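(* Let $\Omega\subset\mathbb{R}^2$ be a compact set that can be covered by at most $|\Omega|+\epsilon_1$ squares $Q_1(m)$, $m\in\mathbb{Z}^2$ ($\epsilon_1\ge0$). Let $\varphi\in S_0(\mathbb{R})$ with $\|\varphi\|_2=1$, let $N\in\mathbb{N}$ be such that $\alpha_N\ge\tfrac12\ge\alpha_{N+1}$ for the non-increasing positive eigenvalues $\alpha_k$ of $H_{\Omega,\varphi}$, and write $N=|\Omega|+\epsilon_2$. Let $C_\varphi=C_{\varphi,\varphi_0}^2\|\mathcal{V}_{\varphi_0}\varphi_0\|_W\|\varphi\|_{S_0}^2$. Let $\{\lambda_j\}_{j\in\mathbb{N}}$ be a sequence of independent identically distributed random variables uniformly distributed in $\Omega$. Suppose $$\varepsilon<\frac{1}{4(1+6\sqrt2C_\varphi)^2}\quad\text{and}\quad 0\le\nu<\frac12-(1+6\sqrt2C_\varphi)\sqrt\varepsilon,$$ let $r\in\mathbb{N}$ and $A=\frac{r}{|\Omega|}\big(\frac12-\varepsilon-\nu-6\sqrt2C_\varphi\sqrt\varepsilon\big)$. Then, with probability at least $$1-(|\Omega|+\epsilon_2)\exp\Big(-\frac{\nu^2r}{|\Omega|(1+\nu/3)}\Big)-(|\Omega|+\epsilon_1)\exp\Big(-\frac{r}{|\Omega|}(3\ln3-2)\Big),$$ the sampling inequality $$A\|f\|_2^2\le\sum_{j=1}^r|\mathcal{V}_\varphi f(\lambda_j)|^2\le r\|f\|_2^2$$ holds simultaneously for all functions $f$ that are $(\varepsilon,\varphi)$-concentrated in $\Omega$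.
   Context: For $z=(x,\omega)\in\mathbb{R}^2$, $\pi(z)f(t)=f(t-x)e^{2\pi i\omega t}$ and the STFT is $\mathcal{V}_\varphi f(z)=\langle f,\pi(z)\varphi\rangle=\int f(t)\overline{\varphi(t-x)}e^{-2\pi i\omega t}dt$. The localization operator is $H_{\Omega,\varphi}f=\iint_\Omega\mathcal{V}_\varphi f(z)\pi(z)\varphi\,dz$, compact and self-adjoint with $\langle H_{\Omega,\varphi}f,f\rangle=\iint_\Omega|\mathcal{V}_\varphi f|^2$. $f\in L^2(\mathbb{R})$ is $(\varepsilon,\varphi)$-concentrated in $\Omega$ if $\langle H_{\Omega,\varphi}f,f\rangle\ge(1-\varepsilon)\|f\|_2^2$. $Q_1(v)=[v_1-\tfrac12,v_1+\tfrac12]\times[v_2-\tfrac12,v_2+\tfrac12]$. Let $\varphi_0(t)=e^{-\pi t^2}$; $S_0(\mathbb{R})=\{f\in L^2:\|f\|_{S_0}=\|\mathcal{V}_{\varphi_0}f\|_{L^1(\mathbb{R}^2)}<\infty\}$. $C_{\varphi,\varphi_0}=\inf\{C>0:\sum_n|b_n|\le C\|\varphi\|_{S_0}$ for a representation $\varphi=\sum_nb_n\pi(z_n)\varphi_0$, $\sum_n|b_n|<\infty$, $z_n\in\mathbb{R}^2\}$, and $\|\mathcal{V}_{\varphi_0}\varphi_0\|_W=\sum_{m\in\mathbb{Z}^2}\operatorname{ess\,sup}_{v\in Q_1(0)}|\mathcal{V}_{\varphi_0}\varphi_0(v+m)|$. *)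

theory Defs
  imports "HOL-Probability.Probability"
begin

text \<open>Functions on the real line are modelled as \<open>real \<Rightarrow> complex\<close>; all
  equalities of L^2 elements are almost-everywhere equalities w.r.t. Lebesgue measure.\<close>

definition L2 :: "(real \<Rightarrow> complex) \<Rightarrow> bool" where
  "L2 f \<longleftrightarrow> f \<in> borel_measurable lborel \<and> integrable lborel (\<lambda>t. (cmod (f t))^2)"

definition L2_norm :: "(real \<Rightarrow> complex) \<Rightarrow> real" where
  "L2_norm f = sqrt (LINT t|lborel. (cmod (f t))^2)"

definition L2_inner :: "(real \<Rightarrow> complex) \<Rightarrow> (real \<Rightarrow> complex) \<Rightarrow> complex" where
  "L2_inner f g = (LINT t|lborel. f t * cnj (g t))"

definition tfshift :: "real \<times> real \<Rightarrow> (real \<Rightarrow> complex) \<Rightarrow> real \<Rightarrow> complex" where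
  "tfshift z f t = f (t - fst z) * cis (2 * pi * snd z * t)"

text \<open>Short-time Fourier transform \<open>V_\<phi> f (z) = \<langle>f, \<pi>(z) \<phi>\<rangle>\<close>.\<close>
definition STFT :: "(real \<Rightarrow> complex) \<Rightarrow> (real \<Rightarrow> complex) \<Rightarrow> real \<times> real \<Rightarrow> complex" where
  "STFT \<phi> f z = (LINT t|lborel. f t * cnj (\<phi> (t - fst z)) * cis (- 2 * pi * snd z * t))"

definition loc_op :: "(real \<times> real) set \<Rightarrow> (real \<Rightarrow> complex) \<Rightarrow> (real \<Rightarrow> complex) \<Rightarrow> real \<Rightarrow> complex" where
  "loc_op \<Omega> \<phi> f t = (LINT z:\<Omega>|lborel. STFT \<phi> f z * tfshift z \<phi> t)"

definition eig_family :: "(real \<times> real) set \<Rightarrow> (real \<Rightarrow> complex) \<Rightarrow> real \<Rightarrow> nat \<Rightarrow> bool" where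
  "eig_family \<Omega> \<phi> \<mu> m \<longleftrightarrow> (\<exists>e :: nat \<Rightarrow> real \<Rightarrow> complex.
      (\<forall>i<m. L2 (e i) \<and> (AE t in lborel. loc_op \<Omega> \<phi> (e i) t = complex_of_real \<mu> * e i t)) \<and>
      (\<forall>i<m. \<forall>j<m. L2_inner (e i) (e j) = (if i = j then 1 else 0)))"

definition eig_mult :: "(real \<times> real) set \<Rightarrow> (real \<Rightarrow> complex) \<Rightarrow> real \<Rightarrow> nat \<Rightarrow> bool" where
  "eig_mult \<Omega> \<phi> \<mu> m \<longleftrightarrow> eig_family \<Omega> \<phi> \<mu> m \<and> \<not> eig_family \<Omega> \<phi> \<mu> (Suc m)"

text \<open>\<open>\<alpha>_1 \<ge> \<alpha>_2 \<ge> \<dots>\<close> (indices \<open>k \<ge> 1\<close>) is the non-increasing enumeration, counted with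
  multiplicity, of the positive eigenvalues of \<open>H_{\<Omega>,\<phi>}\<close> (padded by zeros if there are
  only finitely many).\<close>
definition eigenvalue_seq :: "(real \<times> real) set \<Rightarrow> (real \<Rightarrow> complex) \<Rightarrow> (nat \<Rightarrow> real) \<Rightarrow> bool" where
  "eigenvalue_seq \<Omega> \<phi> \<alpha> \<longleftrightarrow>
     (\<forall>k\<ge>1. \<alpha> k \<ge> 0) \<and> (\<forall>k\<ge>1. \<alpha> (Suc k) \<le> \<alpha> k) \<and>
     (\<forall>\<mu>>0. finite {k. k \<ge> 1 \<and> \<alpha> k = \<mu>} \<and> eig_mult \<Omega> \<phi> \<mu> (card {k. k \<ge> 1 \<and> \<alpha> k = \<mu>}))"

text \<open>\<open>f\<close> is \<open>(\<epsilon>,\<phi>)\<close>-concentrated in \<open>\<Omega>\<close>: \<open>\<langle>H f, f\<rangle> = \<integral>_\<Omega> |V_\<phi> f|^2 \<ge> (1-\<epsilon>) \<parallel>f\<parallel>^2\<close>.\<close>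
definition concentrated :: "real \<Rightarrow> (real \<Rightarrow> complex) \<Rightarrow> (real \<times> real) set \<Rightarrow> (real \<Rightarrow> complex) \<Rightarrow> bool" where
  "concentrated \<epsilon> \<phi> \<Omega> f \<longleftrightarrow> L2 f \<and>
     (LINT z:\<Omega>|lborel. (cmod (STFT \<phi> f z))^2) \<ge> (1 - \<epsilon>) * (L2_norm f)^2"

definition gauss0 :: "real \<Rightarrow> complex" where
  "gauss0 t = complex_of_real (exp (- pi * t^2))"

definition in_S0 :: "(real \<Rightarrow> complex) \<Rightarrow> bool" where
  "in_S0 f \<longleftrightarrow> L2 f \<and> integrable lborel (\<lambda>z::real\<times>real. cmod (STFT gauss0 f z))"

definition S0_norm :: "(real \<Rightarrow> complex) \<Rightarrow> real" where
  "S0_norm f = (LINT z|(lborel :: (real\<times>real) measure). cmod (STFT gauss0 f z))"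

definition gauss_rep :: "(real \<Rightarrow> complex) \<Rightarrow> (nat \<Rightarrow> complex) \<Rightarrow> (nat \<Rightarrow> real \<times> real) \<Rightarrow> bool" where
  "gauss_rep \<phi> b zs \<longleftrightarrow> summable (\<lambda>n. cmod (b n)) \<and>
     (AE t in lborel. \<phi> t = (\<Sum>n. b n * tfshift (zs n) gauss0 t))"

definition C_const :: "(real \<Rightarrow> complex) \<Rightarrow> real" where
  "C_const \<phi> = Inf {C. C > 0 \<and> (\<exists>b zs. gauss_rep \<phi> b zs \<and> (\<Sum>n. cmod (b n)) \<le> C * S0_norm \<phi>)}"

definition Q1 :: "real \<times> real \<Rightarrow> (real \<times> real) set" where
  "Q1 v = {p. \<bar>fst p - fst v\<bar> \<le> 1/2 \<and> \<bar>snd p - snd v\<bar> \<le> 1/2}"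

text \<open>Wiener amalgam norm \<open>\<parallel>F\<parallel>_W = \<Sum>_{m\<in>\<int>^2} ess sup_{v\<in>Q_1(0)} |F(v+m)|\<close>
  (sum of a non-negative family = supremum of its finite partial sums).\<close>
definition W_norm :: "(real \<times> real \<Rightarrow> complex) \<Rightarrow> real" where
  "W_norm F = real_of_ereal (SUP I \<in> {I :: (int \<times> int) set. finite I}.
      \<Sum>m\<in>I. esssup (restrict_space lborel (Q1 (0,0)))
                (\<lambda>v. ereal (cmod (F (v + (real_of_int (fst m), real_of_int (snd m)))))))"

definition C_phi :: "(real \<Rightarrow> complex) \<Rightarrow> real" where
  "C_phi \<phi> = (C_const \<phi>)^2 * W_norm (STFT gauss0 gauss0) * (S0_norm \<phi>)^2"

end

theory Submission
  imports Defs "HOL-Complex_Analysis.Great_Picard"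
begin

text \<open>Split a concentrated \<open>f\<close> as \<open>f1 + f2\<close>, where \<open>f1\<close> lies in the span of the eigenfunctions with the
  first \<open>N\<close> eigenvalues. Since the energy form is at most \<open>1/2\<close> on the orthogonal complement of
  that span, concentration forces \<open>\<parallel>f2\<parallel>^2 \<le> 2 \<epsilon> \<parallel>f\<parallel>^2\<close>. On the span, random sampling is a random
  \<open>N \<times> N\<close> Gram matrix \<open>S\<close>, a sum of independent rank-one matrices with mean at least
  \<open>r / (2 |\<Omega>|)\<close>, and a matrix Chernoff bound controls its smallest eigenvalue. The samples of \<open>f2\<close> are
  controlled by counting: a scalar Chernoff bound allows at most \<open>3 r / |\<Omega>|\<close> samples in each covering
  square, and sampling \<open>V f2\<close> at one point of each square is a Bessel system, because \<open>\<phi>\<close> is an absolutely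
  summable combination of shifted Gaussians, whose Gram matrix decays (Schur test).

  The matrix Chernoff bound avoids the Golden--Thompson inequality. Its potential is
  \<open>tr (I - \<theta> S / m)^m\<close> for large \<open>m\<close> instead of \<open>tr exp (- \<theta> S)\<close>, and one rank-one step is
  estimated by differentiating along the segment to the new matrix and using that the moments
  \<open>k \<mapsto> \<langle>u, A^k u\<rangle>\<close> of a positive definite matrix are logarithmically convex.\<close>

section \<open>A matrix Chernoff bound\<close>

text \<open>Two features of the data shape the proof. \<open>C_const \<phi>\<close> is an infimum
  that is not known to be attained, so every estimate is made for an arbitrary Gaussian series with
  coefficient sum \<open>B\<close>, and the infimum is taken only afterwards. The window
  \<open>\<phi>\<close> is given only almost everywhere, while equicontinuity and Fubini arguments
  want a continuous, bounded, integrable window; the sum of such a series supplies one, and the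
  spectral hypothesis is transferred to it. The term
  \<open>6 * sqrt 2 * C_phi \<phi> * sqrt \<epsilon>\<close> is a cross term
  \<open>2 * a0 * b0\<close>. With \<open>\<parallel>f\<parallel> = 1\<close> and
  \<open>\<rho> = r / |\<Omega>|\<close> one has \<open>a0^2 \<le> \<rho> / 2\<close> and
  \<open>b0^2 \<le> 36 \<rho> C^2 \<epsilon>\<close>, where 36 is 3 (samples per square) times 2
  (from the splitting) times 6. This last 6 comes from bounding the Bessel constant by
  \<open>6 * C_phi^2\<close>, which requires numerical lower bounds for the factors of
  \<open>C_phi\<close>. Powers of a matrix are iterated matrix-vector products, and only their
  moments and traces enter; no diagonalization is used.\<close>

definition hdot :: "nat \<Rightarrow> (nat \<Rightarrow> complex) \<Rightarrow> (nat \<Rightarrow> complex) \<Rightarrow> complex" where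
  "hdot n x y = (\<Sum>i<n. cnj (x i) * y i)"

definition mv :: "nat \<Rightarrow> (nat \<Rightarrow> nat \<Rightarrow> complex) \<Rightarrow> (nat \<Rightarrow> complex) \<Rightarrow> nat \<Rightarrow> complex" where
  "mv n A x i = (\<Sum>j<n. A i j * x j)"

definition hermitian :: "nat \<Rightarrow> (nat \<Rightarrow> nat \<Rightarrow> complex) \<Rightarrow> bool" where
  "hermitian n A \<longleftrightarrow> (\<forall>i<n. \<forall>j<n. A i j = cnj (A j i))"

text \<open>The moment of order \<open>k\<close> of \<open>A\<close> at \<open>x\<close>. For
  \<open>k = 0\<close> it is the squared norm, whatever \<open>A\<close> is, so operator bounds can
  be written as inequalities between the orders 0 and 1.\<close>

definition qform :: "nat \<Rightarrow> (nat \<Rightarrow> nat \<Rightarrow> complex) \<Rightarrow> nat \<Rightarrow> (nat \<Rightarrow> complex) \<Rightarrow> real" where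
  "qform n A k x = Re (hdot n x ((mv n A ^^ k) x))"

definition trace_pow :: "nat \<Rightarrow> (nat \<Rightarrow> nat \<Rightarrow> complex) \<Rightarrow> nat \<Rightarrow> real" where
  "trace_pow n A k = (\<Sum>i<n. Re ((mv n A ^^ k) (\<lambda>j. of_bool (j = i)) i))"

section \<open>Hermitian matrices and the moments of a vector\<close>

lemma hdot_cnj: "cnj (hdot n x y) = hdot n y x"
  by (simp add: hdot_def mult.commute)

lemma hdot_add_right: "hdot n x (\<lambda>i. y i + z i) = hdot n x y + hdot n x z"
  by (simp add: hdot_def sum.distrib distrib_left)

lemma hdot_add_left: "hdot n (\<lambda>i. y i + z i) x = hdot n y x + hdot n z x"
  by (simp add: hdot_def sum.distrib distrib_right)

lemma hdot_scale_right: "hdot n x (\<lambda>i. c * y i) = c * hdot n x y"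
  by (simp add: hdot_def sum_distrib_left mult_ac)

lemma hdot_scale_left: "hdot n (\<lambda>i. c * y i) x = cnj c * hdot n y x"
  by (simp add: hdot_def sum_distrib_left mult_ac)

lemma hdot_self: "hdot n x x = complex_of_real (\<Sum>i<n. (cmod (x i))^2)"
  unfolding hdot_def of_real_sum
  by (intro sum.cong refl) (metis complex_norm_square mult.commute of_real_power)

lemma Re_hdot_self: "Re (hdot n x x) = (\<Sum>i<n. (cmod (x i))^2)"
  by (simp add: hdot_self)

lemma hdot_unit: "i < n \<Longrightarrow> hdot n (\<lambda>j. of_bool (j = i)) x = x i"
proof -
  assume i: "i < n"
  have "hdot n (\<lambda>j. of_bool (j = i)) x = (\<Sum>j<n. if j = i then x j else 0)"
    unfolding hdot_def by (intro sum.cong) auto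
  then show ?thesis using i by simp
qed

lemma hdot_cong: "(\<And>i. i < n \<Longrightarrow> x i = x' i) \<Longrightarrow> (\<And>i. i < n \<Longrightarrow> y i = y' i) \<Longrightarrow> hdot n x y = hdot n x' y'"
  by (simp add: hdot_def)

lemma mv_add: "mv n A (\<lambda>i. x i + y i) = (\<lambda>i. mv n A x i + mv n A y i)"
  by (rule ext) (simp add: mv_def sum.distrib distrib_left)

lemma mv_scale: "mv n A (\<lambda>i. c * x i) = (\<lambda>i. c * mv n A x i)"
  by (rule ext) (simp add: mv_def sum_distrib_left mult_ac)

lemma mv_pow_add: "(mv n A ^^ k) (\<lambda>i. x i + y i) = (\<lambda>i. (mv n A ^^ k) x i + (mv n A ^^ k) y i)"
  by (induction k) (simp_all add: mv_add)

lemma mv_pow_scale: "(mv n A ^^ k) (\<lambda>i. c * x i) = (\<lambda>i. c * (mv n A ^^ k) x i)"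
  by (induction k) (simp_all add: mv_scale)

lemma hermitian_hdot:
  assumes "hermitian n A"
  shows "hdot n x (mv n A y) = hdot n (mv n A x) y"
proof -
  have "hdot n x (mv n A y) = (\<Sum>i<n. \<Sum>j<n. cnj (x i) * (A i j * y j))"
    by (simp add: hdot_def mv_def sum_distrib_left)
  also have "\<dots> = (\<Sum>j<n. \<Sum>i<n. cnj (x i) * (A i j * y j))"
    by (rule sum.swap)
  also have "\<dots> = (\<Sum>j<n. \<Sum>i<n. cnj (A j i * x i) * y j)"
  proof (intro sum.cong refl)
    fix i j assume "j \<in> {..<n}" "i \<in> {..<n}"
    then have "A i j = cnj (A j i)" using assms unfolding hermitian_def by blast
    then show "cnj (x i) * (A i j * y j) = cnj (A j i * x i) * y j" by (simp only: complex_cnj_mult mult_ac)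
  qed
  also have "\<dots> = hdot n (mv n A x) y"
    by (simp add: hdot_def mv_def sum_distrib_right)
  finally show ?thesis .
qed

lemma hermitian_hdot_pow:
  assumes "hermitian n A"
  shows "hdot n ((mv n A ^^ a) x) ((mv n A ^^ b) y) = hdot n x ((mv n A ^^ (a + b)) y)"
proof (induction a arbitrary: b)
  case (Suc a)
  have "hdot n ((mv n A ^^ Suc a) x) ((mv n A ^^ b) y)
      = hdot n ((mv n A ^^ a) x) ((mv n A ^^ Suc b) y)"
    using hermitian_hdot[OF assms] by simp
  with Suc show ?case by (metis add_Suc_shift)
qed simp

lemma hermitian_hdot_pow_Reals:
  assumes "hermitian n A"
  shows "hdot n x ((mv n A ^^ k) x) = of_real (qform n A k x)"
proof -
  have "cnj (hdot n x ((mv n A ^^ k) x)) = hdot n x ((mv n A ^^ k) x)"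
    using hermitian_hdot_pow[OF assms, of k x 0 x] by (simp add: hdot_cnj)
  from arg_cong[OF this, of Im] have "Im (hdot n x ((mv n A ^^ k) x)) = 0"
    by simp
  then show ?thesis by (simp add: qform_def complex_eq_iff)
qed

lemma qform_0: "qform n A 0 x = (\<Sum>i<n. (cmod (x i))^2)"
  by (simp add: qform_def Re_hdot_self)

lemma qform_even:
  assumes "hermitian n A"
  shows "qform n A (2 * j) x = (\<Sum>i<n. (cmod ((mv n A ^^ j) x i))^2)"
  using hermitian_hdot_pow[OF assms, of j x j x] unfolding qform_def mult_2
  by (simp only: Re_hdot_self[symmetric])

text \<open>Half of the even part moves to the left argument of the inner product. This reduces
  statements about all moments to the orders 0 and 1, taken at another vector.\<close>

lemma qform_plus_even:
  assumes "hermitian n A"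
  shows "qform n A (2 * j + k) x = qform n A k ((mv n A ^^ j) x)"
proof -
  have "hdot n ((mv n A ^^ j) x) ((mv n A ^^ k) ((mv n A ^^ j) x)) = hdot n ((mv n A ^^ j) x) ((mv n A ^^ (k + j)) x)"
    unfolding funpow_add o_apply ..
  also have "\<dots> = hdot n x ((mv n A ^^ (j + (k + j))) x)"
    by (rule hermitian_hdot_pow[OF assms])
  also have "j + (k + j) = 2 * j + k" by simp
  finally show ?thesis unfolding qform_def by simp
qed

lemma qform_nonneg:
  assumes "hermitian n A" and psd: "\<And>x. 0 \<le> qform n A 1 x"
  shows "0 \<le> qform n A k x"
proof -
  obtain j b where k: "k = 2 * j + b" "b = 0 \<or> b = 1"
    using that[of "k div 2" 0] that[of "k div 2" 1] by (cases "even k") auto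
  show ?thesis unfolding k(1) qform_plus_even[OF assms(1)]
    using k(2) psd by (auto simp: qform_0 sum_nonneg)
qed

text \<open>For real \<open>t\<close> the moment of order \<open>k\<close> at
  \<open>x + t A x\<close> is a nonnegative quadratic polynomial whose coefficients are three
  consecutive moments of \<open>x\<close>; the claim is the sign of its discriminant.\<close>

lemma qform_log_convex:
  assumes "hermitian n A" and psd: "\<And>x. 0 \<le> qform n A 1 x"
  shows "(qform n A (Suc k) x)^2 \<le> qform n A k x * qform n A (Suc (Suc k)) x"
proof -
  let ?P = "\<lambda>k x. (mv n A ^^ k) x" and ?y = "mv n A x"
  have Py: "?P k ?y = ?P (Suc k) x" for k
    unfolding funpow_Suc_right o_apply ..
  have ex: "qform n A k (\<lambda>i. x i + of_real t * ?y i)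
      = qform n A k x + 2 * t * qform n A (Suc k) x + t^2 * qform n A (Suc (Suc k)) x" for t :: real
  proof -
    have a: "hdot n x (?P k ?y) = of_real (qform n A (Suc k) x)"
      unfolding Py by (rule hermitian_hdot_pow_Reals[OF assms(1)])
    have b: "hdot n ?y (?P k x) = of_real (qform n A (Suc k) x)"
      using hermitian_hdot_pow[OF assms(1), of 1 x k x] hermitian_hdot_pow_Reals[OF assms(1), of x "Suc k"]
      by simp
    have c: "hdot n ?y (?P k ?y) = of_real (qform n A (Suc (Suc k)) x)"
      using hermitian_hdot_pow[OF assms(1), of 1 x "Suc k" x] hermitian_hdot_pow_Reals[OF assms(1), of x "Suc (Suc k)"]
      unfolding Py by simp
    show ?thesis
      unfolding qform_def[of n A k "\<lambda>i. x i + of_real t * ?y i"] mv_pow_add mv_pow_scale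
        hdot_add_right hdot_add_left hdot_scale_left hdot_scale_right a b c
        hermitian_hdot_pow_Reals[OF assms(1), of x k]
      by (simp add: power2_eq_square algebra_simps)
  qed
  have nn: "0 \<le> qform n A k x + 2 * t * qform n A (Suc k) x + t^2 * qform n A (Suc (Suc k)) x" for t
    using qform_nonneg[OF assms, of k] by (subst ex[symmetric])
  show ?thesis
  proof (cases "qform n A (Suc (Suc k)) x = 0")
    case True
    have "qform n A (Suc k) x = 0"
    proof (rule ccontr)
      assume *: "qform n A (Suc k) x \<noteq> 0"
      \<comment> \<open>The polynomial is now affine with nonzero slope, and at this
        \<open>t\<close> it takes the value -1.\<close>
      show False
        using nn[of "- (qform n A k x + 1) / (2 * qform n A (Suc k) x)"] True *
        by (simp add: field_simps)
    qed
    then show ?thesis using True by simp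
  next
    case False
    then have pos: "qform n A (Suc (Suc k)) x > 0"
      using qform_nonneg[OF assms, of "Suc (Suc k)" x] by linarith
    show ?thesis
      using nn[of "- qform n A (Suc k) x / qform n A (Suc (Suc k)) x"] pos
      by (simp add: field_simps power2_eq_square)
  qed
qed

text \<open>Log-convexity means that the quotients \<open>c (Suc k) / c k\<close> increase. This is
  kept in cross-multiplied form in \<open>ratio\<close>, and then \<open>b\<close> factors are
  traded one at a time.\<close>

lemma log_convex_seq:
  fixes c :: "nat \<Rightarrow> real"
  assumes pos: "\<And>k. 0 < c k" and lc: "\<And>k. (c (Suc k))^2 \<le> c k * c (Suc (Suc k))"
  shows "c a * c b \<le> c 0 * c (a + b)"
proof -
  have ratio: "c (Suc b) * c (a + b) \<le> c b * c (Suc (a + b))" for a b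
  proof (induction a)
    case (Suc a)
    have "c (Suc b) * c (Suc (a + b)) * c (a + b) \<le> (c b * c (Suc (a + b))) * c (Suc (a + b))"
      using Suc pos[of "Suc (a + b)"] by (simp add: mult_ac mult_left_mono)
    also have "\<dots> = c b * (c (Suc (a + b)))^2" by (simp add: power2_eq_square)
    also have "\<dots> \<le> c b * (c (a + b) * c (Suc (Suc (a + b))))"
      using lc pos[of b] by (intro mult_left_mono) (auto intro: less_imp_le)
    finally have "c (a + b) * (c (Suc b) * c (Suc (a + b))) \<le> c (a + b) * (c b * c (Suc (Suc (a + b))))"
      by (simp add: mult_ac)
    then show ?case using pos[of "a + b"] by simp
  qed simp
  show ?thesis
  proof (induction b)
    case (Suc b)
    have "c b * (c a * c (Suc b)) = (c a * c b) * c (Suc b)" by simp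
    also have "\<dots> \<le> (c 0 * c (a + b)) * c (Suc b)"
      using Suc pos[of "Suc b"] by (intro mult_right_mono) (auto intro: less_imp_le)
    also have "\<dots> \<le> c 0 * (c b * c (Suc (a + b)))"
      using ratio[of b a] pos[of 0] by (simp add: mult_ac mult_left_mono)
    finally have "c b * (c a * c (Suc b)) \<le> c b * (c 0 * c (Suc (a + b)))" by (simp add: mult_ac)
    then show ?case using pos[of b] by simp
  qed simp
qed

section \<open>Differentiating powers and traces along a rank-one segment\<close>

definition rank1_diff :: "(nat \<Rightarrow> nat \<Rightarrow> complex) \<Rightarrow> real \<Rightarrow> (nat \<Rightarrow> complex) \<Rightarrow> nat \<Rightarrow> nat \<Rightarrow> complex" where
  "rank1_diff T s u i j = T i j - of_real s * (u i * cnj (u j))"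

lemma mv_rank1_diff: "mv n (rank1_diff T s u) x i = mv n T x i - of_real s * (hdot n u x * u i)"
proof -
  have "mv n (rank1_diff T s u) x i = (\<Sum>j<n. T i j * x j - of_real s * u i * (cnj (u j) * x j))"
    unfolding mv_def rank1_diff_def by (intro sum.cong refl) (simp add: algebra_simps)
  also have "\<dots> = mv n T x i - of_real s * u i * hdot n u x"
    unfolding mv_def hdot_def by (simp add: sum_subtractf sum_distrib_left)
  finally show ?thesis by (simp add: mult_ac)
qed

lemma hermitian_rank1_diff: "hermitian n T \<Longrightarrow> hermitian n (rank1_diff T s u)"
  unfolding hermitian_def rank1_diff_def
  by (metis complex_cnj_cnj complex_cnj_complex_of_real complex_cnj_diff complex_cnj_mult mult.commute)

lemma qform_rank1_diff: "qform n (rank1_diff T s u) 1 x = qform n T 1 x - s * (cmod (hdot n u x))^2"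
proof -
  have "hdot n x (mv n (rank1_diff T s u) x) = hdot n x (mv n T x) - of_real s * (hdot n u x * hdot n x u)"
  proof -
    have "hdot n x (mv n (rank1_diff T s u) x) = hdot n x (\<lambda>i. mv n T x i + (- of_real s * hdot n u x) * u i)"
      by (intro hdot_cong) (simp_all add: mv_rank1_diff)
    then show ?thesis unfolding hdot_add_right hdot_scale_right by simp
  qed
  moreover have "hdot n u x * hdot n x u = of_real ((cmod (hdot n u x))^2)"
    by (metis hdot_cnj complex_norm_square of_real_power)
  ultimately show ?thesis by (simp add: qform_def)
qed

text \<open>Product rule for a power of a matrix whose derivative is minus the projection-like
  matrix of \<open>u\<close>: the summand \<open>a\<close> has \<open>a\<close> factors to the left
  of the differentiated one. In the induction the outermost factor gives the summand
  \<open>a = 0\<close>, and applying \<open>A\<close> to the old derivative shifts the others by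
  one.\<close>

lemma has_vector_derivative_mv_pow:
  fixes T u x k
  defines "A \<equiv> \<lambda>s. rank1_diff T s u"
  shows "((\<lambda>s. (mv n (A s) ^^ k) x i) has_vector_derivative
     - (\<Sum>a<k. hdot n u ((mv n (A s) ^^ (k - 1 - a)) x) * (mv n (A s) ^^ a) u i)) (at s)"
proof (induction k arbitrary: i)
  case (Suc k)
  let ?y = "\<lambda>s. (mv n (A s) ^^ k) x"
  let ?d = "\<lambda>i. - (\<Sum>a<k. hdot n u ((mv n (A s) ^^ (k - 1 - a)) x) * (mv n (A s) ^^ a) u i)"
  have A': "((\<lambda>s. A s i j) has_vector_derivative - (u i * cnj (u j))) (at s)" for i j
    unfolding A_def rank1_diff_def
    unfolding has_vector_derivative_def
    by (auto intro!: derivative_eq_intros simp: scaleR_conv_of_real)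
  have "((\<lambda>s. \<Sum>j<n. A s i j * ?y s j) has_vector_derivative
      (\<Sum>j<n. A s i j * ?d j + - (u i * cnj (u j)) * ?y s j)) (at s)"
    by (intro derivative_intros A' Suc)
  moreover have "(\<Sum>j<n. A s i j * ?d j + - (u i * cnj (u j)) * ?y s j)
      = - (\<Sum>a<Suc k. hdot n u ((mv n (A s) ^^ (Suc k - 1 - a)) x) * (mv n (A s) ^^ a) u i)"
  proof -
    have "(\<Sum>j<n. A s i j * ?d j) = - (\<Sum>j<n. \<Sum>a<k. A s i j * (hdot n u ((mv n (A s) ^^ (k - 1 - a)) x) * (mv n (A s) ^^ a) u j))"
      by (simp add: sum_negf sum_distrib_left)
    also have "\<dots> = - (\<Sum>a<k. \<Sum>j<n. A s i j * (hdot n u ((mv n (A s) ^^ (k - 1 - a)) x) * (mv n (A s) ^^ a) u j))"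
      by (subst sum.swap) simp
    also have "\<dots> = - (\<Sum>a<k. hdot n u ((mv n (A s) ^^ (k - 1 - a)) x) * mv n (A s) ((mv n (A s) ^^ a) u) i)"
      unfolding mv_def[of n "A s" "(mv n (A s) ^^ a) u" i for a] by (simp add: sum_distrib_left mult_ac)
    finally have 1: "(\<Sum>j<n. A s i j * ?d j) = \<dots>" .
    have 2: "(\<Sum>j<n. - (u i * cnj (u j)) * ?y s j) = - (hdot n u (?y s) * u i)"
      unfolding hdot_def by (simp add: sum_negf sum_distrib_left sum_distrib_right mult_ac)
    show ?thesis
      unfolding sum.distrib 1 2 by (subst sum.lessThan_Suc_shift) simp
  qed
  ultimately show ?case by (simp add: mv_def[of n "A _" _ i])
qed simp

lemma has_real_derivative_qform:
  fixes T u k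
  defines "A \<equiv> \<lambda>s. rank1_diff T s u"
  assumes "hermitian n T"
  shows "((\<lambda>s. qform n (A s) k u) has_real_derivative
     - (\<Sum>a<k. qform n (A s) a u * qform n (A s) (k - 1 - a) u)) (at s)"
proof -
  have H: "hermitian n (A s)" unfolding A_def by (rule hermitian_rank1_diff[OF assms(2)])
  have "((\<lambda>s. \<Sum>i<n. cnj (u i) * (mv n (A s) ^^ k) u i) has_vector_derivative
     (\<Sum>i<n. cnj (u i) * - (\<Sum>a<k. hdot n u ((mv n (A s) ^^ (k - 1 - a)) u) * (mv n (A s) ^^ a) u i))) (at s)"
    unfolding A_def by (intro derivative_intros has_vector_derivative_mult_right has_vector_derivative_mv_pow)
  moreover have "(\<Sum>i<n. cnj (u i) * - (\<Sum>a<k. hdot n u ((mv n (A s) ^^ (k - 1 - a)) u) * (mv n (A s) ^^ a) u i))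
     = of_real (- (\<Sum>a<k. qform n (A s) a u * qform n (A s) (k - 1 - a) u))"
  proof -
    have "(\<Sum>i<n. cnj (u i) * - (\<Sum>a<k. hdot n u ((mv n (A s) ^^ (k - 1 - a)) u) * (mv n (A s) ^^ a) u i))
      = - (\<Sum>i<n. \<Sum>a<k. cnj (u i) * (hdot n u ((mv n (A s) ^^ (k - 1 - a)) u) * (mv n (A s) ^^ a) u i))"
      by (simp add: sum_negf sum_distrib_left)
    also have "\<dots> = - (\<Sum>a<k. \<Sum>i<n. cnj (u i) * (hdot n u ((mv n (A s) ^^ (k - 1 - a)) u) * (mv n (A s) ^^ a) u i))"
      by (subst sum.swap) simp
    also have "\<dots> = - (\<Sum>a<k. hdot n u ((mv n (A s) ^^ (k - 1 - a)) u) * hdot n u ((mv n (A s) ^^ a) u))"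
    proof (intro arg_cong[of _ _ uminus] sum.cong refl)
      fix a
      show "(\<Sum>i<n. cnj (u i) * (hdot n u ((mv n (A s) ^^ (k - 1 - a)) u) * (mv n (A s) ^^ a) u i))
        = hdot n u ((mv n (A s) ^^ (k - 1 - a)) u) * hdot n u ((mv n (A s) ^^ a) u)"
        unfolding hdot_def[of n u "(mv n (A s) ^^ a) u"] sum_distrib_left by (simp only: mult_ac)
    qed
    also have "\<dots> = of_real (- (\<Sum>a<k. qform n (A s) a u * qform n (A s) (k - 1 - a) u))"
      by (simp add: hermitian_hdot_pow_Reals[OF H] mult.commute)
    finally show ?thesis .
  qed
  ultimately have "((\<lambda>s. hdot n u ((mv n (A s) ^^ k) u)) has_vector_derivative
     of_real (- (\<Sum>a<k. qform n (A s) a u * qform n (A s) (k - 1 - a) u))) (at s)"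
    by (simp add: hdot_def)
  from has_derivative_Re[OF this[unfolded has_vector_derivative_def]]
  show ?thesis unfolding qform_def[of n "A _" k u] has_real_derivative_iff_has_vector_derivative has_vector_derivative_def
    by (simp add: mult_ac)
qed

text \<open>Cyclicity of the trace makes all \<open>k\<close> summands of the product rule equal:
  each is the moment of order \<open>k - 1\<close> at \<open>u\<close>.\<close>

lemma has_real_derivative_trace_pow:
  fixes T u k
  defines "A \<equiv> \<lambda>s. rank1_diff T s u"
  assumes "hermitian n T"
  shows "((\<lambda>s. trace_pow n (A s) k) has_real_derivative - (real k * qform n (A s) (k - 1) u)) (at s)"
proof -
  have H: "hermitian n (A s)" unfolding A_def by (rule hermitian_rank1_diff[OF assms(2)])
  let ?e = "\<lambda>i j. of_bool (j = i)"
  have "((\<lambda>s. \<Sum>i<n. (mv n (A s) ^^ k) (?e i) i) has_vector_derivative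
     (\<Sum>i<n. - (\<Sum>a<k. hdot n u ((mv n (A s) ^^ (k - 1 - a)) (?e i)) * (mv n (A s) ^^ a) u i))) (at s)"
    unfolding A_def by (intro derivative_intros has_vector_derivative_mv_pow)
  moreover have "(\<Sum>i<n. - (\<Sum>a<k. hdot n u ((mv n (A s) ^^ (k - 1 - a)) (?e i)) * (mv n (A s) ^^ a) u i))
     = of_real (- (real k * qform n (A s) (k - 1) u))"
  proof -
    have h: "hdot n u ((mv n (A s) ^^ b) (?e i)) = cnj ((mv n (A s) ^^ b) u i)" if "i < n" for b i
      using hermitian_hdot_pow[OF H, of b u 0 "?e i"] hdot_unit[OF that, of "(mv n (A s) ^^ b) u"]
      by (metis add.right_neutral funpow_0 hdot_cnj)
    have "(\<Sum>i<n. - (\<Sum>a<k. hdot n u ((mv n (A s) ^^ (k - 1 - a)) (?e i)) * (mv n (A s) ^^ a) u i))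
      = - (\<Sum>i<n. \<Sum>a<k. cnj ((mv n (A s) ^^ (k - 1 - a)) u i) * (mv n (A s) ^^ a) u i)"
      unfolding sum_negf by (intro arg_cong[of _ _ uminus] sum.cong refl) (simp only: h lessThan_iff)
    also have "\<dots> = - (\<Sum>a<k. hdot n ((mv n (A s) ^^ (k - 1 - a)) u) ((mv n (A s) ^^ a) u))"
      unfolding hdot_def by (subst sum.swap) simp
    also have "\<dots> = - (\<Sum>a<k. hdot n u ((mv n (A s) ^^ (k - 1)) u))"
    proof (intro arg_cong[of _ _ uminus] sum.cong refl)
      fix a assume "a \<in> {..<k}"
      then have "k - 1 - a + a = k - 1" by simp
      then show "hdot n ((mv n (A s) ^^ (k - 1 - a)) u) ((mv n (A s) ^^ a) u) = hdot n u ((mv n (A s) ^^ (k - 1)) u)"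
        by (metis hermitian_hdot_pow[OF H])
    qed
    also have "\<dots> = of_real (- (real k * qform n (A s) (k - 1) u))"
      unfolding hermitian_hdot_pow_Reals[OF H] by simp
    finally show ?thesis .
  qed
  ultimately have "((\<lambda>s. \<Sum>i<n. (mv n (A s) ^^ k) (?e i) i) has_vector_derivative
     of_real (- (real k * qform n (A s) (k - 1) u))) (at s)" by simp
  from has_derivative_Re[OF this[unfolded has_vector_derivative_def]]
  show ?thesis unfolding trace_pow_def has_real_derivative_iff_has_vector_derivative has_vector_derivative_def
    by (simp add: mult_ac)
qed

text \<open>For even \<open>k\<close> this is the hypothesis at the vector \<open>A^(k/2) x\<close>.
  For odd \<open>k\<close> the next order is even, so the inequality is known one step higher, and
  log-convexity carries it down.\<close>

lemma qform_contract:
  assumes "hermitian n A" and psd: "\<And>x. 0 \<le> qform n A 1 x" and le: "\<And>x. qform n A 1 x \<le> qform n A 0 x"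
  shows "qform n A (Suc k) x \<le> qform n A k x"
proof (cases "even k")
  case True
  then obtain j where "k = 2 * j" by (elim evenE)
  then show ?thesis
    using le qform_plus_even[OF assms(1), of j 1] qform_plus_even[OF assms(1), of j 0] by simp
next
  case False
  then obtain j where k: "Suc k = 2 * j" by (metis even_Suc evenE)
  have le': "qform n A (Suc (Suc k)) x \<le> qform n A (Suc k) x"
    using le qform_plus_even[OF assms(1), of j 1 x] qform_plus_even[OF assms(1), of j 0 x] unfolding k by simp
  have "(qform n A (Suc k) x)^2 \<le> qform n A k x * qform n A (Suc (Suc k)) x"
    by (rule qform_log_convex[OF assms(1) psd])
  also have "\<dots> \<le> qform n A k x * qform n A (Suc k) x"
    using qform_nonneg[OF assms(1) psd] le' by (intro mult_left_mono)
  finally have "qform n A (Suc k) x * qform n A (Suc k) x \<le> qform n A k x * qform n A (Suc k) x"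
    by (simp add: power2_eq_square)
  then show ?thesis
    using qform_nonneg[OF assms(1) psd, of "Suc k" x] qform_nonneg[OF assms(1) psd, of k x]
    by (cases "qform n A (Suc k) x = 0") (auto simp: mult_le_cancel_right)
qed

text \<open>The lower bound \<open>\<rho>\<close> makes all moments strictly positive, as
  \<open>log_convex_seq\<close> demands, unless \<open>x\<close> vanishes on the first
  \<open>n\<close> coordinates, when every moment is 0. The second claim is the first one for the
  orders 1 and \<open>k\<close>.\<close>

lemma qform_product_bounds:
  assumes "hermitian n A" and "0 < \<rho>" and lb: "\<And>x. \<rho> * qform n A 0 x \<le> qform n A 1 x"
  shows "qform n A a x * qform n A b x \<le> qform n A 0 x * qform n A (a + b) x"
    and "\<rho> * qform n A k x \<le> qform n A (Suc k) x"
proof -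
  have psd: "0 \<le> qform n A 1 x" for x
    using lb[of x] \<open>0 < \<rho>\<close> by (smt (verit) qform_0 sum_nonneg zero_le_power2 mult_nonneg_nonneg)
  note nn = qform_nonneg[OF assms(1) psd]
  have "qform n A a x * qform n A b x \<le> qform n A 0 x * qform n A (a + b) x \<and> \<rho> * qform n A k x \<le> qform n A (Suc k) x"
  proof (cases "qform n A 0 x = 0")
    case True
    then have "x i = 0" if "i < n" for i using that
      unfolding qform_0 by (subst (asm) sum_nonneg_eq_0_iff) auto
    then have "qform n A k x = 0" for k unfolding qform_def hdot_def by simp
    then show ?thesis by simp
  next
    case False
    have pos: "0 < qform n A k x \<and> 0 < qform n A (Suc k) x" for k
    proof (induction k)
      case 0
      have "0 < qform n A 0 x" using False nn[of 0 x] by simp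
      moreover from this have "0 < \<rho> * qform n A 0 x" using \<open>0 < \<rho>\<close> by simp
      ultimately show ?case using lb[of x] by simp
    next
      case (Suc k)
      then have "0 < (qform n A (Suc k) x)^2" by simp
      also have "\<dots> \<le> qform n A k x * qform n A (Suc (Suc k)) x"
        by (rule qform_log_convex[OF assms(1) psd])
      finally show ?case using Suc by (simp add: zero_less_mult_iff)
    qed
    then have lc: "qform n A a x * qform n A b x \<le> qform n A 0 x * qform n A (a + b) x" for a b
      using log_convex_seq[of "\<lambda>k. qform n A k x"] qform_log_convex[OF assms(1) psd] by blast
    have "(\<rho> * qform n A k x) * qform n A 0 x \<le> qform n A 1 x * qform n A k x"
      using mult_right_mono[OF lb nn, of x k x] by (simp add: mult_ac)
    also have "\<dots> \<le> qform n A (Suc k) x * qform n A 0 x"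
      using lc[of 1 k] by (simp add: mult_ac)
    finally show ?thesis using lc pos by simp
  qed
  then show "qform n A a x * qform n A b x \<le> qform n A 0 x * qform n A (a + b) x"
    and "\<rho> * qform n A k x \<le> qform n A (Suc k) x" by blast+
qed

text \<open>Along \<open>A s = T - s u u\<^sup>*\<close> the derivative of \<open>tr A^m\<close> is \<open>- m q\<close> with \<open>q = \<langle>u, A^(m - 1) u\<rangle>\<close>, and
  log-convexity of the moments yields \<open>q' \<ge> - l q\<close>, hence \<open>q s \<ge> q 0 * exp (- l s)\<close>.\<close>
lemma trace_pow_rank1_diff_le:
  fixes T u m \<eta> \<rho>
  defines "l \<equiv> real m * \<eta> / \<rho>"
  assumes T: "hermitian n T" and ub: "\<And>x. qform n T 1 x \<le> qform n T 0 x"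
    and lb: "\<And>x. \<rho> * qform n T 0 x \<le> qform n (rank1_diff T 1 u) 1 x"
    and "0 < \<rho>" "m > 0" "0 < \<eta>" and u: "qform n T 0 u \<le> \<eta>"
  shows "trace_pow n (rank1_diff T 1 u) m \<le> trace_pow n T m - m * (1 - exp (- l)) / l * qform n T m u"
proof -
  have l: "l > 0" unfolding l_def using assms by simp
  define A where "A s = rank1_diff T s u" for s
  have H: "hermitian n (A s)" for s unfolding A_def by (rule hermitian_rank1_diff[OF T])
  have z: "qform n (A s) 0 x = qform n T 0 x" for s x by (simp add: qform_0)
  have A0: "A 0 = T" unfolding A_def rank1_diff_def by simp
  have lbs: "\<rho> * qform n (A s) 0 x \<le> qform n (A s) 1 x" if "s \<le> 1" for s x
  proof -
    have "s * (cmod (hdot n u x))^2 \<le> 1 * (cmod (hdot n u x))^2" using that by (intro mult_right_mono) auto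
    then show ?thesis using lb[of x] unfolding z unfolding A_def qform_rank1_diff by simp
  qed
  have ubs: "qform n (A s) 1 x \<le> qform n (A s) 0 x" if "0 \<le> s" for s x
  proof -
    have "0 \<le> s * (cmod (hdot n u x))^2" using that by simp
    then show ?thesis using ub[of x] unfolding z unfolding A_def qform_rank1_diff by simp
  qed
  have psd: "0 \<le> qform n (A s) 1 x" if "s \<le> 1" for s x
    using lbs[OF that, of x] \<open>0 < \<rho>\<close> by (smt (verit) qform_0 sum_nonneg zero_le_power2 mult_nonneg_nonneg)
  define q where "q s = qform n (A s) (m - 1) u" for s
  define d where "d s = - (\<Sum>a<m - 1. qform n (A s) a u * qform n (A s) (m - 1 - 1 - a) u)" for s
  have dq: "(q has_real_derivative d s) (at s)" for s
    unfolding q_def[abs_def] d_def A_def by (rule has_real_derivative_qform[OF T])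
  have dge: "d s \<ge> - l * q s" if "0 \<le> s" "s \<le> 1" for s
  proof -
    have qn: "0 \<le> q s" unfolding q_def by (rule qform_nonneg[OF H psd[OF that(2)]])
    \<comment> \<open>The product bound merges two moments into \<open>\<eta>\<close> times the
      moment of order \<open>m - 2\<close>, and \<open>\<rho>\<close> raises that order to
      \<open>m - 1\<close>, which is \<open>q s\<close>. There are \<open>m - 1 \<le> m\<close> such
      terms, hence the rate \<open>l\<close>.\<close>
    have "(\<Sum>a<m - 1. qform n (A s) a u * qform n (A s) (m - 1 - 1 - a) u) \<le> (\<Sum>a<m - 1. \<eta> * (q s / \<rho>))"
    proof (rule sum_mono)
      fix a assume a: "a \<in> {..<m - 1}"
      have "qform n (A s) a u * qform n (A s) (m - 1 - 1 - a) u \<le> qform n (A s) 0 u * qform n (A s) (a + (m - 1 - 1 - a)) u"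
        by (rule qform_product_bounds(1)[OF H \<open>0 < \<rho>\<close> lbs[OF that(2)]])
      also have "a + (m - 1 - 1 - a) = m - 2" using a by simp
      also have "qform n (A s) 0 u * qform n (A s) (m - 2) u \<le> \<eta> * (q s / \<rho>)"
      proof (rule mult_mono)
        have "\<rho> * qform n (A s) (m - 2) u \<le> qform n (A s) (Suc (m - 2)) u"
          by (rule qform_product_bounds(2)[OF H \<open>0 < \<rho>\<close> lbs[OF that(2)]])
        moreover have "Suc (m - 2) = m - 1" using a by simp
        ultimately show "qform n (A s) (m - 2) u \<le> q s / \<rho>"
          using \<open>0 < \<rho>\<close> by (simp add: q_def field_simps)
      qed (use u z \<open>0 < \<eta>\<close> qform_nonneg[OF H psd[OF that(2)]] in auto)
      finally show "qform n (A s) a u * qform n (A s) (m - 1 - 1 - a) u \<le> \<eta> * (q s / \<rho>)" .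
    qed
    also have "\<dots> = real (m - 1) * \<eta> / \<rho> * q s" by simp
    also have "\<dots> \<le> l * q s" unfolding l_def
      using qn \<open>0 < \<rho>\<close> \<open>0 < \<eta>\<close> by (intro mult_right_mono divide_right_mono) auto
    finally show ?thesis unfolding d_def by simp
  qed
  have qge: "q s \<ge> q 0 * exp (- l * s)" if "0 \<le> s" "s \<le> 1" for s
  proof -
    have "q 0 * exp (l * 0) \<le> q s * exp (l * s)"
    proof (rule DERIV_nonneg_imp_nondecreasing[OF that(1), of "\<lambda>s. q s * exp (l * s)"])
      fix x assume x: "0 \<le> x" "x \<le> s"
      have "((\<lambda>s. q s * exp (l * s)) has_real_derivative (d x + l * q x) * exp (l * x)) (at x)"
      proof (rule DERIV_cong[OF DERIV_mult[OF dq]])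
        show "((\<lambda>s. exp (l * s)) has_real_derivative l * exp (l * x)) (at x)"
          by (auto intro!: derivative_eq_intros)
      qed (simp add: algebra_simps)
      moreover have "0 \<le> (d x + l * q x) * exp (l * x)" using dge[of x] x that by simp
      ultimately show "\<exists>y. ((\<lambda>s. q s * exp (l * s)) has_real_derivative y) (at x) \<and> 0 \<le> y" by blast
    qed
    then have "q 0 * exp (- l * s) \<le> (q s * exp (l * s)) * exp (- l * s)" by (intro mult_right_mono) auto
    also have "\<dots> = q s" by (simp add: mult.assoc flip: exp_add)
    finally show ?thesis .
  qed
  have psd0: "0 \<le> qform n T 1 x" for x using psd[of 0 x] A0 by simp
  \<comment> \<open>The subtracted exponential decreases exactly at the rate that \<open>qge\<close>
    guarantees for the trace, so the difference does not increase on the unit interval.\<close>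
  have "trace_pow n (A 1) m - m * q 0 / l * exp (- l * 1) \<le> trace_pow n (A 0) m - m * q 0 / l * exp (- l * 0)"
  proof (rule DERIV_nonpos_imp_nonincreasing[of 0 1 "\<lambda>s. trace_pow n (A s) m - m * q 0 / l * exp (- l * s)"])
    fix x :: real assume x: "0 \<le> x" "x \<le> 1"
    have "((\<lambda>s. trace_pow n (A s) m) has_real_derivative - (m * q x)) (at x)"
      unfolding q_def A_def by (rule has_real_derivative_trace_pow[OF T])
    moreover have "((\<lambda>s. m * q 0 / l * exp (- l * s)) has_real_derivative - (m * q 0 * exp (- l * x))) (at x)"
      using l by (auto intro!: derivative_eq_intros)
    ultimately have "((\<lambda>s. trace_pow n (A s) m - m * q 0 / l * exp (- l * s)) has_real_derivative
        - (m * q x) - - (m * q 0 * exp (- l * x))) (at x)"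
      by (rule DERIV_diff)
    moreover have "- (m * q x) - - (m * q 0 * exp (- l * x)) \<le> 0"
      using mult_left_mono[OF qge[OF x], of "real m"] by (simp add: mult_ac)
    ultimately show "\<exists>y. ((\<lambda>s. trace_pow n (A s) m - m * q 0 / l * exp (- l * s)) has_real_derivative y) (at x) \<and> y \<le> 0"
      by blast
  qed simp
  then have "trace_pow n (A 1) m \<le> trace_pow n T m - m * (1 - exp (- l)) / l * q 0"
    unfolding A0 right_diff_distrib diff_divide_distrib left_diff_distrib by (simp add: mult_ac)
  \<comment> \<open>The order is raised from \<open>m - 1\<close> to \<open>m\<close> because
    averaging over \<open>u\<close> must return the potential \<open>trace_pow n T m\<close> itself;
    otherwise the recursion over the samples would not close.\<close>
  moreover have "qform n T m u \<le> q 0"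
    using qform_contract[OF T psd0 ub, of "m - 1" u] \<open>m > 0\<close> unfolding q_def A0 by simp
  then have "m * (1 - exp (- l)) / l * qform n T m u \<le> m * (1 - exp (- l)) / l * q 0"
    using l by (intro mult_left_mono) auto
  ultimately show ?thesis unfolding A_def by linarith
qed

lemma mv_pow_expand:
  assumes "i < n"
  shows "(mv n A ^^ k) u i = (\<Sum>j<n. u j * (mv n A ^^ k) (\<lambda>l. of_bool (l = j)) i)"
  using assms
proof (induction k arbitrary: i)
  case 0
  have "(\<Sum>j<n. u j * of_bool (i = j)) = (\<Sum>j<n. if i = j then u j else 0)"
    by (intro sum.cong) auto
  then show ?case using 0 by simp
next
  case (Suc k)
  have "(mv n A ^^ Suc k) u i = (\<Sum>l<n. A i l * (\<Sum>j<n. u j * (mv n A ^^ k) (\<lambda>l. of_bool (l = j)) l))"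
    using Suc by (simp add: mv_def[of n A _ i])
  also have "\<dots> = (\<Sum>j<n. \<Sum>l<n. A i l * (u j * (mv n A ^^ k) (\<lambda>l. of_bool (l = j)) l))"
    unfolding sum_distrib_left by (rule sum.swap)
  also have "\<dots> = (\<Sum>j<n. u j * mv n A ((mv n A ^^ k) (\<lambda>l. of_bool (l = j))) i)"
    unfolding mv_def[of n A _ i] sum_distrib_left by (simp only: mult_ac)
  finally show ?case by simp
qed

lemma trace_pow_qform: "trace_pow n A k = (\<Sum>i<n. qform n A k (\<lambda>j. of_bool (j = i)))"
  unfolding trace_pow_def qform_def by (intro sum.cong refl) (simp add: hdot_unit)

text \<open>The norm of \<open>A^j x\<close> is at most the Frobenius norm of \<open>A^j\<close>,
  whose square is the trace of \<open>A^(2 j)\<close> for Hermitian \<open>A\<close>. This plays the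
  part of "an eigenvalue power is at most the trace", and it is why even exponents are used
  later.\<close>

lemma qform_even_le_trace_pow:
  assumes "hermitian n A"
  shows "qform n A (2 * j) x \<le> trace_pow n A (2 * j) * qform n A 0 x"
proof -
  let ?P = "\<lambda>l i. (mv n A ^^ j) (\<lambda>m. of_bool (m = l)) i"
  have "(cmod ((mv n A ^^ j) x i))^2 \<le> (\<Sum>l<n. (cmod (x l))^2) * (\<Sum>l<n. (cmod (?P l i))^2)" if "i < n" for i
  proof -
    have "cmod ((mv n A ^^ j) x i) \<le> (\<Sum>l<n. cmod (x l) * cmod (?P l i))"
      unfolding mv_pow_expand[OF that, of j A x] by (rule order_trans[OF norm_sum]) (simp add: norm_mult)
    then have "(cmod ((mv n A ^^ j) x i))^2 \<le> (\<Sum>l<n. cmod (x l) * cmod (?P l i))^2"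
      by (intro power_mono) auto
    also have "\<dots> \<le> (\<Sum>l<n. (cmod (x l))^2) * (\<Sum>l<n. (cmod (?P l i))^2)"
      by (rule Cauchy_Schwarz_ineq_sum)
    finally show ?thesis .
  qed
  then have "qform n A (2 * j) x \<le> (\<Sum>i<n. (\<Sum>l<n. (cmod (x l))^2) * (\<Sum>l<n. (cmod (?P l i))^2))"
    unfolding qform_even[OF assms] by (intro sum_mono) simp
  also have "\<dots> = (\<Sum>i<n. \<Sum>l<n. (cmod (?P l i))^2) * (\<Sum>l<n. (cmod (x l))^2)"
    unfolding sum_distrib_right[symmetric] sum_distrib_left[symmetric] by (rule mult.commute)
  also have "(\<Sum>i<n. \<Sum>l<n. (cmod (?P l i))^2) = trace_pow n A (2 * j)"
    unfolding trace_pow_qform qform_even[OF assms] by (rule sum.swap)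
  finally show ?thesis unfolding qform_0 .
qed

text \<open>Jensen's inequality for the spectral measure of a unit vector, obtained here from the
  product bound on moments alone.\<close>

lemma qform_power_le:
  assumes "hermitian n A" and "0 < \<rho>" and lb: "\<And>x. \<rho> * qform n A 0 x \<le> qform n A 1 x"
    and x: "qform n A 0 x = 1"
  shows "(qform n A 1 x)^k \<le> qform n A k x"
proof (induction k)
  case (Suc k)
  have "(qform n A 1 x)^Suc k \<le> qform n A 1 x * qform n A k x"
    using Suc lb[of x] x \<open>0 < \<rho>\<close> by (simp add: mult_left_mono)
  also have "\<dots> \<le> qform n A (Suc k) x"
    using qform_product_bounds(1)[OF assms(1,2) lb, of 1 x k] x by simp
  finally show ?case .
qed (simp add: x)

text \<open>A sample \<open>y\<close> drawn from \<open>D\<close> contributes the rank-one matrix of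
  the vector \<open>w k y\<close>. This matrix has norm at most 1, and its mean is diagonal with
  entries \<open>a k \<ge> p\<close>. In the application \<open>w k\<close> is the transform of the
  \<open>k\<close>-th eigenfunction and \<open>p\<close> is
  \<open>1 / (2 |\<Omega>|)\<close>.\<close>

locale random_frame = D: prob_space D for D :: "'b measure" +
  fixes n :: nat and w :: "nat \<Rightarrow> 'b \<Rightarrow> complex" and a :: "nat \<Rightarrow> real" and p :: real
  assumes w_meas [measurable]: "\<And>k. w k \<in> borel_measurable D"
    and w_bound: "\<And>y. (\<Sum>k<n. (cmod (w k y))^2) \<le> 1"
    and w_moment: "\<And>k l. k < n \<Longrightarrow> l < n \<Longrightarrow> (LINT y|D. w k y * cnj (w l y)) = (if k = l then of_real (a k) else 0)"
    and a_ge: "\<And>k. k < n \<Longrightarrow> p \<le> a k"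
begin

definition frame_mat :: "real \<Rightarrow> 'i set \<Rightarrow> ('i \<Rightarrow> 'b) \<Rightarrow> nat \<Rightarrow> nat \<Rightarrow> complex" where
  "frame_mat \<kappa> I \<omega> i j = of_bool (i = j) - of_real \<kappa> * (\<Sum>q\<in>I. cnj (w i (\<omega> q)) * w j (\<omega> q))"

lemma hermitian_frame_mat: "hermitian n (frame_mat \<kappa> I \<omega>)"
  unfolding hermitian_def frame_mat_def by (auto simp: mult.commute)

lemma hdot_cnj_w_le: "(cmod (hdot n (\<lambda>i. cnj (w i y)) x))^2 \<le> qform n A 0 x"
proof -
  have "cmod (hdot n (\<lambda>i. cnj (w i y)) x) \<le> (\<Sum>k<n. cmod (w k y) * cmod (x k))"
    unfolding hdot_def by (rule order_trans[OF norm_sum]) (simp add: norm_mult)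
  then have "(cmod (hdot n (\<lambda>i. cnj (w i y)) x))^2 \<le> (\<Sum>k<n. cmod (w k y) * cmod (x k))^2"
    by (intro power_mono) auto
  also have "\<dots> \<le> (\<Sum>k<n. (cmod (w k y))^2) * (\<Sum>k<n. (cmod (x k))^2)"
    by (rule Cauchy_Schwarz_ineq_sum)
  also have "\<dots> \<le> 1 * (\<Sum>k<n. (cmod (x k))^2)"
    by (intro mult_right_mono w_bound sum_nonneg) auto
  finally show ?thesis by (simp add: qform_0)
qed

lemma frame_mat_insert:
  assumes "finite I" "q \<notin> I" "0 \<le> \<kappa>"
  shows "frame_mat \<kappa> (insert q I) (fun_upd \<omega> q y) = rank1_diff (frame_mat \<kappa> I \<omega>) 1 (\<lambda>i. of_real (sqrt \<kappa>) * cnj (w i y))"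
proof (intro ext)
  fix i j
  have "(\<Sum>s\<in>I. cnj (w i (fun_upd \<omega> q y s)) * w j (fun_upd \<omega> q y s)) = (\<Sum>s\<in>I. cnj (w i (\<omega> s)) * w j (\<omega> s))"
    using assms by (intro sum.cong) auto
  moreover have "complex_of_real (sqrt \<kappa>) * (complex_of_real (sqrt \<kappa>) * z) = of_real \<kappa> * z" for z
    using assms(3) by (simp flip: mult.assoc of_real_mult)
  ultimately show "frame_mat \<kappa> (insert q I) (fun_upd \<omega> q y) i j
    = rank1_diff (frame_mat \<kappa> I \<omega>) 1 (\<lambda>i. of_real (sqrt \<kappa>) * cnj (w i y)) i j"
    using assms by (simp add: frame_mat_def rank1_diff_def algebra_simps)
qed

lemma qform_frame_mat:
  assumes "finite I" "0 \<le> \<kappa>"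
  shows "qform n (frame_mat \<kappa> I \<omega>) 1 x = qform n (frame_mat \<kappa> I \<omega>) 0 x - \<kappa> * (\<Sum>q\<in>I. (cmod (hdot n (\<lambda>i. cnj (w i (\<omega> q))) x))^2)"
  using assms(1)
proof (induction I rule: finite_induct)
  case empty
  have "mv n (frame_mat \<kappa> {} \<omega>) x i = x i" if "i < n" for i
  proof -
    have "mv n (frame_mat \<kappa> {} \<omega>) x i = (\<Sum>j<n. if i = j then x j else 0)"
      unfolding mv_def frame_mat_def by (intro sum.cong) auto
    then show ?thesis using that by simp
  qed
  then have "hdot n x (mv n (frame_mat \<kappa> {} \<omega>) x) = hdot n x x" by (intro hdot_cong) auto
  then show ?case by (simp add: qform_def)
next
  case (insert q I)
  have "frame_mat \<kappa> (insert q I) \<omega> = rank1_diff (frame_mat \<kappa> I \<omega>) 1 (\<lambda>i. of_real (sqrt \<kappa>) * cnj (w i (\<omega> q)))"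
    using frame_mat_insert[OF insert(1,2) assms(2), of \<omega> "\<omega> q"] by simp
  then have "qform n (frame_mat \<kappa> (insert q I) \<omega>) 1 x = qform n (frame_mat \<kappa> I \<omega>) 1 x
      - (cmod (hdot n (\<lambda>i. of_real (sqrt \<kappa>) * cnj (w i (\<omega> q))) x))^2"
    by (simp only: qform_rank1_diff)
  also have "(cmod (hdot n (\<lambda>i. of_real (sqrt \<kappa>) * cnj (w i (\<omega> q))) x))^2 = \<kappa> * (cmod (hdot n (\<lambda>i. cnj (w i (\<omega> q))) x))^2"
    unfolding hdot_scale_left using assms(2) by (simp add: norm_mult power_mult_distrib)
  finally show ?case using insert unfolding qform_0 by (simp add: algebra_simps)
qed

text \<open>Every sample contributes a form between 0 and the squared norm, so the spectrum lies
  between \<open>1 - \<kappa> * card I\<close> and 1. Weakening \<open>card I\<close> to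
  \<open>r\<close> gives one lower bound that serves all stages of the induction over the
  samples.\<close>

lemma frame_mat_bounds:
  assumes "finite I" "0 \<le> \<kappa>"
  shows "qform n (frame_mat \<kappa> I \<omega>) 1 x \<le> qform n (frame_mat \<kappa> I \<omega>) 0 x"
    and "card I \<le> r \<Longrightarrow> (1 - \<kappa> * real r) * qform n (frame_mat \<kappa> I \<omega>) 0 x \<le> qform n (frame_mat \<kappa> I \<omega>) 1 x"
proof -
  have "0 \<le> \<kappa> * (\<Sum>q\<in>I. (cmod (hdot n (\<lambda>i. cnj (w i (\<omega> q))) x))^2)"
    using assms by (intro mult_nonneg_nonneg sum_nonneg) auto
  then show "qform n (frame_mat \<kappa> I \<omega>) 1 x \<le> qform n (frame_mat \<kappa> I \<omega>) 0 x"
    using qform_frame_mat[OF assms] by simp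
next
  assume r: "card I \<le> r"
  let ?z = "qform n (frame_mat \<kappa> I \<omega>) 0 x"
  have z: "0 \<le> ?z" by (simp add: qform_0 sum_nonneg)
  have "(\<Sum>q\<in>I. (cmod (hdot n (\<lambda>i. cnj (w i (\<omega> q))) x))^2) \<le> real (card I) * ?z"
    by (rule sum_bounded_above) (rule hdot_cnj_w_le)
  also have "\<dots> \<le> real r * ?z" using r z by (intro mult_right_mono) auto
  finally have "\<kappa> * (\<Sum>q\<in>I. (cmod (hdot n (\<lambda>i. cnj (w i (\<omega> q))) x))^2) \<le> \<kappa> * (real r * ?z)"
    using assms by (intro mult_left_mono)
  then show "(1 - \<kappa> * real r) * ?z \<le> qform n (frame_mat \<kappa> I \<omega>) 1 x"
    unfolding qform_frame_mat[OF assms, of \<omega> x] by (simp add: algebra_simps)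
qed

text \<open>The second moments of \<open>w\<close> are diagonal, so the mean is the sum of
  \<open>a i\<close> times the diagonal entries of \<open>A^k\<close>. Nonnegativity of these
  entries allows \<open>a i\<close> to be replaced by \<open>p\<close>.\<close>

lemma expectation_qform:
  assumes "hermitian n A" and nn: "\<And>x. 0 \<le> qform n A k x"
  shows "integrable D (\<lambda>y. qform n A k (\<lambda>i. cnj (w i y)))"
    and "p * trace_pow n A k \<le> (LINT y|D. qform n A k (\<lambda>i. cnj (w i y)))"
proof -
  let ?P = "\<lambda>j i. (mv n A ^^ k) (\<lambda>m. of_bool (m = j)) i"
  have eq: "qform n A k (\<lambda>i. cnj (w i y)) = Re (\<Sum>i<n. \<Sum>j<n. ?P j i * (w i y * cnj (w j y)))" for y
  proof -
    have "hdot n (\<lambda>i. cnj (w i y)) ((mv n A ^^ k) (\<lambda>i. cnj (w i y)))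
      = (\<Sum>i<n. w i y * (\<Sum>j<n. cnj (w j y) * ?P j i))"
      unfolding hdot_def by (intro sum.cong refl) (subst mv_pow_expand, auto)
    then show ?thesis unfolding qform_def by (simp add: sum_distrib_left mult_ac)
  qed
  have b: "cmod (w i y) \<le> 1" if "i < n" for i y
  proof -
    have "(cmod (w i y))^2 \<le> (\<Sum>k<n. (cmod (w k y))^2)" using that by (intro member_le_sum) auto
    also have "\<dots> \<le> 1" by (rule w_bound)
    finally show ?thesis by (simp add: power_le_one_iff)
  qed
  have int: "integrable D (\<lambda>y. w i y * cnj (w j y))" if "i < n" "j < n" for i j
  proof (rule D.integrable_const_bound[of _ 1])
    show "AE y in D. cmod (w i y * cnj (w j y)) \<le> 1"
      using b that by (auto simp: norm_mult intro!: mult_le_one)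
    show "(\<lambda>y. w i y * cnj (w j y)) \<in> borel_measurable D"
      by (intro borel_measurable_times measurable_compose[OF w_meas, of cnj] w_meas borel_measurable_continuous_onI continuous_intros)
  qed
  show "integrable D (\<lambda>y. qform n A k (\<lambda>i. cnj (w i y)))"
    unfolding eq by (intro integrable_Re Bochner_Integration.integrable_sum integrable_mult_right int) auto
  have "(LINT y|D. (\<Sum>i<n. (\<Sum>j<n. ?P j i * (w i y * cnj (w j y)))))
      = (\<Sum>i<n. (LINT y|D. (\<Sum>j<n. ?P j i * (w i y * cnj (w j y)))))"
    by (intro Bochner_Integration.integral_sum Bochner_Integration.integrable_sum integrable_mult_right int) auto
  also have "\<dots> = (\<Sum>i<n. (\<Sum>j<n. (LINT y|D. ?P j i * (w i y * cnj (w j y)))))"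
    by (intro sum.cong refl Bochner_Integration.integral_sum integrable_mult_right int) auto
  also have "\<dots> = (\<Sum>i<n. (\<Sum>j<n. ?P j i * (LINT y|D. w i y * cnj (w j y))))"
    by (intro sum.cong refl integral_mult_right_zero)
  finally have sum_eq: "(LINT y|D. (\<Sum>i<n. (\<Sum>j<n. ?P j i * (w i y * cnj (w j y))))) = \<dots>" .
  have "(LINT y|D. qform n A k (\<lambda>i. cnj (w i y))) = Re (LINT y|D. (\<Sum>i<n. (\<Sum>j<n. ?P j i * (w i y * cnj (w j y)))))"
    unfolding eq by (intro integral_Re Bochner_Integration.integrable_sum integrable_mult_right int) auto
  also note sum_eq
  also have "(\<Sum>i<n. \<Sum>j<n. ?P j i * (LINT y|D. w i y * cnj (w j y))) = (\<Sum>i<n. \<Sum>j<n. if i = j then ?P j i * of_real (a i) else 0)"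
    by (intro sum.cong refl) (simp add: w_moment)
  also have "Re \<dots> = (\<Sum>i<n. a i * qform n A k (\<lambda>j. of_bool (j = i)))"
    by (simp add: qform_def hdot_unit mult.commute)
  also have "\<dots> \<ge> (\<Sum>i<n. p * qform n A k (\<lambda>j. of_bool (j = i)))"
    by (intro sum_mono mult_right_mono a_ge nn) auto
  finally show "p * trace_pow n A k \<le> (LINT y|D. qform n A k (\<lambda>i. cnj (w i y)))"
    by (simp add: trace_pow_qform sum_distrib_left)
qed

lemma trace_pow_frame_mat_nonneg:
  assumes "finite I" "0 \<le> \<kappa>" "\<kappa> * real (card I) \<le> 1"
  shows "0 \<le> trace_pow n (frame_mat \<kappa> I \<omega>) m" "0 \<le> qform n (frame_mat \<kappa> I \<omega>) m x"
proof -
  have psd: "0 \<le> qform n (frame_mat \<kappa> I \<omega>) 1 x" for x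
  proof -
    have "0 \<le> (1 - \<kappa> * real (card I)) * qform n (frame_mat \<kappa> I \<omega>) 0 x"
      using assms by (simp add: qform_0 sum_nonneg)
    then show ?thesis using frame_mat_bounds(2)[OF assms(1,2) order_refl, of \<omega> x] by linarith
  qed
  show "0 \<le> trace_pow n (frame_mat \<kappa> I \<omega>) m" "0 \<le> qform n (frame_mat \<kappa> I \<omega>) m x"
    unfolding trace_pow_qform by (auto intro!: sum_nonneg qform_nonneg[OF hermitian_frame_mat psd])
qed

text \<open>A fresh independent sample lowers the mean of the potential by the factor
  \<open>1 - \<rho> (1 - exp (- \<theta>)) p\<close>, which is then bounded by an exponential so
  that the factors multiply well.\<close>

lemma trace_pow_frame_mat_step:
  assumes I: "finite I" "q \<notin> I" "Suc (card I) \<le> r" and "0 < \<theta>" "\<theta> * real r < real m" "0 \<le> p"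
  defines "\<kappa> \<equiv> \<theta> / real m" and "\<rho> \<equiv> 1 - \<theta> * real r / real m"
  shows "(\<integral>\<^sup>+ y. ennreal (trace_pow n (frame_mat \<kappa> (insert q I) (fun_upd \<omega> q y)) m) \<partial>D)
    \<le> ennreal (exp (- (\<rho> * (1 - exp (- \<theta>)) * p))) * ennreal (trace_pow n (frame_mat \<kappa> I \<omega>) m)"
proof -
  have m: "m > 0" using assms by (cases m) (auto simp: mult_less_0_iff)
  have \<kappa>: "0 < \<kappa>" unfolding \<kappa>_def using assms m by simp
  have \<rho>: "0 < \<rho>" "\<rho> = 1 - \<kappa> * real r" "\<rho> \<le> 1" unfolding \<rho>_def \<kappa>_def using assms m by (auto simp: field_simps)
  let ?T = "frame_mat \<kappa> I \<omega>" and ?u = "\<lambda>y i. cnj (w i y)"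
  let ?c = "\<rho> * (1 - exp (- \<theta>))"
  have \<kappa>r: "\<kappa> * real k \<le> 1" if "k \<le> r" for k
  proof -
    have "\<kappa> * real k \<le> \<kappa> * real r" using that \<kappa> by (intro mult_left_mono) auto
    then show ?thesis using \<rho> by linarith
  qed
  have nn: "0 \<le> qform n ?T m x" "0 \<le> trace_pow n ?T m" for x
    using trace_pow_frame_mat_nonneg[OF I(1), of \<kappa>] \<kappa> \<kappa>r[of "card I"] I by auto
  have fin: "finite (insert q I)" "card (insert q I) \<le> r" using I by auto
  have step: "trace_pow n (frame_mat \<kappa> (insert q I) (fun_upd \<omega> q y)) m \<le> trace_pow n ?T m - ?c * qform n ?T m (?u y)" for y
  proof -
    let ?v = "\<lambda>i. of_real (sqrt \<kappa>) * cnj (w i y)"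
    have sc: "qform n ?T k ?v = \<kappa> * qform n ?T k (?u y)" for k
    proof -
      have "hdot n ?v ((mv n ?T ^^ k) ?v) = of_real (sqrt \<kappa>) * (of_real (sqrt \<kappa>) * hdot n (?u y) ((mv n ?T ^^ k) (?u y)))"
        unfolding mv_pow_scale hdot_scale_left hdot_scale_right by simp
      also have "\<dots> = of_real \<kappa> * hdot n (?u y) ((mv n ?T ^^ k) (?u y))"
        using \<kappa> by (simp flip: mult.assoc of_real_mult)
      finally show ?thesis unfolding qform_def by simp
    qed
    have "trace_pow n (rank1_diff ?T 1 ?v) m \<le> trace_pow n ?T m
        - m * (1 - exp (- (real m * \<kappa> / \<rho>))) / (real m * \<kappa> / \<rho>) * qform n ?T m ?v"
    proof (rule trace_pow_rank1_diff_le[OF hermitian_frame_mat _ _ \<rho>(1) m \<kappa>])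
      show "qform n ?T 1 x \<le> qform n ?T 0 x" for x using frame_mat_bounds(1)[OF I(1)] \<kappa> by simp
      show "\<rho> * qform n ?T 0 x \<le> qform n (rank1_diff ?T 1 ?v) 1 x" for x
        using frame_mat_bounds(2)[OF fin(1) _ fin(2), of \<kappa> "fun_upd \<omega> q y" x] \<kappa>
        unfolding frame_mat_insert[OF I(1,2) less_imp_le[OF \<kappa>]] qform_0 \<rho>(2) by simp
      have "qform n ?T 0 (?u y) \<le> 1" using w_bound by (simp add: qform_0)
      then show "qform n ?T 0 ?v \<le> \<kappa>" unfolding sc using \<kappa> by (simp add: mult_left_le)
    qed
    \<comment> \<open>Here \<open>l = m \<kappa> / \<rho> = \<theta> / \<rho>\<close>, and the
      factor \<open>\<kappa>\<close> taken out of the moment by \<open>sc\<close> cancels the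
      \<open>\<kappa>\<close> in \<open>l\<close>.\<close>
    also have "m * (1 - exp (- (real m * \<kappa> / \<rho>))) / (real m * \<kappa> / \<rho>) * qform n ?T m ?v
        = \<rho> * (1 - exp (- (\<theta> / \<rho>))) * qform n ?T m (?u y)"
      unfolding sc using m \<kappa> \<rho> \<open>0 < \<theta>\<close> by (simp add: \<kappa>_def field_simps)
    finally have "trace_pow n (rank1_diff ?T 1 ?v) m \<le> trace_pow n ?T m - \<rho> * (1 - exp (- (\<theta> / \<rho>))) * qform n ?T m (?u y)" .
    \<comment> \<open>Since \<open>\<rho> \<le> 1\<close>, the exponent
      \<open>\<theta> / \<rho>\<close> is at least \<open>\<theta>\<close>.\<close>
    moreover have "?c * qform n ?T m (?u y) \<le> \<rho> * (1 - exp (- (\<theta> / \<rho>))) * qform n ?T m (?u y)"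
      using \<rho> \<open>0 < \<theta>\<close> by (intro mult_right_mono mult_left_mono nn) (auto simp: field_simps)
    ultimately have "trace_pow n (rank1_diff ?T 1 ?v) m \<le> trace_pow n ?T m - ?c * qform n ?T m (?u y)" by linarith
    then show ?thesis unfolding frame_mat_insert[OF I(1,2) less_imp_le[OF \<kappa>]] by simp
  qed
  have nn': "0 \<le> trace_pow n (frame_mat \<kappa> (insert q I) \<omega>') m" for \<omega>'
    using trace_pow_frame_mat_nonneg(1)[OF fin(1), of \<kappa>] \<kappa> \<kappa>r[OF fin(2)] by auto
  note E = expectation_qform[OF hermitian_frame_mat nn(1)]
  have "(\<integral>\<^sup>+ y. ennreal (trace_pow n (frame_mat \<kappa> (insert q I) (fun_upd \<omega> q y)) m) \<partial>D)
    \<le> (\<integral>\<^sup>+ y. ennreal (trace_pow n ?T m - ?c * qform n ?T m (?u y)) \<partial>D)"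
    by (intro nn_integral_mono ennreal_leI step)
  also have "\<dots> = ennreal (LINT y|D. trace_pow n ?T m - ?c * qform n ?T m (?u y))"
    using order_trans[OF nn' step] E(1) by (intro nn_integral_eq_integral) auto
  also have "(LINT y|D. trace_pow n ?T m - ?c * qform n ?T m (?u y)) = trace_pow n ?T m - ?c * (LINT y|D. qform n ?T m (?u y))"
    using E(1) by (subst Bochner_Integration.integral_diff) (auto simp: D.prob_space)
  also have "\<dots> \<le> trace_pow n ?T m - ?c * (p * trace_pow n ?T m)"
    using \<rho> \<open>0 < \<theta>\<close> by (intro diff_left_mono mult_left_mono E(2)) auto
  also have "\<dots> = (1 + - (?c * p)) * trace_pow n ?T m" by (simp add: algebra_simps)
  also have "\<dots> \<le> exp (- (?c * p)) * trace_pow n ?T m"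
    by (intro mult_right_mono exp_ge_add_one_self nn)
  finally show ?thesis by (simp add: ennreal_mult' nn ennreal_leI del: fun_upd_apply)
qed

lemma measurable_trace_pow_frame_mat [measurable]:
  assumes "finite I"
  shows "(\<lambda>\<omega>. trace_pow n (frame_mat \<kappa> I \<omega>) m) \<in> borel_measurable (Pi\<^sub>M I (\<lambda>_. D))"
proof -
  have e: "(\<lambda>\<omega>. frame_mat \<kappa> I \<omega> i j) \<in> borel_measurable (Pi\<^sub>M I (\<lambda>_. D))" for i j
  proof -
    have w: "(\<lambda>\<omega>. w i (\<omega> q)) \<in> borel_measurable (Pi\<^sub>M I (\<lambda>_. D))" if "q \<in> I" for i q
      using measurable_compose[OF measurable_component_singleton[OF that] w_meas] .
    have "(\<lambda>\<omega>. cnj (w i (\<omega> q))) \<in> borel_measurable (Pi\<^sub>M I (\<lambda>_. D))" if "q \<in> I" for i q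
      using measurable_compose[OF w[OF that], of cnj] by (simp add: borel_measurable_continuous_onI continuous_on_cnj continuous_on_id)
    then show ?thesis unfolding frame_mat_def using w
      by (intro borel_measurable_diff borel_measurable_times borel_measurable_sum borel_measurable_const) auto
  qed
  have "(\<lambda>\<omega>. (mv n (frame_mat \<kappa> I \<omega>) ^^ m) x i) \<in> borel_measurable (Pi\<^sub>M I (\<lambda>_. D))" for x i
    by (induction m arbitrary: i) (auto simp: mv_def[of n _ _ i for i] intro!: borel_measurable_sum borel_measurable_times e)
  note this[measurable]
  show ?thesis unfolding trace_pow_def by measurable
qed

text \<open>Integrating out the coordinates of the product measure one by one multiplies the bound
  by the same factor each time. With no samples left the matrix is the identity, whose trace is
  \<open>n\<close>.\<close>

lemma nn_integral_trace_pow_frame_mat: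
  fixes I :: "'i set"
  assumes "finite I" "card I \<le> r" and "0 < \<theta>" "\<theta> * real r < real m" "0 \<le> p"
  defines "\<kappa> \<equiv> \<theta> / real m" and "\<rho> \<equiv> 1 - \<theta> * real r / real m"
  shows "(\<integral>\<^sup>+ \<omega>. ennreal (trace_pow n (frame_mat \<kappa> I \<omega>) m) \<partial>Pi\<^sub>M I (\<lambda>_. D))
    \<le> ennreal (exp (- (\<rho> * (1 - exp (- \<theta>)) * p)) ^ card I * real n)"
  using assms(1,2)
proof (induction I rule: finite_induct)
  case empty
  interpret product_sigma_finite "\<lambda>_. D" by standard
  have "(mv n (frame_mat \<kappa> {} \<omega>) ^^ k) x i = x i" if "i < n" for \<omega> :: "'i \<Rightarrow> 'b" and k x i
    using that
  proof (induction k arbitrary: i)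
    case (Suc k)
    have "mv n (frame_mat \<kappa> {} \<omega>) ((mv n (frame_mat \<kappa> {} \<omega>) ^^ k) x) i
      = (\<Sum>j<n. if i = j then (mv n (frame_mat \<kappa> {} \<omega>) ^^ k) x j else 0)"
      unfolding mv_def[of n _ _ i] frame_mat_def[of \<kappa> "{}" \<omega> i] by (intro sum.cong) auto
    then show ?case using Suc by simp
  qed simp
  then have "trace_pow n (frame_mat \<kappa> {} \<omega>) m = (\<Sum>i<n. 1)" for \<omega> :: "'i \<Rightarrow> 'b"
    unfolding trace_pow_def by (intro sum.cong refl) simp
  then show ?case
    using prob_space.emeasure_space_1[OF prob_space_PiM[of "{} :: 'i set" "\<lambda>_. D", OF D.prob_space_axioms]] by simp
next
  case (insert q I)
  interpret product_sigma_finite "\<lambda>_. D" by standard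
  let ?e = "exp (- (\<rho> * (1 - exp (- \<theta>)) * p))"
  have "(\<integral>\<^sup>+ \<omega>. ennreal (trace_pow n (frame_mat \<kappa> (insert q I) \<omega>) m) \<partial>Pi\<^sub>M (insert q I) (\<lambda>_. D))
      = (\<integral>\<^sup>+ \<omega>. (\<integral>\<^sup>+ y. ennreal (trace_pow n (frame_mat \<kappa> (insert q I) (fun_upd \<omega> q y)) m) \<partial>D) \<partial>Pi\<^sub>M I (\<lambda>_. D))"
    by (rule product_nn_integral_insert[OF insert(1,2)])
      (intro measurable_compose[OF measurable_trace_pow_frame_mat measurable_ennreal] finite.insertI insert)
  also have "\<dots> \<le> (\<integral>\<^sup>+ \<omega>. ennreal ?e * ennreal (trace_pow n (frame_mat \<kappa> I \<omega>) m) \<partial>Pi\<^sub>M I (\<lambda>_. D))"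
    unfolding \<kappa>_def \<rho>_def using insert assms(3-5)
    by (intro nn_integral_mono trace_pow_frame_mat_step) auto
  also have "\<dots> = ennreal ?e * (\<integral>\<^sup>+ \<omega>. ennreal (trace_pow n (frame_mat \<kappa> I \<omega>) m) \<partial>Pi\<^sub>M I (\<lambda>_. D))"
    using insert(1) by (intro nn_integral_cmult measurable_compose[OF measurable_trace_pow_frame_mat measurable_ennreal])
  also have "\<dots> \<le> ennreal ?e * ennreal (?e ^ card I * real n)"
    using insert by (intro mult_left_mono) auto
  also have "\<dots> = ennreal (?e ^ card (insert q I) * real n)"
    using insert by (simp add: ennreal_mult' [symmetric] mult_ac)
  finally show ?case .
qed

text \<open>For a unit vector, the power \<open>2 j\<close> of the form
  \<open>1 - \<kappa> \<langle>x, S x\<rangle>\<close> is at most the trace, hence below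
  \<open>(1 - \<kappa> t)^(2 j)\<close>; taking roots gives
  \<open>\<langle>x, S x\<rangle> > t\<close>. One inequality for the trace thus controls all
  \<open>x\<close> at once.\<close>

lemma frame_lower_bound_of_trace_pow:
  assumes I: "finite I" and \<kappa>: "0 < \<kappa>" "\<kappa> * real (card I) < 1" "\<kappa> * t < 1"
    and tr: "trace_pow n (frame_mat \<kappa> I \<omega>) (2 * j) < (1 - \<kappa> * t)^(2 * j)"
  shows "t * (\<Sum>k<n. (cmod (x k))^2) \<le> (\<Sum>q\<in>I. (cmod (\<Sum>k<n. w k (\<omega> q) * x k))^2)"
proof -
  let ?T = "frame_mat \<kappa> I \<omega>" and ?S = "\<lambda>x. \<Sum>q\<in>I. (cmod (\<Sum>k<n. w k (\<omega> q) * x k))^2"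
  note b = frame_mat_bounds[OF I less_imp_le[OF \<kappa>(1)]]
  have \<rho>: "0 < 1 - \<kappa> * real (card I)" using \<kappa> by simp
  have unit: "t \<le> ?S x" if x: "qform n ?T 0 x = 1" for x
  proof -
    have "(qform n ?T 1 x)^(2 * j) \<le> qform n ?T (2 * j) x"
      by (rule qform_power_le[OF hermitian_frame_mat \<rho> b(2)[OF order_refl] x])
    also have "\<dots> \<le> trace_pow n ?T (2 * j)"
      using qform_even_le_trace_pow[OF hermitian_frame_mat, of \<kappa> I \<omega> j x] x by simp
    also have "\<dots> < (1 - \<kappa> * t)^(2 * j)" by (rule tr)
    finally have "(qform n ?T 1 x)^(2 * j) < (1 - \<kappa> * t)^(2 * j)" .
    then have "qform n ?T 1 x < 1 - \<kappa> * t" by (rule power_less_imp_less_base) (use \<kappa> in simp)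
    then have "\<kappa> * t < \<kappa> * ?S x"
      unfolding qform_frame_mat[OF I less_imp_le[OF \<kappa>(1)], of \<omega> x] x by (simp add: hdot_def)
    then show ?thesis using \<kappa>(1) by simp
  qed
  define N where "N = (\<Sum>k<n. (cmod (x k))^2)"
  have N0: "0 \<le> N" unfolding N_def by (simp add: sum_nonneg)
  show ?thesis
  proof (cases "N = 0")
    case True
    then show ?thesis by (simp add: sum_nonneg flip: N_def)
  next
    case False
    let ?x = "\<lambda>k. of_real (1 / sqrt N) * x k"
    have sq: "(1 / sqrt N)^2 = 1 / N" using N0 by (simp add: power_divide)
    have "qform n ?T 0 ?x = (1 / sqrt N)^2 * N"
      unfolding qform_0 N_def sum_distrib_left by (simp only: norm_mult norm_of_real power_mult_distrib power2_abs)
    then have 1: "qform n ?T 0 ?x = 1" using False unfolding sq by simp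
    have "?S ?x = (1 / sqrt N)^2 * ?S x"
      unfolding sum_distrib_left[of _ _ I]
    proof (intro sum.cong refl)
      fix q
      have "(\<Sum>k<n. w k (\<omega> q) * ?x k) = of_real (1 / sqrt N) * (\<Sum>k<n. w k (\<omega> q) * x k)"
        unfolding sum_distrib_left by (simp only: mult_ac)
      then show "(cmod (\<Sum>k<n. w k (\<omega> q) * ?x k))^2 = (1 / sqrt N)^2 * (cmod (\<Sum>k<n. w k (\<omega> q) * x k))^2"
        by (simp only: norm_mult norm_of_real power_mult_distrib power2_abs)
    qed
    then have "t \<le> 1 / N * ?S x" using unit[OF 1] unfolding sq by simp
    then show ?thesis using N0 False unfolding N_def[symmetric] by (simp add: field_simps)
  qed
qed

text \<open>Markov's inequality for the potential of order \<open>2 j\<close>. As \<open>j\<close>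
  grows, \<open>\<rho>\<close> tends to 1 and \<open>(1 - \<theta> t / (2 j))^(2 j)\<close> tends to
  \<open>exp (- \<theta> t)\<close>, so the bound becomes the one that the exponential potential
  would give.\<close>

theorem frame_lower_tail:
  assumes I: "finite I" and \<theta>: "0 < \<theta>" and "0 \<le> p" "0 \<le> t"
  shows "\<exists>G\<in>sets (Pi\<^sub>M I (\<lambda>_. D)).
    1 - real n * exp (- ((1 - exp (- \<theta>)) * p * real (card I)) + \<theta> * t) \<le> measure (Pi\<^sub>M I (\<lambda>_. D)) G \<and>
    (\<forall>\<omega>\<in>G. \<forall>x. t * (\<Sum>k<n. (cmod (x k))^2) \<le> (\<Sum>q\<in>I. (cmod (\<Sum>k<n. w k (\<omega> q) * x k))^2))"
proof -
  let ?P = "Pi\<^sub>M I (\<lambda>_. D)"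
  interpret P: prob_space ?P by (intro prob_space_PiM D.prob_space_axioms)
  have nn: "0 \<le> \<theta> * real (card I)" "0 \<le> \<theta> * t" using \<theta> \<open>0 \<le> t\<close> by auto
  \<comment> \<open>Beyond \<open>J\<close> both \<open>1 - \<kappa> * card I\<close> and
    \<open>1 - \<kappa> * t\<close> are positive for
    \<open>\<kappa> = \<theta> / (2 j)\<close>.\<close>
  obtain J :: nat where J: "\<theta> * real (card I) + \<theta> * t < real J" using reals_Archimedean2 by blast
  define good where "good j = {\<omega> \<in> space ?P. trace_pow n (frame_mat (\<theta> / real (2 * j)) I \<omega>) (2 * j) < (1 - (\<theta> / real (2 * j)) * t)^(2 * j)}" for j
  have good_sets: "good j \<in> sets ?P" for j
    unfolding good_def using measurable_trace_pow_frame_mat[OF I] by measurable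
  \<comment> \<open>Each \<open>good j\<close> already forces the frame inequality. Their union
    therefore does so too, and its probability is at least every \<open>1 - B j\<close>, hence at
    least the limit: no single order has to be optimal.\<close>
  define G where "G = (\<Union>j\<in>{J..}. good j)"
  have G: "G \<in> sets ?P" unfolding G_def using good_sets by auto
  define B where "B j = real n * exp (- ((1 - \<theta> * real (card I) / real (2 * j)) * (1 - exp (- \<theta>)) * p)) ^ card I
    / (1 + (- \<theta> * t) / real (2 * j))^(2 * j)" for j :: nat
  have B: "1 - B j \<le> measure ?P G" if j: "j \<ge> J" for j
  proof -
    let ?m = "2 * j" let ?tr = "\<lambda>\<omega>. trace_pow n (frame_mat (\<theta> / real ?m) I \<omega>) ?m"
    let ?b = "(1 - (\<theta> / real ?m) * t)^?m"
    have h: "\<theta> * real (card I) + \<theta> * t < real ?m" using J j by simp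
    have h1: "\<theta> * real (card I) < real ?m" "\<theta> * t < real ?m"
      using h nn by linarith+
    have m: "0 < real ?m" using h1(1) nn by linarith
    have b: "0 < ?b" using h1 m by (intro zero_less_power) (simp add: field_simps)
    have "emeasure ?P (space ?P - good j) = emeasure ?P {\<omega>\<in>space ?P. 1 \<le> ennreal (1 / ?b) * ennreal (?tr \<omega>)}"
    proof (rule arg_cong[where f = "emeasure ?P"])
      have "(\<not> ?tr \<omega> < ?b) = (1 \<le> ennreal (1 / ?b) * ennreal (?tr \<omega>))" for \<omega>
      proof -
        have "ennreal (1 / ?b) * ennreal (?tr \<omega>) = ennreal (?tr \<omega> / ?b)"
          using b by (simp add: ennreal_mult'[symmetric])
        then show ?thesis unfolding not_less by (simp only: ennreal_ge_1 pos_le_divide_eq[OF b] mult_1)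
      qed
      then show "space ?P - good j = {\<omega>\<in>space ?P. 1 \<le> ennreal (1 / ?b) * ennreal (?tr \<omega>)}"
        unfolding good_def by auto
    qed
    also have "\<dots> \<le> ennreal (1 / ?b) * (\<integral>\<^sup>+ \<omega>. ennreal (?tr \<omega>) * indicator (space ?P) \<omega> \<partial>?P)"
      using measurable_trace_pow_frame_mat[OF I] by (intro nn_integral_Markov_inequality) auto
    also have "(\<integral>\<^sup>+ \<omega>. ennreal (?tr \<omega>) * indicator (space ?P) \<omega> \<partial>?P) = (\<integral>\<^sup>+ \<omega>. ennreal (?tr \<omega>) \<partial>?P)"
      by (intro nn_integral_cong) auto
    also have "ennreal (1 / ?b) * \<dots> \<le> ennreal (1 / ?b) *
        ennreal (exp (- ((1 - \<theta> * real (card I) / real ?m) * (1 - exp (- \<theta>)) * p)) ^ card I * real n)"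
      by (intro mult_left_mono nn_integral_trace_pow_frame_mat[OF I order_refl \<theta> h1(1) \<open>0 \<le> p\<close>]) auto
    also have "\<dots> = ennreal (B j)"
    proof -
      have "(1 + (- \<theta> * t) / real ?m)^?m = ?b" by simp
      then have "1 / ?b * (exp (- ((1 - \<theta> * real (card I) / real ?m) * (1 - exp (- \<theta>)) * p)) ^ card I * real n) = B j"
        unfolding B_def by (simp only: times_divide_eq_left mult_1 mult.commute)
      moreover have "ennreal (1 / ?b) * ennreal z = ennreal (1 / ?b * z)" for z
        using b by (intro ennreal_mult'[symmetric]) (simp only: zero_le_divide_1_iff less_imp_le)
      ultimately show ?thesis by simp
    qed
    finally have le: "emeasure ?P (space ?P - good j) \<le> ennreal (B j)" .
    have "0 \<le> B j" unfolding B_def by (intro divide_nonneg_nonneg mult_nonneg_nonneg zero_le_power zero_le_even_power) auto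
    with le have "measure ?P (space ?P - good j) \<le> B j"
      by (simp only: P.emeasure_eq_measure ennreal_le_iff)
    then have "1 - B j \<le> measure ?P (good j)" using P.prob_compl[OF good_sets[of j]] by simp
    also have "\<dots> \<le> measure ?P G" using j G by (intro P.finite_measure_mono) (auto simp: G_def)
    finally show ?thesis .
  qed
  have "B \<longlonglongrightarrow> real n * exp (- ((1 - 0) * (1 - exp (- \<theta>)) * p)) ^ card I / exp (- \<theta> * t)"
    unfolding B_def
  proof (intro tendsto_intros)
    have dbl: "filterlim (\<lambda>j::nat. 2 * j) at_top at_top"
      by (rule filterlim_subseq) (auto simp: strict_mono_def)
    show "(\<lambda>j. (1 + (- \<theta> * t) / real (2 * j))^(2 * j)) \<longlonglongrightarrow> exp (- \<theta> * t)"
      using filterlim_compose[OF tendsto_exp_limit_sequentially[of "- \<theta> * t"] dbl] .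
    show "(\<lambda>j. \<theta> * real (card I) / real (2 * j)) \<longlonglongrightarrow> 0"
      using filterlim_compose[OF lim_const_over_n[of "\<theta> * real (card I)"] dbl] .
  qed auto
  moreover have "real n * exp (- ((1 - 0) * (1 - exp (- \<theta>)) * p)) ^ card I / exp (- \<theta> * t)
      = real n * exp (- ((1 - exp (- \<theta>)) * p * real (card I)) + \<theta> * t)"
    unfolding exp_of_nat_mult[symmetric] times_divide_eq_right[symmetric] exp_diff[symmetric]
    by (simp add: mult_ac)
  ultimately have lim: "(\<lambda>j. 1 - B j) \<longlonglongrightarrow> 1 - real n * exp (- ((1 - exp (- \<theta>)) * p * real (card I)) + \<theta> * t)"
    by (intro tendsto_intros) simp
  have "1 - real n * exp (- ((1 - exp (- \<theta>)) * p * real (card I)) + \<theta> * t) \<le> measure ?P G"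
    by (rule LIMSEQ_le_const2[OF lim]) (use B in blast)
  moreover have "t * (\<Sum>k<n. (cmod (x k))^2) \<le> (\<Sum>q\<in>I. (cmod (\<Sum>k<n. w k (\<omega> q) * x k))^2)" if "\<omega> \<in> G" for \<omega> x
  proof -
    from that obtain j where j: "j \<ge> J" "\<omega> \<in> good j" unfolding G_def by auto
    have "\<theta> * real (card I) + \<theta> * t < real (2 * j)" using J j by simp
    then have h1: "\<theta> * real (card I) < real (2 * j)" "\<theta> * t < real (2 * j)"
      using nn by linarith+
    have m: "0 < real (2 * j)" using h1(1) nn by linarith
    show ?thesis
      by (rule frame_lower_bound_of_trace_pow[OF I, of "\<theta> / real (2 * j)" t \<omega> j])
        (use j(2) m h1 \<theta> in \<open>simp_all add: good_def\<close>)
  qed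
  ultimately show ?thesis using G by blast
qed

end

section \<open>Square-integrable functions and Gaussians\<close>

lemma square_integrable_mult:
  fixes f g :: "'a \<Rightarrow> complex"
  assumes [measurable]: "f \<in> borel_measurable M" "g \<in> borel_measurable M"
    and f: "integrable M (\<lambda>x. (cmod (f x))^2)" and g: "integrable M (\<lambda>x. (cmod (g x))^2)"
  shows "integrable M (\<lambda>x. f x * g x)"
    and "(LINT x|M. cmod (f x) * cmod (g x))^2 \<le> (LINT x|M. (cmod (f x))^2) * (LINT x|M. (cmod (g x))^2)"
proof -
  have b: "cmod (f x) * cmod (g x) \<le> (cmod (f x))^2 + (cmod (g x))^2" for x
    using sum_squares_bound[of "cmod (f x)" "cmod (g x)"]
      mult_nonneg_nonneg[OF norm_ge_zero norm_ge_zero, of "f x" "g x"] by linarith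
  show "integrable M (\<lambda>x. f x * g x)"
    by (rule Bochner_Integration.integrable_bound[OF Bochner_Integration.integrable_add[OF f g]])
      (use b in \<open>auto simp: norm_mult intro!: AE_I2\<close>)
  from integrable_norm[OF this] have i: "integrable M (\<lambda>x. cmod (f x) * cmod (g x))" by (simp add: norm_mult)
  have "(\<integral>\<^sup>+x. ennreal (cmod (f x)) * ennreal (cmod (g x)) \<partial>M)^2
     \<le> (\<integral>\<^sup>+x. (ennreal (cmod (f x)))^2 \<partial>M) * (\<integral>\<^sup>+x. (ennreal (cmod (g x)))^2 \<partial>M)"
    by (rule Cauchy_Schwarz_nn_integral) auto
  also have "(\<integral>\<^sup>+x. ennreal (cmod (f x)) * ennreal (cmod (g x)) \<partial>M) = ennreal (LINT x|M. cmod (f x) * cmod (g x))"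
    using i by (subst nn_integral_eq_integral[symmetric]) (auto simp: ennreal_mult')
  also have "(\<integral>\<^sup>+x. (ennreal (cmod (f x)))^2 \<partial>M) = ennreal (LINT x|M. (cmod (f x))^2)"
    using f by (subst nn_integral_eq_integral[symmetric]) (auto simp: ennreal_power)
  also have "(\<integral>\<^sup>+x. (ennreal (cmod (g x)))^2 \<partial>M) = ennreal (LINT x|M. (cmod (g x))^2)"
    using g by (subst nn_integral_eq_integral[symmetric]) (auto simp: ennreal_power)
  finally show "(LINT x|M. cmod (f x) * cmod (g x))^2 \<le> (LINT x|M. (cmod (f x))^2) * (LINT x|M. (cmod (g x))^2)"
    by (simp add: ennreal_mult'[symmetric] ennreal_power ennreal_le_iff mult_nonneg_nonneg integral_nonneg)
qed

section \<open>Norm and inner product of square-integrable functions\<close>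

lemma L2_measurable [measurable_dest]: "L2 f \<Longrightarrow> f \<in> borel_measurable borel"
  by (simp add: L2_def)

lemma L2_integrable: "L2 f \<Longrightarrow> integrable lborel (\<lambda>t. (cmod (f t))^2)"
  by (simp add: L2_def)

lemma L2_norm_nonneg: "0 \<le> L2_norm f"
  by (simp add: L2_norm_def integral_nonneg)

lemma L2_norm_sq: "(L2_norm f)^2 = (LINT t|lborel. (cmod (f t))^2)"
  by (simp add: L2_norm_def integral_nonneg)

lemma measurable_cnj [measurable]: "cnj \<in> borel_measurable borel"
  by (intro borel_measurable_continuous_onI continuous_intros)

lemma measurable_cis [measurable]: "cis \<in> borel_measurable borel"
  by (intro borel_measurable_continuous_onI continuous_intros)

lemma L2_inner_integrable: "L2 f \<Longrightarrow> L2 g \<Longrightarrow> integrable lborel (\<lambda>t. f t * cnj (g t))"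
  by (rule square_integrable_mult(1)) (auto simp: L2_def)

lemma L2_Cauchy_Schwarz_abs:
  assumes "L2 f" "L2 g"
  shows "(LINT t|lborel. cmod (f t) * cmod (g t)) \<le> L2_norm f * L2_norm g"
    and "integrable lborel (\<lambda>t. cmod (f t) * cmod (g t))"
proof -
  have "(LINT t|lborel. cmod (f t) * cmod (g t))^2 \<le> (L2_norm f * L2_norm g)^2"
    using square_integrable_mult(2)[of f lborel g] assms unfolding power_mult_distrib L2_norm_sq by (auto simp: L2_def)
  then show "(LINT t|lborel. cmod (f t) * cmod (g t)) \<le> L2_norm f * L2_norm g"
    by (rule power2_le_imp_le) (simp add: L2_norm_nonneg)
  show "integrable lborel (\<lambda>t. cmod (f t) * cmod (g t))"
    using integrable_norm[OF L2_inner_integrable[OF assms]] by (simp add: norm_mult)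
qed

lemma L2_Cauchy_Schwarz: "L2 f \<Longrightarrow> L2 g \<Longrightarrow> cmod (L2_inner f g) \<le> L2_norm f * L2_norm g"
  unfolding L2_inner_def
  by (rule order_trans[OF integral_norm_bound]) (simp add: norm_mult L2_Cauchy_Schwarz_abs)

lemma L2_inner_self: "L2_inner f f = of_real ((L2_norm f)^2)"
proof -
  have "f t * cnj (f t) = complex_of_real ((cmod (f t))^2)" for t
    by (metis complex_norm_square of_real_power)
  then show ?thesis unfolding L2_inner_def L2_norm_sq by (simp only: integral_complex_of_real)
qed

lemma L2_inner_cnj: "cnj (L2_inner f g) = L2_inner g f"
  unfolding L2_inner_def by (subst Bochner_Integration.integral_cnj[symmetric]) (simp add: mult.commute)

lemma L2_add:
  assumes "L2 f" "L2 g" shows "L2 (\<lambda>t. f t + g t)"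
proof -
  have b: "(cmod (f t + g t))^2 \<le> 2 * (cmod (f t))^2 + 2 * (cmod (g t))^2" for t
  proof -
    have "(cmod (f t + g t))^2 \<le> (cmod (f t) + cmod (g t))^2"
      by (intro power_mono norm_triangle_ineq) auto
    also have "\<dots> \<le> 2 * (cmod (f t))^2 + 2 * (cmod (g t))^2"
      using sum_squares_bound[of "cmod (f t)" "cmod (g t)"] by (simp add: power2_sum)
    finally show ?thesis .
  qed
  have "integrable lborel (\<lambda>t. 2 * (cmod (f t))^2 + 2 * (cmod (g t))^2)"
    using assms by (auto simp: L2_def)
  then have "integrable lborel (\<lambda>t. (cmod (f t + g t))^2)"
    by (rule Bochner_Integration.integrable_bound) (use assms b in \<open>auto simp: L2_def intro!: AE_I2\<close>)
  then show ?thesis using assms by (auto simp: L2_def)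
qed

lemma L2_scale: "L2 f \<Longrightarrow> L2 (\<lambda>t. c * f t)"
  by (auto simp: L2_def norm_mult power_mult_distrib)

lemma L2_zero: "L2 (\<lambda>t. 0)"
  by (simp add: L2_def)

lemma L2_sum: "(\<And>i. i \<in> I \<Longrightarrow> L2 (f i)) \<Longrightarrow> L2 (\<lambda>t. \<Sum>i\<in>I. f i t)"
  by (induction I rule: infinite_finite_induct) (simp_all add: L2_zero L2_add)

lemma L2_diff: "L2 f \<Longrightarrow> L2 g \<Longrightarrow> L2 (\<lambda>t. f t - g t)"
  using L2_add[OF _ L2_scale[of g "-1"], of f] by simp

lemma L2_inner_add_left: "L2 f \<Longrightarrow> L2 g \<Longrightarrow> L2 h \<Longrightarrow> L2_inner (\<lambda>t. f t + g t) h = L2_inner f h + L2_inner g h"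
  unfolding L2_inner_def by (simp add: distrib_right L2_inner_integrable)

lemma L2_inner_diff_left: "L2 f \<Longrightarrow> L2 g \<Longrightarrow> L2 h \<Longrightarrow> L2_inner (\<lambda>t. f t - g t) h = L2_inner f h - L2_inner g h"
  unfolding L2_inner_def by (simp add: left_diff_distrib L2_inner_integrable)

lemma L2_inner_scale_left: "L2_inner (\<lambda>t. c * f t) h = c * L2_inner f h"
  unfolding L2_inner_def by (simp add: mult.assoc)

lemma L2_inner_sum_left:
  assumes "\<And>i. i \<in> I \<Longrightarrow> L2 (f i)" "L2 h"
  shows "L2_inner (\<lambda>t. \<Sum>i\<in>I. f i t) h = (\<Sum>i\<in>I. L2_inner (f i) h)"
  unfolding L2_inner_def sum_distrib_right
  by (rule Bochner_Integration.integral_sum) (auto intro: L2_inner_integrable assms)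

lemma L2_inner_add_right: "L2 f \<Longrightarrow> L2 g \<Longrightarrow> L2 h \<Longrightarrow> L2_inner h (\<lambda>t. f t + g t) = L2_inner h f + L2_inner h g"
  by (metis L2_inner_add_left L2_inner_cnj complex_cnj_add)

lemma L2_inner_diff_right: "L2 f \<Longrightarrow> L2 g \<Longrightarrow> L2 h \<Longrightarrow> L2_inner h (\<lambda>t. f t - g t) = L2_inner h f - L2_inner h g"
  by (metis L2_inner_diff_left L2_inner_cnj complex_cnj_diff)

lemma L2_inner_scale_right: "L2_inner h (\<lambda>t. c * f t) = cnj c * L2_inner h f"
  by (metis L2_inner_scale_left L2_inner_cnj complex_cnj_mult)

lemma L2_inner_sum_right:
  assumes "\<And>i. i \<in> I \<Longrightarrow> L2 (f i)" "L2 h"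
  shows "L2_inner h (\<lambda>t. \<Sum>i\<in>I. f i t) = (\<Sum>i\<in>I. L2_inner h (f i))"
  using arg_cong[where f = cnj, OF L2_inner_sum_left[OF assms]] by (simp add: L2_inner_cnj)

lemma L2_norm_add_sq:
  assumes "L2 f" "L2 g"
  shows "(L2_norm (\<lambda>t. f t + g t))^2 = (L2_norm f)^2 + 2 * Re (L2_inner f g) + (L2_norm g)^2"
proof -
  have "complex_of_real ((L2_norm (\<lambda>t. f t + g t))^2)
    = of_real ((L2_norm f)^2) + (L2_inner f g + cnj (L2_inner f g)) + of_real ((L2_norm g)^2)"
    unfolding L2_inner_self[symmetric] L2_inner_cnj using assms
    by (simp add: L2_inner_add_left L2_inner_add_right L2_add)
  also have "L2_inner f g + cnj (L2_inner f g) = of_real (2 * Re (L2_inner f g))"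
    by (simp add: complex_add_cnj)
  finally have "complex_of_real ((L2_norm (\<lambda>t. f t + g t))^2)
    = of_real ((L2_norm f)^2 + 2 * Re (L2_inner f g) + (L2_norm g)^2)" by simp
  then show ?thesis by (simp only: of_real_eq_iff)
qed

lemma L2_norm_scale: "L2_norm (\<lambda>t. c * f t) = cmod c * L2_norm f"
  unfolding L2_norm_def by (simp add: norm_mult power_mult_distrib real_sqrt_mult)

lemma L2_norm_diff_sq:
  assumes "L2 f" "L2 g"
  shows "(L2_norm (\<lambda>t. f t - g t))^2 = (L2_norm f)^2 - 2 * Re (L2_inner f g) + (L2_norm g)^2"
  using L2_norm_add_sq[OF assms(1) L2_scale[OF assms(2), of "-1"]]
  by (simp only: L2_inner_scale_right L2_norm_scale) simp

text \<open>Schur test for the Gram matrix of the \<open>u m\<close>.\<close>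
lemma L2_frame_bound:
  fixes u :: "'i \<Rightarrow> real \<Rightarrow> complex"
  assumes "finite S" and u: "\<And>m. m \<in> S \<Longrightarrow> L2 (u m)" and f: "L2 f"
    and G: "\<And>m. m \<in> S \<Longrightarrow> (\<Sum>l\<in>S. cmod (L2_inner (u m) (u l))) \<le> K" and "0 \<le> K"
  shows "(\<Sum>m\<in>S. (cmod (L2_inner f (u m)))^2) \<le> K * (L2_norm f)^2"
proof -
  let ?c = "\<lambda>m. L2_inner f (u m)" and ?X = "\<Sum>m\<in>S. (cmod (L2_inner f (u m)))^2"
  \<comment> \<open>The function whose coefficients are those of \<open>f\<close>: its inner product
    with \<open>f\<close> is the sum to be bounded, so Cauchy-Schwarz reduces the claim to the norm
    of \<open>?g\<close>.\<close>
  let ?g = "\<lambda>t. \<Sum>m\<in>S. ?c m * u m t"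
  have cu: "L2 (\<lambda>t. ?c m * u m t)" if "m \<in> S" for m by (rule L2_scale[OF u[OF that]])
  have g: "L2 ?g" by (intro L2_sum cu)
  have sq: "cnj z * z = of_real ((cmod z)^2)" for z by (metis complex_norm_square of_real_power mult.commute)
  have "L2_inner f ?g = of_real ?X"
    by (subst L2_inner_sum_right[OF cu f]) (auto simp: L2_inner_scale_right sq)
  from arg_cong[OF this, of cmod] have "?X = cmod (L2_inner f ?g)"
    unfolding norm_of_real by (simp add: sum_nonneg)
  also have "\<dots> \<le> L2_norm f * L2_norm ?g" by (rule L2_Cauchy_Schwarz[OF f g])
  finally have X: "?X \<le> L2_norm f * L2_norm ?g" .
  have "(L2_norm ?g)^2 = cmod (L2_inner ?g ?g)" by (simp add: L2_inner_self norm_power)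
  also have "L2_inner ?g ?g = (\<Sum>m\<in>S. \<Sum>l\<in>S. ?c m * (cnj (?c l) * L2_inner (u m) (u l)))"
  proof -
    have "L2_inner ?g ?g = (\<Sum>m\<in>S. L2_inner (\<lambda>t. ?c m * u m t) ?g)"
      by (rule L2_inner_sum_left[OF cu g])
    also have "\<dots> = (\<Sum>m\<in>S. \<Sum>l\<in>S. L2_inner (\<lambda>t. ?c m * u m t) (\<lambda>t. ?c l * u l t))"
      by (intro sum.cong refl L2_inner_sum_right cu)
    finally show ?thesis unfolding L2_inner_scale_left L2_inner_scale_right .
  qed
  also have "cmod \<dots> \<le> (\<Sum>m\<in>S. \<Sum>l\<in>S. cmod (?c m) * cmod (?c l) * cmod (L2_inner (u m) (u l)))"
    by (intro order_trans[OF norm_sum] sum_mono) (simp add: norm_mult)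
  \<comment> \<open>The arithmetic-geometric mean inequality splits the double sum into two halves.
    The moduli of the Gram matrix are symmetric, so the same row-sum bound \<open>K\<close> serves
    both.\<close>
  also have "\<dots> \<le> (\<Sum>m\<in>S. \<Sum>l\<in>S. ((cmod (?c m))^2 / 2 + (cmod (?c l))^2 / 2) * cmod (L2_inner (u m) (u l)))"
  proof (intro sum_mono mult_right_mono)
    show "cmod (?c m) * cmod (?c l) \<le> (cmod (?c m))^2 / 2 + (cmod (?c l))^2 / 2" for m l
      using sum_squares_bound[of "cmod (?c m)" "cmod (?c l)"] by simp
  qed auto
  also have "\<dots> = (\<Sum>m\<in>S. (cmod (?c m))^2 / 2 * (\<Sum>l\<in>S. cmod (L2_inner (u m) (u l))))
     + (\<Sum>m\<in>S. \<Sum>l\<in>S. (cmod (?c l))^2 / 2 * cmod (L2_inner (u m) (u l)))"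
    by (simp add: distrib_right sum.distrib sum_distrib_left)
  also have "(\<Sum>m\<in>S. \<Sum>l\<in>S. (cmod (?c l))^2 / 2 * cmod (L2_inner (u m) (u l)))
     = (\<Sum>l\<in>S. (cmod (?c l))^2 / 2 * (\<Sum>m\<in>S. cmod (L2_inner (u l) (u m))))"
  proof (subst sum.swap, intro sum.cong refl)
    fix l
    have "cmod (L2_inner (u m) (u l)) = cmod (L2_inner (u l) (u m))" for m
      by (metis L2_inner_cnj complex_mod_cnj)
    then show "(\<Sum>m\<in>S. (cmod (?c l))^2 / 2 * cmod (L2_inner (u m) (u l)))
      = (cmod (?c l))^2 / 2 * (\<Sum>m\<in>S. cmod (L2_inner (u l) (u m)))"
      by (simp only: sum_distrib_left)
  qed
  also have "(\<Sum>m\<in>S. (cmod (?c m))^2 / 2 * (\<Sum>l\<in>S. cmod (L2_inner (u m) (u l)))) + \<dots>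
     \<le> (\<Sum>m\<in>S. (cmod (?c m))^2 / 2 * K) + (\<Sum>m\<in>S. (cmod (?c m))^2 / 2 * K)"
    by (intro add_mono sum_mono mult_left_mono G) auto
  also have "\<dots> = K * ?X" unfolding sum_distrib_right[symmetric] sum_divide_distrib[symmetric] by simp
  finally have g2: "(L2_norm ?g)^2 \<le> K * ?X" .
  have X0: "0 \<le> ?X" by (simp add: sum_nonneg)
  have "?X^2 \<le> (L2_norm f * L2_norm ?g)^2" using X X0 by (intro power_mono)
  also have "\<dots> \<le> (L2_norm f)^2 * (K * ?X)"
    unfolding power_mult_distrib by (intro mult_left_mono g2) auto
  finally have "?X * ?X \<le> (K * (L2_norm f)^2) * ?X" by (simp add: power2_eq_square mult_ac)
  then show ?thesis using X0 \<open>0 \<le> K\<close>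
    by (cases "?X = 0") (auto simp: mult_le_cancel_right)
qed

lemma L2_Bessel:
  assumes "finite S" "\<And>i. i \<in> S \<Longrightarrow> L2 (e i)" "L2 f"
    and on: "\<And>i j. i \<in> S \<Longrightarrow> j \<in> S \<Longrightarrow> L2_inner (e i) (e j) = (if i = j then 1 else 0)"
  shows "(\<Sum>i\<in>S. (cmod (L2_inner f (e i)))^2) \<le> (L2_norm f)^2"
proof -
  have "(\<Sum>l\<in>S. cmod (L2_inner (e m) (e l))) \<le> 1" if "m \<in> S" for m
  proof -
    have "(\<Sum>l\<in>S. cmod (L2_inner (e m) (e l))) = (\<Sum>l\<in>S. if m = l then 1 else 0)"
      using on that by (intro sum.cong) auto
    then show ?thesis using \<open>finite S\<close> by simp
  qed
  from L2_frame_bound[OF assms(1-3) this] show ?thesis by simp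
qed

section \<open>Time-frequency shifts and Gaussian integrals\<close>

lemma tfshift_measurable [measurable]: "\<phi> \<in> borel_measurable borel \<Longrightarrow> tfshift z \<phi> \<in> borel_measurable borel"
proof (cases z)
  case (Pair x w)
  assume [measurable]: "\<phi> \<in> borel_measurable borel"
  have "(\<lambda>t. \<phi> (t - x) * cis (2 * pi * w * t)) \<in> borel_measurable borel" by measurable
  then show ?thesis by (simp add: tfshift_def[abs_def] Pair)
qed

lemma cmod_tfshift: "cmod (tfshift z \<phi> t) = cmod (\<phi> (t - fst z))"
  by (simp add: tfshift_def norm_mult)

lemma L2_tfshift: "L2 \<phi> \<Longrightarrow> L2 (tfshift z \<phi>)"
  using lborel_integrable_real_affine[of "\<lambda>t. (cmod (\<phi> t))^2" 1 "- fst z"]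
  by (auto simp: L2_def cmod_tfshift)

lemma L2_norm_tfshift: "L2_norm (tfshift z \<phi>) = L2_norm \<phi>"
  using lborel_integral_real_affine[of 1 "\<lambda>t. (cmod (\<phi> t))^2" "- fst z"]
  by (simp add: L2_norm_def cmod_tfshift)

lemma STFT_eq_inner: "STFT \<phi> f z = L2_inner f (tfshift z \<phi>)"
  by (simp add: STFT_def L2_inner_def tfshift_def cis_cnj mult.assoc)

lemma STFT_bound: "L2 \<phi> \<Longrightarrow> L2 f \<Longrightarrow> cmod (STFT \<phi> f z) \<le> L2_norm f * L2_norm \<phi>"
  unfolding STFT_eq_inner using L2_Cauchy_Schwarz[of f "tfshift z \<phi>"] by (simp add: L2_tfshift L2_norm_tfshift)

text \<open>The characteristic function of the standard normal distribution, after the substitution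
  \<open>x = sqrt (2 pi a) t\<close>.\<close>

lemma gaussian_Fourier_std:
  fixes a s :: real
  assumes "a > 0"
  shows "integrable lborel (\<lambda>t. exp (- (pi * a * t^2)))"
    and "(LINT t|lborel. of_real (exp (- (pi * a * t^2))) * cis (2 * pi * s * t)) = of_real (exp (- (pi * s^2 / a)) / sqrt a)"
proof -
  let ?c = "sqrt (2 * pi * a)"
  have c: "?c > 0" "?c^2 = 2 * pi * a" using assms by auto
  have d: "std_normal_density (?c * t) = exp (- (pi * a * t^2)) / sqrt (2 * pi)" for t
    using c(2) by (simp add: std_normal_density_def power_mult_distrib)
  have "integrable lborel (\<lambda>t. std_normal_density (0 + ?c * t))"
    by (rule lborel_integrable_real_affine) (use c integrable_normal_moment[of 1 0 0] in auto)
  then have "integrable lborel (\<lambda>t. sqrt (2 * pi) * std_normal_density (?c * t))" by simp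
  then show "integrable lborel (\<lambda>t. exp (- (pi * a * t^2)))" unfolding d by simp
  let ?u = "2 * pi * s / ?c"
  have "(CLINT x|std_normal_distribution. iexp (?u * x)) = of_real (exp (- (?u^2) / 2))"
    using fun_cong[OF char_std_normal_distribution, of ?u] by (simp add: char_def)
  then have "(LINT x|lborel. std_normal_density x *\<^sub>R iexp (?u * x)) = of_real (exp (- (?u^2) / 2))"
    by (subst (asm) integral_density) auto
  moreover have "(LINT x|lborel. std_normal_density x *\<^sub>R iexp (?u * x))
      = \<bar>?c\<bar> *\<^sub>R (LINT t|lborel. std_normal_density (0 + ?c * t) *\<^sub>R iexp (?u * (0 + ?c * t)))"
    by (rule lborel_integral_real_affine) (use c in auto)
  moreover have "std_normal_density (0 + ?c * t) *\<^sub>R iexp (?u * (0 + ?c * t))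
      = (exp (- (pi * a * t^2)) / sqrt (2 * pi)) *\<^sub>R cis (2 * pi * s * t)" for t
  proof -
    have "?u * (0 + ?c * t) = 2 * pi * s * t" using assms by simp
    then show ?thesis by (simp only: add_0 d cis_conv_exp)
  qed
  ultimately have "?c *\<^sub>R (LINT t|lborel. (exp (- (pi * a * t^2)) / sqrt (2 * pi)) *\<^sub>R cis (2 * pi * s * t)) = of_real (exp (- (?u^2) / 2))"
    using c(1) by (simp only: abs_of_pos)
  also have "(LINT t|lborel. (exp (- (pi * a * t^2)) / sqrt (2 * pi)) *\<^sub>R cis (2 * pi * s * t))
     = (1 / sqrt (2 * pi)) *\<^sub>R (LINT t|lborel. of_real (exp (- (pi * a * t^2))) * cis (2 * pi * s * t))"
    unfolding integral_scaleR_right[symmetric] by (intro Bochner_Integration.integral_cong) (auto simp: scaleR_conv_of_real)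
  also have "?u^2 / 2 = pi * s^2 / a"
    unfolding power_divide c(2) using assms by (simp add: power2_eq_square field_simps)
  hence "- (?u^2) / 2 = - (pi * s^2 / a)" by simp
  finally have "(?c / sqrt (2 * pi)) *\<^sub>R (LINT t|lborel. of_real (exp (- (pi * a * t^2))) * cis (2 * pi * s * t)) = of_real (exp (- (pi * s^2 / a)))"
    by simp
  moreover have "?c / sqrt (2 * pi) = sqrt a" by (simp add: real_sqrt_mult)
  ultimately have "of_real (sqrt a) * (LINT t|lborel. of_real (exp (- (pi * a * t^2))) * cis (2 * pi * s * t)) = of_real (exp (- (pi * s^2 / a)))"
    by (simp only: scaleR_conv_of_real)
  then show "(LINT t|lborel. of_real (exp (- (pi * a * t^2))) * cis (2 * pi * s * t)) = of_real (exp (- (pi * s^2 / a)) / sqrt a)"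
    using assms by (simp add: field_simps)
qed

lemma gaussian_integrable:
  fixes a c :: real
  assumes "a > 0"
  shows "integrable lborel (\<lambda>t. exp (- (pi * a * (t - c)^2)))"
  using lborel_integrable_real_affine[OF gaussian_Fourier_std(1)[OF assms], of 1 "- c"] by simp

lemma gaussian_Fourier:
  fixes a c s :: real
  assumes "a > 0"
  shows "(LINT t|lborel. of_real (exp (- (pi * a * (t - c)^2))) * cis (2 * pi * s * t))
    = cis (2 * pi * s * c) * of_real (exp (- (pi * s^2 / a)) / sqrt a)"
proof -
  have "(LINT t|lborel. of_real (exp (- (pi * a * (t - c)^2))) * cis (2 * pi * s * t))
     = (LINT t|lborel. of_real (exp (- (pi * a * t^2))) * cis (2 * pi * s * (c + t)))"
    by (subst lborel_integral_real_affine[of 1 _ c]) auto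
  also have "\<dots> = (LINT t|lborel. cis (2 * pi * s * c) * (of_real (exp (- (pi * a * t^2))) * cis (2 * pi * s * t)))"
    by (intro Bochner_Integration.integral_cong refl) (simp add: distrib_left mult_ac flip: cis_mult)
  finally show ?thesis using gaussian_Fourier_std(2)[OF assms] by simp
qed

lemma gaussian_integral:
  fixes a c :: real
  assumes "a > 0"
  shows "(LINT t|lborel. exp (- (pi * a * (t - c)^2))) = 1 / sqrt a"
proof -
  have "complex_of_real (LINT t|lborel. exp (- (pi * a * (t - c)^2))) = of_real (1 / sqrt a)"
    using gaussian_Fourier[OF assms, of c 0] by simp
  then show ?thesis by (simp only: of_real_eq_iff)
qed

lemma gaussian2_integrable:
  fixes a :: real and z :: "real \<times> real"
  assumes "a > 0"
  shows "integrable lborel (\<lambda>y::real\<times>real. exp (- (pi * a * ((fst y - fst z)^2 + (snd y - snd z)^2))))"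
    and "(LINT y|lborel. exp (- (pi * a * ((fst y - fst z)^2 + (snd y - snd z)^2)))) = 1 / a"
proof -
  let ?f = "\<lambda>y::real\<times>real. exp (- (pi * a * ((fst y - fst z)^2 + (snd y - snd z)^2)))"
  have f: "?f (x, w) = exp (- (pi * a * (x - fst z)^2)) * exp (- (pi * a * (w - snd z)^2))" for x w
    by (simp add: algebra_simps flip: exp_add)
  have "integrable (lborel \<Otimes>\<^sub>M lborel) ?f"
  proof (rule lborel_pair.Fubini_integrable)
    show "integrable lborel (\<lambda>x. LINT y|lborel. norm (?f (x, y)))"
      unfolding f by (simp add: gaussian_integrable assms)
    show "AE x in lborel. integrable lborel (\<lambda>y. ?f (x, y))"
      unfolding f by (simp add: gaussian_integrable assms)
  qed measurable
  then show i: "integrable lborel ?f" by (simp only: lborel_prod)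
  have "(LINT y|lborel. ?f y) = (LINT x|lborel. (LINT w|lborel. ?f (x, w)))"
    using lborel_pair.integral_fst'[of ?f] i unfolding lborel_prod by simp
  also have "\<dots> = 1 / sqrt a * (1 / sqrt a)"
    unfolding f by (simp add: gaussian_integral assms)
  finally show "(LINT y|lborel. ?f y) = 1 / a" using assms by (simp add: real_sqrt_mult_self)
qed

section \<open>The Gaussian window and its kernel\<close>

lemma gauss0_measurable [measurable]: "gauss0 \<in> borel_measurable borel"
  unfolding gauss0_def[abs_def] by measurable

lemma cmod_gauss0: "cmod (gauss0 t) = exp (- pi * t^2)"
  by (simp add: gauss0_def)

lemma cmod_gauss0_le_1: "cmod (gauss0 t) \<le> 1"
  by (simp add: cmod_gauss0)

lemma gauss0_sq: "(cmod (gauss0 t))^2 = exp (- (pi * 2 * (t - 0)^2))"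
  by (simp add: cmod_gauss0 flip: exp_of_nat_mult)

lemma L2_gauss0: "L2 gauss0"
  using gaussian_integrable[of 2 0] unfolding L2_def gauss0_sq by simp

lemma L2_norm_gauss0: "(L2_norm gauss0)^2 = 1 / sqrt 2"
  unfolding L2_norm_sq gauss0_sq by (subst gaussian_integral) auto

lemma tfshift_0: "tfshift (0, 0) \<phi> = \<phi>"
  by (rule ext) (simp add: tfshift_def)

text \<open>Up to the factor \<open>sqrt 2 = 1 / \<parallel>gauss0\<parallel>^2\<close>, this is the
  reproducing kernel of the space of Gaussian transforms.\<close>

definition gauss_ker :: "real \<times> real \<Rightarrow> real \<times> real \<Rightarrow> complex" where
  "gauss_ker z y = L2_inner (tfshift z gauss0) (tfshift y gauss0)"

text \<open>Completing the square turns the product of the Gaussians at \<open>x\<close> and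
  \<open>x'\<close> into one Gaussian at the midpoint, with the factor
  \<open>exp (- (pi / 2) (x' - x)^2)\<close>; its Fourier transform at the frequency difference
  supplies the rest.\<close>

lemma gauss_ker_eq:
  "gauss_ker z y = of_real (exp (- (pi * (1/2) * ((fst y - fst z)^2 + (snd y - snd z)^2))) / sqrt 2)
     * cis (pi * (snd z - snd y) * (fst z + fst y))"
proof -
  obtain x w x' w' where zy: "z = (x, w)" "y = (x', w')" by (metis surj_pair)
  have "tfshift z gauss0 t * cnj (tfshift y gauss0 t)
     = of_real (exp (- (pi * (1/2) * (x' - x)^2))) * (of_real (exp (- (pi * 2 * (t - (x + x') / 2)^2))) * cis (2 * pi * (w - w') * t))" for t
  proof -
    have e: "exp (- pi * (t - x)^2) * exp (- pi * (t - x')^2) = exp (- (pi * (1/2) * (x' - x)^2)) * exp (- (pi * 2 * (t - (x + x') / 2)^2))"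
      unfolding exp_add[symmetric] by (intro arg_cong[of _ _ exp]) (simp add: power2_eq_square field_simps)
    have c: "cis (2 * pi * w * t) * cnj (cis (2 * pi * w' * t)) = cis (2 * pi * (w - w') * t)"
      by (simp add: cis_cnj cis_mult algebra_simps)
    have "tfshift z gauss0 t * cnj (tfshift y gauss0 t) = of_real (exp (- pi * (t - x)^2) * exp (- pi * (t - x')^2)) * (cis (2 * pi * w * t) * cnj (cis (2 * pi * w' * t)))"
      by (simp add: tfshift_def gauss0_def zy mult_ac)
    then show ?thesis unfolding e c by (simp add: mult_ac)
  qed
  then have "gauss_ker z y = of_real (exp (- (pi * (1/2) * (x' - x)^2))) *
     (cis (2 * pi * (w - w') * ((x + x') / 2)) * of_real (exp (- (pi * (w - w')^2 / 2)) / sqrt 2))"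
    unfolding gauss_ker_def L2_inner_def by (simp only: integral_mult_right_zero gaussian_Fourier[of 2] zero_less_numeral)
  also have "\<dots> = of_real (exp (- (pi * (1/2) * (x' - x)^2)) * exp (- (pi * (w - w')^2 / 2)) / sqrt 2) * cis (2 * pi * (w - w') * ((x + x') / 2))"
    by (simp add: mult_ac)
  also have "exp (- (pi * (1/2) * (x' - x)^2)) * exp (- (pi * (w - w')^2 / 2)) = exp (- (pi * (1/2) * ((x' - x)^2 + (w' - w)^2)))"
    unfolding exp_add[symmetric] by (simp add: field_simps power2_commute)
  also have "2 * pi * (w - w') * ((x + x') / 2) = pi * (w - w') * (x + x')" by simp
  finally show ?thesis by (simp only: zy fst_conv snd_conv)
qed

lemma cmod_gauss_ker:
  "cmod (gauss_ker z y) = exp (- (pi * (1/2) * ((fst y - fst z)^2 + (snd y - snd z)^2))) / sqrt 2"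
  unfolding gauss_ker_eq by (simp add: norm_mult norm_divide)

lemma gauss_ker_measurable [measurable]:
  "(\<lambda>p. gauss_ker (fst p) (snd p)) \<in> borel_measurable (borel \<Otimes>\<^sub>M borel)"
  "gauss_ker z \<in> borel_measurable borel"
proof -
  have 1: "continuous_on UNIV (\<lambda>p. gauss_ker (fst p) (snd p))"
    unfolding gauss_ker_eq cis_conv_exp by (intro continuous_intros) auto
  then show "(\<lambda>p. gauss_ker (fst p) (snd p)) \<in> borel_measurable (borel \<Otimes>\<^sub>M borel)"
    by (simp add: borel_prod borel_measurable_continuous_onI)
  have "continuous_on UNIV (gauss_ker z)"
    unfolding gauss_ker_eq[abs_def] cis_conv_exp by (intro continuous_intros) auto
  then show "gauss_ker z \<in> borel_measurable borel" by (rule borel_measurable_continuous_onI)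
qed

lemma gauss_ker_integrable: "integrable lborel (gauss_ker z)"
  by (rule Bochner_Integration.integrable_bound[OF gaussian2_integrable(1)[of "1/2" z]])
    (auto simp: cmod_gauss_ker field_simps intro!: AE_I2)

lemma tfshift_gauss0_measurable [measurable]: "(\<lambda>y. tfshift y gauss0 t) \<in> borel_measurable borel"
proof -
  have "continuous_on UNIV (\<lambda>y. tfshift y gauss0 t)"
    unfolding tfshift_def gauss0_def cis_conv_exp by (intro continuous_intros)
  then show ?thesis by (rule borel_measurable_continuous_onI)
qed

lemma cmod_tfshift_gauss0_le: "cmod (tfshift y gauss0 t) \<le> 1"
  by (simp add: cmod_tfshift cmod_gauss0_le_1)

lemma gauss_ker_tfshift_integrable: "integrable lborel (\<lambda>y. gauss_ker z y * tfshift y gauss0 t)"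
  by (rule Bochner_Integration.integrable_bound[OF gauss_ker_integrable[of z]])
    (auto simp: norm_mult intro!: AE_I2 mult_left_le cmod_tfshift_gauss0_le)

text \<open>The inversion formula for the Gaussian itself, by explicit computation. For fixed
  \<open>x'\<close> the integral over frequencies is the transform of a Gaussian centred at
  \<open>w\<close>; after completing the square the remaining integral over \<open>x'\<close> is
  \<open>1 / sqrt 2\<close>. General functions are reduced to this case by Fubini.\<close>

lemma gauss_self_inversion:
  "(LINT y|lborel. gauss_ker z y * tfshift y gauss0 t) = tfshift z gauss0 t / sqrt 2"
proof -
  obtain x w where z: "z = (x, w)" by (metis surj_pair)
  have "(LINT y|lborel. gauss_ker z y * tfshift y gauss0 t) = (LINT x'|lborel. (LINT w'|lborel. gauss_ker z (x', w') * tfshift (x', w') gauss0 t))"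
    using lborel_pair.integral_fst'[of "\<lambda>y. gauss_ker z y * tfshift y gauss0 t"] gauss_ker_tfshift_integrable[of z t]
    unfolding lborel_prod by simp
  also have "\<dots> = (LINT x'|lborel. of_real (exp (- (pi * 2 * (x' - t)^2))) * (of_real (exp (- pi * (t - x)^2)) * cis (2 * pi * w * t)))"
  proof (intro Bochner_Integration.integral_cong refl)
    fix x'
    let ?C = "complex_of_real (exp (- (pi * (1/2) * (x' - x)^2)) / sqrt 2 * exp (- pi * (t - x')^2)) * cis (pi * w * (x + x'))"
    let ?s = "t - (x + x') / 2"
    have "gauss_ker z (x', w') * tfshift (x', w') gauss0 t = ?C * (of_real (exp (- (pi * (1/2) * (w' - w)^2))) * cis (2 * pi * ?s * w'))" for w'
    proof -
      have e: "exp (- (pi * (1/2) * ((x' - x)^2 + (w' - w)^2))) = exp (- (pi * (1/2) * (x' - x)^2)) * exp (- (pi * (1/2) * (w' - w)^2))"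
        by (simp add: algebra_simps flip: exp_add)
      have c: "cis (pi * (w - w') * (x + x')) * cis (2 * pi * w' * t) = cis (pi * w * (x + x')) * cis (2 * pi * ?s * w')"
        unfolding cis_mult by (intro arg_cong[of _ _ cis]) (simp add: field_simps)
      have "gauss_ker z (x', w') * tfshift (x', w') gauss0 t
        = of_real (exp (- (pi * (1/2) * ((x' - x)^2 + (w' - w)^2))) / sqrt 2 * exp (- pi * (t - x')^2)) * (cis (pi * (w - w') * (x + x')) * cis (2 * pi * w' * t))"
        unfolding gauss_ker_eq by (simp add: z tfshift_def gauss0_def mult_ac)
      then show ?thesis unfolding e c by (simp add: mult_ac)
    qed
    then have "(LINT w'|lborel. gauss_ker z (x', w') * tfshift (x', w') gauss0 t)
      = ?C * (cis (2 * pi * ?s * w) * of_real (exp (- (pi * ?s^2 / (1/2))) / sqrt (1/2)))"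
      by (simp only: integral_mult_right_zero gaussian_Fourier[of "1/2"] zero_less_divide_1_iff zero_less_numeral)
    also have "\<dots> = of_real (exp (- (pi * (1/2) * (x' - x)^2)) * exp (- pi * (t - x')^2) * exp (- (pi * ?s^2 / (1/2)))) * (cis (pi * w * (x + x')) * cis (2 * pi * ?s * w))"
      by (simp add: real_sqrt_divide mult_ac)
    also have "cis (pi * w * (x + x')) * cis (2 * pi * ?s * w) = cis (2 * pi * w * t)"
      unfolding cis_mult by (intro arg_cong[of _ _ cis]) (simp add: field_simps)
    also have "exp (- (pi * (1/2) * (x' - x)^2)) * exp (- pi * (t - x')^2) * exp (- (pi * ?s^2 / (1/2))) = exp (- (pi * 2 * (x' - t)^2)) * exp (- pi * (t - x)^2)"
      unfolding exp_add[symmetric] by (intro arg_cong[of _ _ exp]) (simp add: power2_eq_square field_simps)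
    finally show "(LINT w'|lborel. gauss_ker z (x', w') * tfshift (x', w') gauss0 t)
      = of_real (exp (- (pi * 2 * (x' - t)^2))) * (of_real (exp (- pi * (t - x)^2)) * cis (2 * pi * w * t))"
      by (simp add: mult_ac)
  qed
  also have "\<dots> = of_real (LINT x'|lborel. exp (- (pi * 2 * (x' - t)^2))) * (of_real (exp (- pi * (t - x)^2)) * cis (2 * pi * w * t))"
    by (simp only: integral_mult_left_zero integral_complex_of_real)
  also have "\<dots> = tfshift z gauss0 t / sqrt 2"
    by (simp add: gaussian_integral z tfshift_def gauss0_def)
  finally show ?thesis .
qed

section \<open>Atomic decomposition into shifted Gaussians\<close>

text \<open>The positive and negative part of \<open>g\<close> are, up to a common factor, densities of probability measures
  with equal characteristic functions, so Levy's uniqueness theorem applies.\<close>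
lemma real_Fourier_unique:
  fixes g :: "real \<Rightarrow> real"
  assumes g: "integrable lborel g" and ft: "\<And>w. (LINT t|lborel. of_real (g t) * cis (w * t)) = 0"
  shows "AE t in lborel. g t = 0"
proof -
  define P where "P t = max (g t) 0" for t
  define Q where "Q t = max (- g t) 0" for t
  have gm [measurable]: "g \<in> borel_measurable borel" using g by auto
  have P: "integrable lborel P" and Q: "integrable lborel Q"
    unfolding P_def Q_def using g by (auto intro!: integrable_max)
  have PQ: "g t = P t - Q t" "0 \<le> P t" "0 \<le> Q t" "P t = 0 \<or> Q t = 0" for t by (auto simp: P_def Q_def)
  have ic: "integrable lborel (\<lambda>t. of_real (h t) * cis (w * t))" if "integrable lborel h" for h :: "real \<Rightarrow> real" and w
  proof -
    have [measurable]: "h \<in> borel_measurable borel" using that by auto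
    show ?thesis
      by (rule Bochner_Integration.integrable_bound[OF integrable_norm[OF that]]) (auto simp: norm_mult)
  qed
  have eq: "(LINT t|lborel. of_real (P t) * cis (w * t)) = (LINT t|lborel. of_real (Q t) * cis (w * t))" for w
  proof -
    have "(LINT t|lborel. of_real (g t) * cis (w * t)) = (LINT t|lborel. of_real (P t) * cis (w * t)) - (LINT t|lborel. of_real (Q t) * cis (w * t))"
      by (subst Bochner_Integration.integral_diff[symmetric, OF ic[OF P] ic[OF Q]])
        (intro Bochner_Integration.integral_cong refl, simp add: PQ(1) left_diff_distrib)
    then show ?thesis using ft by simp
  qed
  define m where "m = (LINT t|lborel. P t)"
  \<comment> \<open>Frequency 0 shows that both parts have the same mass \<open>m\<close>, the
    common factor by which they are normalized.\<close>
  have "complex_of_real (LINT t|lborel. P t) = of_real (LINT t|lborel. Q t)"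
    using eq[of 0] by simp
  then have mQ: "m = (LINT t|lborel. Q t)" unfolding m_def by (simp only: of_real_eq_iff)
  have m0: "0 \<le> m" unfolding m_def by (simp add: integral_nonneg PQ)
  show ?thesis
  proof (cases "m = 0")
    case True
    have "AE t in lborel. P t = 0" "AE t in lborel. Q t = 0"
      using integral_nonneg_eq_0_iff_AE[OF P] integral_nonneg_eq_0_iff_AE[OF Q] True mQ m_def PQ by auto
    then show ?thesis by eventually_elim (simp add: PQ(1))
  next
    case False
    then have m: "m > 0" using m0 by simp
    have [measurable]: "P \<in> borel_measurable borel" "Q \<in> borel_measurable borel" using P Q by auto
    have rd: "real_distribution (density lborel (\<lambda>t. ennreal (h t / m)))"
      and ch: "char (density lborel (\<lambda>t. ennreal (h t / m))) w = (LINT t|lborel. of_real (h t) * cis (w * t)) / of_real m"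
      if h: "integrable lborel h" "\<And>t. 0 \<le> h t" "(LINT t|lborel. h t) = m" for h :: "real \<Rightarrow> real" and w
    proof -
      have [measurable]: "h \<in> borel_measurable borel" using h by auto
      have "(\<integral>\<^sup>+t. ennreal (h t / m) \<partial>lborel) = ennreal (LINT t|lborel. h t / m)"
        using h m by (intro nn_integral_eq_integral) auto
      also have "\<dots> = 1" using h m by simp
      finally have "emeasure (density lborel (\<lambda>t. ennreal (h t / m))) (space (density lborel (\<lambda>t. ennreal (h t / m)))) = 1"
        by (simp add: emeasure_density)
      then show "real_distribution (density lborel (\<lambda>t. ennreal (h t / m)))"
        unfolding real_distribution_def real_distribution_axioms_def by (auto intro: prob_spaceI)
      have "char (density lborel (\<lambda>t. ennreal (h t / m))) w = (LINT t|lborel. (h t / m) *\<^sub>R cis (w * t))"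
        unfolding char_def cis_conv_exp[symmetric] using h m by (intro integral_density) auto
      also have "\<dots> = (LINT t|lborel. of_real (h t) * cis (w * t) / of_real m)"
        by (intro Bochner_Integration.integral_cong refl) (simp add: scaleR_conv_of_real)
      finally show "char (density lborel (\<lambda>t. ennreal (h t / m))) w = (LINT t|lborel. of_real (h t) * cis (w * t)) / of_real m"
        by simp
    qed
    have "density lborel (\<lambda>t. ennreal (P t / m)) = density lborel (\<lambda>t. ennreal (Q t / m))"
    proof (rule Levy_uniqueness)
      show "real_distribution (density lborel (\<lambda>t. ennreal (P t / m)))" by (rule rd[OF P PQ(2) m_def[symmetric]])
      show "real_distribution (density lborel (\<lambda>t. ennreal (Q t / m)))" by (rule rd[OF Q PQ(3) mQ[symmetric]])
      show "char (density lborel (\<lambda>t. ennreal (P t / m))) = char (density lborel (\<lambda>t. ennreal (Q t / m)))"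
        by (rule ext) (simp only: ch[OF P PQ(2) m_def[symmetric]] ch[OF Q PQ(3) mQ[symmetric]] eq)
    qed
    then have "AE t in lborel. ennreal (P t / m) = ennreal (Q t / m)"
      by (intro sigma_finite_measure.density_unique[OF sigma_finite_lborel]) auto
    then show ?thesis
    proof eventually_elim
      case (elim t)
      then have "P t = Q t" using m PQ by simp
      then show ?case using PQ(1)[of t] by simp
    qed
  qed
qed

text \<open>The transform of the conjugate at \<open>w\<close> is the conjugate of the transform at
  \<open>-w\<close>, so it vanishes as well. Real and imaginary part then have vanishing transforms
  separately.\<close>

lemma Fourier_unique:
  fixes g :: "real \<Rightarrow> complex"
  assumes g: "integrable lborel g" and ft: "\<And>w. (LINT t|lborel. g t * cis (w * t)) = 0"
  shows "AE t in lborel. g t = 0"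
proof -
  have [measurable]: "g \<in> borel_measurable borel" using g by auto
  have ic: "integrable lborel (\<lambda>t. h t * cis (w * t))" if "integrable lborel h" for h :: "real \<Rightarrow> complex" and w
  proof -
    have [measurable]: "h \<in> borel_measurable borel" using that by auto
    show ?thesis
      by (rule Bochner_Integration.integrable_bound[OF integrable_norm[OF that]]) (auto simp: norm_mult)
  qed
  have c: "(LINT t|lborel. cnj (g t) * cis (w * t)) = 0" for w
  proof -
    have "(LINT t|lborel. cnj (g t) * cis (w * t)) = (LINT t|lborel. cnj (g t * cis ((- w) * t)))"
      by (intro Bochner_Integration.integral_cong refl) (simp add: cis_cnj)
    then show ?thesis using ft[of "- w"] by (simp only: Bochner_Integration.integral_cnj) simp
  qed
  have gc: "integrable lborel (\<lambda>t. cnj (g t))" using g by simp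
  have "(LINT t|lborel. of_real (Re (g t)) * cis (w * t)) = 0" for w
  proof -
    have "(LINT t|lborel. of_real (Re (g t)) * cis (w * t)) = (LINT t|lborel. (g t * cis (w * t) + cnj (g t) * cis (w * t)) / 2)"
      by (intro Bochner_Integration.integral_cong refl) (simp add: complex_add_cnj flip: distrib_right)
    then show ?thesis using ic[OF g] ic[OF gc] by (simp add: ft c)
  qed
  from real_Fourier_unique[OF integrable_Re[OF g] this] have re: "AE t in lborel. Re (g t) = 0" .
  have "(LINT t|lborel. of_real (Im (g t)) * cis (w * t)) = 0" for w
  proof -
    have "(LINT t|lborel. of_real (Im (g t)) * cis (w * t)) = (LINT t|lborel. (g t * cis (w * t) - cnj (g t) * cis (w * t)) / (2 * \<i>))"
    proof (intro Bochner_Integration.integral_cong refl)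
      fix t
      have "complex_of_real (Im (g t)) = (g t - cnj (g t)) / (2 * \<i>)" by (simp add: complex_diff_cnj complex_eq_iff)
      then show "of_real (Im (g t)) * cis (w * t) = (g t * cis (w * t) - cnj (g t) * cis (w * t)) / (2 * \<i>)"
        by (simp add: left_diff_distrib diff_divide_distrib)
    qed
    then show ?thesis using ic[OF g] ic[OF gc] by (simp add: ft c)
  qed
  from real_Fourier_unique[OF integrable_Im[OF g] this] have im: "AE t in lborel. Im (g t) = 0" .
  from re im show ?thesis by eventually_elim (simp add: complex_eq_iff)
qed

section \<open>Synthesis with Gaussians and the inversion formula\<close>

definition synth :: "(real \<times> real \<Rightarrow> complex) \<Rightarrow> real \<Rightarrow> complex" where
  "synth F t = (LINT z|lborel. F z * tfshift z gauss0 t)"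

lemma tfshift_gauss0_joint_measurable [measurable]:
  "(\<lambda>p. tfshift (fst p) gauss0 (snd p)) \<in> borel_measurable (borel \<Otimes>\<^sub>M borel)"
proof -
  have "continuous_on UNIV (\<lambda>p::(real\<times>real)\<times>real. tfshift (fst p) gauss0 (snd p))"
    unfolding tfshift_def gauss0_def cis_conv_exp by (intro continuous_intros)
  then show ?thesis by (simp add: borel_prod borel_measurable_continuous_onI)
qed

lemma synth_integrable:
  assumes "integrable lborel F"
  shows "integrable lborel (\<lambda>z. F z * tfshift z gauss0 t)"
proof -
  have [measurable]: "F \<in> borel_measurable borel" using assms by auto
  show ?thesis
    by (rule Bochner_Integration.integrable_bound[OF assms])
      (auto simp: norm_mult intro!: AE_I2 mult_left_le cmod_tfshift_gauss0_le)
qed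

lemma cmod_synth_le:
  assumes "integrable lborel F"
  shows "cmod (synth F t) \<le> (LINT z|lborel. cmod (F z))"
  unfolding synth_def
proof (rule order_trans[OF integral_norm_bound], rule integral_mono)
  show "integrable lborel (\<lambda>x. cmod (F x * tfshift x gauss0 t))"
    by (rule integrable_norm[OF synth_integrable[OF assms]])
qed (auto simp: norm_mult intro!: mult_left_le cmod_tfshift_gauss0_le integrable_norm assms)

lemma synth_measurable [measurable]:
  assumes "integrable lborel F"
  shows "synth F \<in> borel_measurable borel"
proof -
  have [measurable]: "F \<in> borel_measurable borel" using assms by auto
  have "(\<lambda>p. F (snd p) * tfshift (snd p) gauss0 (fst p)) \<in> borel_measurable (borel \<Otimes>\<^sub>M borel)"
    using measurable_compose[OF measurable_Pair[OF measurable_snd measurable_fst] tfshift_gauss0_joint_measurable]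
    by simp measurable
  then have "case_prod (\<lambda>t z. F z * tfshift z gauss0 t) \<in> borel_measurable (lborel \<Otimes>\<^sub>M lborel)"
    by (simp add: case_prod_beta' cong: measurable_cong_sets)
  then have "(\<lambda>t. LINT z|lborel. F z * tfshift z gauss0 t) \<in> borel_measurable lborel"
    by (rule lborel.borel_measurable_lebesgue_integral)
  then show ?thesis unfolding synth_def[abs_def] by simp
qed

lemma cnj_gauss_ker: "cnj (gauss_ker z y) = gauss_ker y z"
  unfolding gauss_ker_def by (rule L2_inner_cnj)

text \<open>The form in which Fubini's theorem is prepared throughout: one integrable factor in the
  outer variable, and a kernel whose inner L^1 norms are uniformly bounded.\<close>

lemma pair_mult_integrable:
  fixes F :: "'a :: euclidean_space \<Rightarrow> complex" and h :: "'a \<times> 'b :: euclidean_space \<Rightarrow> complex"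
  assumes F: "integrable lborel F" and h [measurable]: "h \<in> borel_measurable (borel \<Otimes>\<^sub>M borel)"
    and i: "\<And>z. integrable lborel (\<lambda>y. h (z, y))" and b: "\<And>z. (LINT y|lborel. cmod (h (z, y))) \<le> B"
  shows "integrable (lborel \<Otimes>\<^sub>M lborel) (\<lambda>p. F (fst p) * h p)"
proof -
  have [measurable]: "F \<in> borel_measurable borel" using F by auto
  show ?thesis
  proof (rule lborel_pair.Fubini_integrable)
    have "(\<lambda>z. LINT y|lborel. cmod (h (z, y))) \<in> borel_measurable lborel"
      by (rule lborel.borel_measurable_lebesgue_integral) (simp add: case_prod_beta')
    then have [measurable]: "(\<lambda>z. LINT y|lborel. cmod (h (z, y))) \<in> borel_measurable borel" by simp
    have "integrable lborel (\<lambda>z. cmod (F z) * (LINT y|lborel. cmod (h (z, y))))"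
    proof (rule Bochner_Integration.integrable_bound[of _ "\<lambda>z. B * cmod (F z)"])
      show "AE z in lborel. norm (cmod (F z) * (LINT y|lborel. cmod (h (z, y)))) \<le> norm (B * cmod (F z))"
      proof (rule AE_I2)
        fix z
        have "0 \<le> (LINT y|lborel. cmod (h (z, y)))" by (simp add: integral_nonneg)
        then show "norm (cmod (F z) * (LINT y|lborel. cmod (h (z, y)))) \<le> norm (B * cmod (F z))"
          using order_trans[OF b[of z] abs_ge_self] by (simp add: abs_mult mult.commute[of _ "cmod (F z)"] mult_left_mono)
      qed
    qed (use F in auto)
    then show "integrable lborel (\<lambda>x. LINT y|lborel. cmod (F (fst (x, y)) * h (x, y)))" by (simp add: norm_mult)
    show "AE x in lborel. integrable lborel (\<lambda>y. F (fst (x, y)) * h (x, y))" using i by simp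
  qed measurable
qed

lemma integral_swap:
  fixes f :: "'a :: euclidean_space \<Rightarrow> 'b :: euclidean_space \<Rightarrow> complex"
  assumes "integrable (lborel \<Otimes>\<^sub>M lborel) (\<lambda>p. f (fst p) (snd p))"
  shows "(LINT y|lborel. (LINT x|lborel. f x y)) = (LINT x|lborel. (LINT y|lborel. f x y))"
  using assms by (intro lborel_pair.Fubini_integral) (simp add: case_prod_beta')

lemma STFT_gauss_inner: "STFT gauss0 f z = (LINT t|lborel. f t * cnj (tfshift z gauss0 t))"
  by (simp add: STFT_eq_inner L2_inner_def)

text \<open>After interchanging the integrals, the inner one is the self-inversion of the Gaussian.
  The kernel is integrable and Cauchy-Schwarz bounds the other factor uniformly, so the interchange
  is legitimate for every \<open>f\<close> in L^2.\<close>

lemma STFT_gauss_reproducing: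
  assumes f: "L2 f"
  shows "(LINT y|lborel. STFT gauss0 f y * gauss_ker y z) = STFT gauss0 f z / sqrt 2"
proof -
  have [measurable]: "f \<in> borel_measurable borel" using f by auto
  have m: "(\<lambda>p. f (snd p) * cnj (tfshift (fst p) gauss0 (snd p))) \<in> borel_measurable (borel \<Otimes>\<^sub>M borel)"
    using measurable_compose[OF tfshift_gauss0_joint_measurable measurable_cnj] by measurable
  have i: "integrable (lborel \<Otimes>\<^sub>M lborel) (\<lambda>p. gauss_ker z (fst p) * cnj (f (snd p) * cnj (tfshift (fst p) gauss0 (snd p))))"
  proof (rule pair_mult_integrable[OF gauss_ker_integrable])
    show "(\<lambda>p. cnj (f (snd p) * cnj (tfshift (fst p) gauss0 (snd p)))) \<in> borel_measurable (borel \<Otimes>\<^sub>M borel)"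
      by (rule measurable_compose[OF m measurable_cnj])
    show "integrable lborel (\<lambda>t. cnj (f (snd (y, t)) * cnj (tfshift (fst (y, t)) gauss0 (snd (y, t)))))" for y
      using L2_inner_integrable[OF L2_tfshift[OF L2_gauss0] f, of y] by (simp add: mult.commute)
    show "(LINT t|lborel. cmod (cnj (f (snd (y, t)) * cnj (tfshift (fst (y, t)) gauss0 (snd (y, t)))))) \<le> L2_norm f * L2_norm gauss0" for y
      using L2_Cauchy_Schwarz_abs(1)[OF f L2_tfshift[OF L2_gauss0], of y] by (simp add: norm_mult L2_norm_tfshift)
  qed
  then have i': "integrable (lborel \<Otimes>\<^sub>M lborel) (\<lambda>p. cnj (gauss_ker z (fst p) * cnj (f (snd p) * cnj (tfshift (fst p) gauss0 (snd p)))))"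
    by (rule integrable_cnj)
  have "(LINT y|lborel. STFT gauss0 f y * gauss_ker y z) = (LINT y|lborel. (LINT t|lborel. cnj (gauss_ker z y * cnj (f t * cnj (tfshift y gauss0 t)))))"
    unfolding STFT_gauss_inner cnj_gauss_ker[of z, symmetric] integral_mult_left_zero[symmetric]
    by (simp add: mult_ac)
  also have "\<dots> = (LINT t|lborel. (LINT y|lborel. cnj (gauss_ker z y * cnj (f t * cnj (tfshift y gauss0 t)))))"
    by (rule integral_swap[symmetric]) (rule i')
  also have "\<dots> = (LINT t|lborel. f t * cnj (LINT y|lborel. gauss_ker z y * tfshift y gauss0 t))"
    by (intro Bochner_Integration.integral_cong refl)
      (simp add: mult_ac flip: Bochner_Integration.integral_cnj integral_mult_right_zero)
  also have "\<dots> = STFT gauss0 f z / sqrt 2"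
    unfolding gauss_self_inversion STFT_gauss_inner by simp
  finally show ?thesis .
qed

lemma STFT_synth:
  assumes F: "integrable lborel F"
  shows "(LINT t|lborel. synth F t * cnj (tfshift z gauss0 t)) = (LINT y|lborel. F y * gauss_ker y z)"
proof -
  have i: "integrable (lborel \<Otimes>\<^sub>M lborel) (\<lambda>p. F (fst p) * (tfshift (fst p) gauss0 (snd p) * cnj (tfshift z gauss0 (snd p))))"
  proof (rule pair_mult_integrable[OF F])
    have [measurable]: "tfshift z gauss0 \<in> borel_measurable borel" by (rule tfshift_measurable) measurable
    show "(\<lambda>p. tfshift (fst p) gauss0 (snd p) * cnj (tfshift z gauss0 (snd p))) \<in> borel_measurable (borel \<Otimes>\<^sub>M borel)"
      by measurable
    show "integrable lborel (\<lambda>t. tfshift (fst (y, t)) gauss0 (snd (y, t)) * cnj (tfshift z gauss0 (snd (y, t))))" for y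
      using L2_inner_integrable[OF L2_tfshift[OF L2_gauss0] L2_tfshift[OF L2_gauss0], of y z] by simp
    show "(LINT t|lborel. cmod (tfshift (fst (y, t)) gauss0 (snd (y, t)) * cnj (tfshift z gauss0 (snd (y, t))))) \<le> L2_norm gauss0 * L2_norm gauss0" for y
      using L2_Cauchy_Schwarz_abs(1)[OF L2_tfshift[OF L2_gauss0] L2_tfshift[OF L2_gauss0], of y z] by (simp add: norm_mult L2_norm_tfshift)
  qed
  have "(LINT t|lborel. synth F t * cnj (tfshift z gauss0 t)) = (LINT t|lborel. (LINT y|lborel. F y * (tfshift y gauss0 t * cnj (tfshift z gauss0 t))))"
    unfolding synth_def by (intro Bochner_Integration.integral_cong refl) (simp flip: mult.assoc)
  also have "\<dots> = (LINT y|lborel. (LINT t|lborel. F y * (tfshift y gauss0 t * cnj (tfshift z gauss0 t))))"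
    by (rule integral_swap) (rule i)
  also have "\<dots> = (LINT y|lborel. F y * gauss_ker y z)"
    by (simp add: gauss_ker_def L2_inner_def)
  finally show ?thesis .
qed

lemma STFT_gauss0_measurable:
  assumes L2: "L2 \<phi>"
  shows "STFT gauss0 \<phi> \<in> borel_measurable borel"
proof -
  have [measurable]: "\<phi> \<in> borel_measurable borel" using L2 by auto
  have "(\<lambda>p. \<phi> (snd p) * cnj (tfshift (fst p) gauss0 (snd p))) \<in> borel_measurable (borel \<Otimes>\<^sub>M borel)"
    using measurable_compose[OF tfshift_gauss0_joint_measurable measurable_cnj] by measurable
  then have "case_prod (\<lambda>z t. \<phi> t * cnj (tfshift z gauss0 t)) \<in> borel_measurable (lborel \<Otimes>\<^sub>M lborel)"
    by (simp add: case_prod_beta' cong: measurable_cong_sets)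
  then have "(\<lambda>z. LINT t|lborel. \<phi> t * cnj (tfshift z gauss0 t)) \<in> borel_measurable lborel"
    by (rule lborel.borel_measurable_lebesgue_integral)
  then show ?thesis by (simp add: STFT_gauss_inner[abs_def])
qed

lemma in_S0_integrable:
  assumes "in_S0 \<phi>"
  shows "integrable lborel (STFT gauss0 \<phi>)"
  using assms integrable_norm_iff[of "STFT gauss0 \<phi>" lborel] STFT_gauss0_measurable[of \<phi>]
  by (simp add: in_S0_def)

text \<open>The difference of both sides has vanishing inner products with all shifted Gaussians.
  Those at \<open>(0, w)\<close> form the Fourier transform of the difference times
  \<open>gauss0\<close>, so that product vanishes almost everywhere; and \<open>gauss0\<close> has
  no zeros.\<close>

theorem gauss_inversion:
  assumes S0: "in_S0 \<phi>"
  shows "AE t in lborel. \<phi> t = sqrt 2 * synth (STFT gauss0 \<phi>) t"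
proof -
  let ?V = "STFT gauss0 \<phi>"
  have L2: "L2 \<phi>" using S0 by (simp add: in_S0_def)
  have V: "integrable lborel ?V" by (rule in_S0_integrable[OF S0])
  have [measurable]: "synth ?V \<in> borel_measurable borel" by (rule synth_measurable[OF V])
  have [measurable]: "\<phi> \<in> borel_measurable borel" using L2 by auto
  let ?D = "\<lambda>t. \<phi> t - sqrt 2 * synth ?V t"
  have gi: "integrable lborel gauss0"
    using gaussian_Fourier_std(1)[of 1] by (simp add: gauss0_def[abs_def])
  have gi': "integrable lborel (tfshift z gauss0)" for z
  proof (rule Bochner_Integration.integrable_bound[of _ "\<lambda>t. exp (- (pi * 1 * (t - fst z)^2))"])
    show "integrable lborel (\<lambda>t. exp (- (pi * 1 * (t - fst z)^2)))" by (rule gaussian_integrable) simp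
    show "AE t in lborel. cmod (tfshift z gauss0 t) \<le> norm (exp (- (pi * 1 * (t - fst z)^2)))"
      by (simp add: cmod_tfshift cmod_gauss0)
  qed (use tfshift_measurable[OF gauss0_measurable] in simp)
  have i1: "integrable lborel (\<lambda>t. \<phi> t * cnj (tfshift z gauss0 t))" for z
    by (rule L2_inner_integrable[OF L2 L2_tfshift[OF L2_gauss0]])
  have i2: "integrable lborel (\<lambda>t. synth ?V t * cnj (tfshift z gauss0 t))" for z
  proof (rule Bochner_Integration.integrable_bound[of _ "\<lambda>t. (LINT z|lborel. cmod (?V z)) * cmod (tfshift z gauss0 t)"])
    show "AE t in lborel. cmod (synth ?V t * cnj (tfshift z gauss0 t)) \<le> norm ((LINT z|lborel. cmod (?V z)) * cmod (tfshift z gauss0 t))"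
      using cmod_synth_le[OF V] by (auto simp: norm_mult abs_mult intro!: AE_I2 mult_right_mono order_trans[OF _ abs_ge_self])
  qed (use gi' tfshift_measurable[OF gauss0_measurable, of z] in auto)
  have D0: "(LINT t|lborel. ?D t * cnj (tfshift z gauss0 t)) = 0" for z
  proof -
    have "(LINT t|lborel. ?D t * cnj (tfshift z gauss0 t)) = (LINT t|lborel. \<phi> t * cnj (tfshift z gauss0 t)) - sqrt 2 * (LINT t|lborel. synth ?V t * cnj (tfshift z gauss0 t))"
      unfolding left_diff_distrib mult.assoc using i1 i2 by (subst Bochner_Integration.integral_diff) auto
    also have "\<dots> = ?V z - sqrt 2 * (?V z / sqrt 2)"
      unfolding STFT_synth[OF V] STFT_gauss_reproducing[OF L2] by (simp add: STFT_gauss_inner)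
    finally show ?thesis by simp
  qed
  have "AE t in lborel. ?D t * gauss0 t = 0"
  proof (rule Fourier_unique)
    have e: "?D t * cnj (tfshift (0, w) gauss0 t) = ?D t * gauss0 t * cis (- (2 * pi * w * t))" for t w
      by (simp add: tfshift_def gauss0_def cis_cnj)
    have "integrable lborel (\<lambda>t. ?D t * cnj (tfshift (0, 0) gauss0 t))"
      unfolding left_diff_distrib mult.assoc using i1[of "(0,0)"] i2[of "(0,0)"] by auto
    then show "integrable lborel (\<lambda>t. ?D t * gauss0 t)" unfolding e by simp
    fix w
    show "(LINT t|lborel. ?D t * gauss0 t * cis (w * t)) = 0"
      using D0[of "(0, - w / (2 * pi))"] unfolding e by simp
  qed
  then show ?thesis by eventually_elim (simp add: gauss0_def)
qed

section \<open>Discretizing the synthesis on a fine grid\<close>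

definition grid :: "nat \<Rightarrow> real \<times> real \<Rightarrow> real \<times> real" where
  "grid n z = (of_int \<lfloor>real (Suc n) * fst z\<rfloor> / real (Suc n), of_int \<lfloor>real (Suc n) * snd z\<rfloor> / real (Suc n))"

lemma grid_measurable [measurable]: "grid n \<in> borel_measurable borel"
proof -
  have "(\<lambda>z::real\<times>real. (of_int \<lfloor>real (Suc n) * fst z\<rfloor> / real (Suc n), of_int \<lfloor>real (Suc n) * snd z\<rfloor> / real (Suc n)))
    \<in> measurable (borel \<Otimes>\<^sub>M borel) (borel \<Otimes>\<^sub>M borel)" by measurable
  then show ?thesis unfolding grid_def[abs_def] borel_prod .
qed

lemma floor_grid_dist:
  fixes x :: real
  shows "\<bar>of_int \<lfloor>real (Suc n) * x\<rfloor> / real (Suc n) - x\<bar> \<le> 1 / real (Suc n)"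
proof -
  have "\<bar>of_int \<lfloor>real (Suc n) * x\<rfloor> - real (Suc n) * x\<bar> \<le> 1" by linarith
  then have "\<bar>of_int \<lfloor>real (Suc n) * x\<rfloor> - real (Suc n) * x\<bar> / real (Suc n) \<le> 1 / real (Suc n)"
    by (intro divide_right_mono) auto
  moreover have "of_int \<lfloor>real (Suc n) * x\<rfloor> / real (Suc n) - x = (of_int \<lfloor>real (Suc n) * x\<rfloor> - real (Suc n) * x) / real (Suc n)"
    by (simp add: diff_divide_distrib del: of_nat_Suc)
  ultimately show ?thesis by simp
qed

lemma grid_tendsto: "(\<lambda>n. grid n z) \<longlonglongrightarrow> z"
proof -
  have "(\<lambda>n. of_int \<lfloor>real (Suc n) * x\<rfloor> / real (Suc n)) \<longlonglongrightarrow> x" for x :: real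
  proof (rule LIM_zero_cancel, rule Lim_null_comparison)
    show "\<forall>\<^sub>F n in sequentially. norm (of_int \<lfloor>real (Suc n) * x\<rfloor> / real (Suc n) - x) \<le> 1 / real (Suc n)"
      using floor_grid_dist by (auto simp del: of_nat_Suc)
    show "(\<lambda>n. 1 / real (Suc n)) \<longlonglongrightarrow> 0" by (rule LIMSEQ_Suc[OF lim_1_over_n])
  qed
  from tendsto_Pair[OF this[of "fst z"] this[of "snd z"]] show ?thesis by (simp add: grid_def)
qed

text \<open>A bound that depends on \<open>z\<close> alone and dominates the kernel at all nearby
  \<open>z'\<close>, as dominated convergence over the grids needs. From
  \<open>|y - z|^2 \<le> 2 |y - z'|^2 + 4\<close> one loses half of the decay rate and the factor
  \<open>exp pi\<close>.\<close>

lemma gauss_ker_near: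
  assumes "\<bar>fst z' - fst z\<bar> \<le> 1" "\<bar>snd z' - snd z\<bar> \<le> 1"
  shows "cmod (gauss_ker z' y) \<le> exp pi * exp (- (pi * (1/4) * ((fst y - fst z)^2 + (snd y - snd z)^2)))"
proof -
  have h: "(a - b)^2 \<le> 2 * (a - b')^2 + 2" if "\<bar>b' - b\<bar> \<le> 1" for a b b' :: real
  proof -
    have "(a - b)^2 = ((a - b') + (b' - b))^2" by simp
    also have "\<dots> \<le> 2 * (a - b')^2 + 2 * (b' - b)^2"
      using sum_squares_bound[of "a - b'" "b' - b"] unfolding power2_sum by linarith
    also have "(b' - b)^2 \<le> 1" using that by (simp add: abs_square_le_1)
    finally show ?thesis by simp
  qed
  let ?d = "(fst y - fst z)^2 + (snd y - snd z)^2" and ?d' = "(fst y - fst z')^2 + (snd y - snd z')^2"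
  have "?d \<le> 2 * ?d' + 4" using add_mono[OF h[OF assms(1), of "fst y"] h[OF assms(2), of "snd y"]] by (simp add: distrib_left)
  then have "pi * (1/4) * ?d \<le> pi * (1/4) * (2 * ?d' + 4)" by (intro mult_left_mono) auto
  then have "- (pi * (1/2) * ?d') \<le> pi + - (pi * (1/4) * ?d)" by (simp add: algebra_simps)
  then have "exp (- (pi * (1/2) * ?d')) \<le> exp pi * exp (- (pi * (1/4) * ?d))"
    unfolding exp_add[symmetric] by (simp only: exp_le_cancel_iff)
  moreover have "exp (- (pi * (1/2) * ?d')) / sqrt 2 \<le> exp (- (pi * (1/2) * ?d')) / 1"
    by (intro divide_left_mono) auto
  ultimately show ?thesis unfolding cmod_gauss_ker by simp
qed

lemma gauss_ker_continuous: "continuous_on UNIV (\<lambda>z. gauss_ker z y)"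
  unfolding gauss_ker_eq[abs_def] cis_conv_exp by (intro continuous_intros) auto

lemma gauss_ker_grid_diff:
  shows "cmod (gauss_ker z y - gauss_ker (grid n z) y) \<le> 2 * exp pi * exp (- (pi * (1/4) * ((fst y - fst z)^2 + (snd y - snd z)^2)))"
proof -
  have "\<bar>fst (grid n z) - fst z\<bar> \<le> 1" "\<bar>snd (grid n z) - snd z\<bar> \<le> 1"
    using floor_grid_dist[of n "fst z"] floor_grid_dist[of n "snd z"]
    by (auto simp: grid_def elim!: order_trans simp del: of_nat_Suc)
  from gauss_ker_near[OF this, of y] gauss_ker_near[of z z y] show ?thesis
    using norm_triangle_ineq4[of "gauss_ker z y" "gauss_ker (grid n z) y"] by simp
qed

lemma gauss_ker_grid_measurable [measurable]:
  "(\<lambda>p. gauss_ker (grid n (fst p)) (snd p)) \<in> borel_measurable (borel \<Otimes>\<^sub>M borel)"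
proof -
  have "(\<lambda>p. (grid n (fst p), snd p)) \<in> measurable (borel \<Otimes>\<^sub>M borel) (borel \<Otimes>\<^sub>M borel)" by measurable
  from measurable_compose[OF this gauss_ker_measurable(1)] show ?thesis by simp
qed

lemma gauss_near_integrable:
  fixes F :: "real \<times> real \<Rightarrow> complex"
  assumes F: "integrable lborel F"
  shows "integrable (lborel \<Otimes>\<^sub>M lborel) (\<lambda>p. F (fst p) * complex_of_real
    (2 * exp pi * exp (- (pi * (1/4) * ((fst (snd p) - fst (fst p))^2 + (snd (snd p) - snd (fst p))^2)))))"
proof (rule pair_mult_integrable[OF F])
  have "continuous_on UNIV (\<lambda>p::(real\<times>real)\<times>(real\<times>real). complex_of_real (2 * exp pi * exp (- (pi * (1/4) * ((fst (snd p) - fst (fst p))^2 + (snd (snd p) - snd (fst p))^2)))))"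
    by (intro continuous_intros)
  then show "(\<lambda>p::(real\<times>real)\<times>(real\<times>real). complex_of_real (2 * exp pi * exp (- (pi * (1/4) * ((fst (snd p) - fst (fst p))^2 + (snd (snd p) - snd (fst p))^2))))) \<in> borel_measurable (borel \<Otimes>\<^sub>M borel)"
    by (simp add: borel_prod borel_measurable_continuous_onI)
  fix z :: "real \<times> real"
  have i: "integrable lborel (\<lambda>y. 2 * exp pi * exp (- (pi * (1/4) * ((fst y - fst z)^2 + (snd y - snd z)^2))))"
    using gaussian2_integrable(1)[of "1/4" z] by simp
  from i show "integrable lborel (\<lambda>y. complex_of_real (2 * exp pi * exp (- (pi * (1/4) * ((fst (snd (z, y)) - fst (fst (z, y)))^2 + (snd (snd (z, y)) - snd (fst (z, y)))^2)))))"
    by (simp only: fst_conv snd_conv integrable_of_real)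
  \<comment> \<open>A Gaussian of parameter 1/4 in the plane has integral 4, whence
    \<open>8 * exp pi\<close>.\<close>
  show "(LINT y|lborel. cmod (complex_of_real (2 * exp pi * exp (- (pi * (1/4) * ((fst (snd (z, y)) - fst (fst (z, y)))^2 + (snd (snd (z, y)) - snd (fst (z, y)))^2)))))) \<le> 8 * exp pi"
    using gaussian2_integrable(2)[of "1/4" z] by (simp add: norm_mult)
qed

lemma grid_error_tendsto:
  fixes F :: "real \<times> real \<Rightarrow> complex"
  assumes F: "integrable lborel F"
  defines "h \<equiv> \<lambda>n p. F (fst p) * (gauss_ker (fst p) (snd p) - gauss_ker (grid n (fst p)) (snd p))"
  shows "integrable (lborel \<Otimes>\<^sub>M lborel) (h n)"
    and "(\<lambda>n. LINT p|(lborel \<Otimes>\<^sub>M lborel). cmod (h n p)) \<longlonglongrightarrow> 0"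
proof -
  let ?b = "\<lambda>p. F (fst p) * complex_of_real (2 * exp pi * exp (- (pi * (1/4) * ((fst (snd p) - fst (fst p))^2 + (snd (snd p) - snd (fst p))^2))))"
  have [measurable]: "F \<in> borel_measurable borel" using F by auto
  have hm [measurable]: "h n \<in> borel_measurable (borel \<Otimes>\<^sub>M borel)" for n unfolding h_def by measurable
  have bd: "cmod (h n p) \<le> cmod (?b p)" for n p
    unfolding h_def norm_mult using gauss_ker_grid_diff[of "fst p" "snd p" n] by (intro mult_left_mono) (auto simp: norm_mult)
  show "integrable (lborel \<Otimes>\<^sub>M lborel) (h n)"
    by (rule Bochner_Integration.integrable_bound[OF gauss_near_integrable[OF F]]) (use bd in auto)
  have "(\<lambda>n. LINT p|(lborel \<Otimes>\<^sub>M lborel). cmod (h n p)) \<longlonglongrightarrow> (LINT p|((lborel :: (real\<times>real) measure) \<Otimes>\<^sub>M (lborel :: (real\<times>real) measure)). 0)"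
  proof (rule integral_dominated_convergence[OF _ _ integrable_norm[OF gauss_near_integrable[OF F]]])
    show "AE p in lborel \<Otimes>\<^sub>M lborel. (\<lambda>n. cmod (h n p)) \<longlonglongrightarrow> 0"
    proof (rule AE_I2)
      fix p :: "(real\<times>real)\<times>(real\<times>real)"
      have "(\<lambda>n. gauss_ker (grid n (fst p)) (snd p)) \<longlonglongrightarrow> gauss_ker (fst p) (snd p)"
        using continuous_on_tendsto_compose[OF gauss_ker_continuous grid_tendsto] by simp
      then have "(\<lambda>n. h n p) \<longlonglongrightarrow> F (fst p) * (gauss_ker (fst p) (snd p) - gauss_ker (fst p) (snd p))"
        unfolding h_def by (intro tendsto_intros)
      then show "(\<lambda>n. cmod (h n p)) \<longlonglongrightarrow> 0" by (simp add: tendsto_norm_zero)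
    qed
  qed (use bd in \<open>auto\<close>)
  then show "(\<lambda>n. LINT p|(lborel \<Otimes>\<^sub>M lborel). cmod (h n p)) \<longlonglongrightarrow> 0" by simp
qed

text \<open>The grid point is constant on each of countably many disjoint measurable cells, so the
  integral is a series whose coefficients are the integrals of \<open>F\<close> over the cells.
  Disjointness keeps the sum of their moduli below the L^1 norm of \<open>F\<close>.\<close>

lemma sum_over_cells:
  fixes F :: "real \<times> real \<Rightarrow> complex"
  assumes F: "integrable lborel F"
  obtains c \<zeta> where "summable (\<lambda>k. cmod (c k))" "(\<Sum>k. cmod (c k)) \<le> (LINT z|lborel. cmod (F z))"
    "\<And>t. (LINT z|lborel. F z * tfshift (grid n z) gauss0 t) = (\<Sum>k. c k * tfshift (\<zeta> k) gauss0 t)"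
proof -
  have [measurable]: "F \<in> borel_measurable borel" using F by auto
  have inf: "infinite (UNIV :: (int \<times> int) set)"
    by (simp add: finite_prod infinite_UNIV_int)
  obtain e :: "int \<times> int \<Rightarrow> nat" where e: "bij_betw e UNIV UNIV"
    using countableE_infinite[OF _ inf] by auto
  define cd where "cd = inv e"
  have cd: "bij cd" unfolding cd_def using e by (rule bij_imp_bij_inv)
  define \<zeta> where "\<zeta> k = (real_of_int (fst (cd k)) / real (Suc n), real_of_int (snd (cd k)) / real (Suc n))" for k
  have \<zeta>: "\<zeta> i = \<zeta> j \<longleftrightarrow> i = j" for i j
  proof
    assume "\<zeta> i = \<zeta> j"
    then have "cd i = cd j" unfolding \<zeta>_def by (simp add: prod_eq_iff del: of_nat_Suc)
    then show "i = j" using bij_is_inj[OF cd] by (simp add: inj_eq)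
  qed simp
  have \<zeta>_surj: "\<exists>k. grid n z = \<zeta> k" for z
  proof -
    obtain k where k: "(\<lfloor>real (Suc n) * fst z\<rfloor>, \<lfloor>real (Suc n) * snd z\<rfloor>) = cd k"
      using surjD[OF bij_is_surj[OF cd]] by blast
    have "grid n z = \<zeta> k" unfolding \<zeta>_def grid_def k[symmetric] fst_conv snd_conv ..
    then show ?thesis ..
  qed
  define A where "A k = {z. grid n z = \<zeta> k}" for k
  have A_sets: "A k \<in> sets lborel" for k
  proof -
    have "A k = grid n -` {\<zeta> k} \<inter> space borel" by (auto simp: A_def)
    also have "\<dots> \<in> sets borel" by (rule measurable_sets[OF grid_measurable]) simp
    finally show ?thesis by simp
  qed
  have disj: "A i \<inter> A j = {}" if "i \<noteq> j" for i j using that \<zeta> by (auto simp: A_def)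
  have UN: "(\<Union>k. A k) = UNIV" using \<zeta>_surj by (auto simp: A_def)
  define c where "c k = (LINT z:A k|lborel. F z)" for k
  have nF: "set_integrable lborel (A k) (\<lambda>z. cmod (F z))" for k
    unfolding set_integrable_def using integrable_norm[OF F] A_sets by (intro integrable_mult_indicator)
  have cb: "cmod (c k) \<le> (LINT z:A k|lborel. cmod (F z))" for k
    unfolding c_def set_lebesgue_integral_def
    by (rule order_trans[OF integral_norm_bound]) simp
  have part: "(\<Sum>k<m. cmod (c k)) \<le> (LINT z|lborel. cmod (F z))" for m
  proof -
    have "(\<Sum>k<m. cmod (c k)) \<le> (\<Sum>k<m. LINT z:A k|lborel. cmod (F z))" by (intro sum_mono cb)
    also have "\<dots> = (LINT z:(\<Union>k<m. A k)|lborel. cmod (F z))"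
      using disj by (intro set_integral_finite_Union[symmetric] nF A_sets) (auto simp: disjoint_family_on_def)
    also have "\<dots> \<le> (LINT z|lborel. cmod (F z))"
      unfolding set_lebesgue_integral_def using A_sets
      by (intro integral_mono integrable_mult_indicator integrable_norm F) (auto simp: indicator_def)
    finally show ?thesis .
  qed
  have s: "summable (\<lambda>k. cmod (c k))" by (rule summableI_nonneg_bounded[OF _ part]) auto
  have sl: "(\<Sum>k. cmod (c k)) \<le> (LINT z|lborel. cmod (F z))" by (rule suminf_le_const[OF s part])
  have "(LINT z|lborel. F z * tfshift (grid n z) gauss0 t) = (\<Sum>k. c k * tfshift (\<zeta> k) gauss0 t)" for t
  proof -
    have [measurable]: "(\<lambda>z. tfshift (grid n z) gauss0 t) \<in> borel_measurable borel"
      by (rule measurable_compose[OF grid_measurable tfshift_gauss0_measurable])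
    have i: "integrable lborel (\<lambda>z. F z * tfshift (grid n z) gauss0 t)"
      by (rule Bochner_Integration.integrable_bound[OF F]) (auto simp: norm_mult intro!: AE_I2 mult_left_le cmod_tfshift_gauss0_le)
    have "(LINT z|lborel. F z * tfshift (grid n z) gauss0 t) = (LINT z:(\<Union>k. A k)|lborel. F z * tfshift (grid n z) gauss0 t)"
      unfolding UN set_lebesgue_integral_def by simp
    also have "\<dots> = (\<Sum>k. LINT z:A k|lborel. F z * tfshift (grid n z) gauss0 t)"
      by (rule lebesgue_integral_countable_add[OF A_sets disj]) (use i in \<open>auto simp: UN set_integrable_def\<close>)
    also have "\<dots> = (\<Sum>k. LINT z:A k|lborel. F z * tfshift (\<zeta> k) gauss0 t)"
      by (intro suminf_cong set_lebesgue_integral_cong A_sets) (auto simp: A_def)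
    also have "\<dots> = (\<Sum>k. c k * tfshift (\<zeta> k) gauss0 t)"
      unfolding c_def by simp
    finally show ?thesis .
  qed
  with s sl that show ?thesis by blast
qed

text \<open>Replacing \<open>z\<close> by the nearby grid point \<open>grid n z\<close> in \<open>synth F\<close> gives an atomic sum; by the Gaussian
  self-inversion the error is again of the form \<open>synth F'\<close>, with \<open>F'\<close> small in \<open>L^1\<close> for a fine grid.\<close>
lemma synth_atomic_step:
  assumes F: "integrable lborel F" and \<delta>: "\<delta> > 0"
  shows "\<exists>c \<zeta> F'. summable (\<lambda>k. cmod (c k)) \<and> (\<Sum>k. cmod (c k)) \<le> (LINT z|lborel. cmod (F z)) \<and>
    integrable lborel F' \<and> (LINT z|lborel. cmod (F' z)) \<le> \<delta> \<and>
    (\<forall>t. synth F t = (\<Sum>k. c k * tfshift (\<zeta> k) gauss0 t) + synth F' t)"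
proof -
  have [measurable]: "F \<in> borel_measurable borel" using F by auto
  let ?h = "\<lambda>n p. F (fst p) * (gauss_ker (fst p) (snd p) - gauss_ker (grid n (fst p)) (snd p))"
  \<comment> \<open>The tolerance is divided by \<open>sqrt 2\<close> because the new density
    carries this factor, which cancels the \<open>1 / sqrt 2\<close> of the self-inversion.\<close>
  have "\<forall>\<^sub>F n in sequentially. (LINT p|(lborel \<Otimes>\<^sub>M lborel). cmod (?h n p)) < \<delta> / sqrt 2"
    by (rule order_tendstoD(2)[OF grid_error_tendsto(2)[OF F]]) (use \<delta> in simp)
  then obtain n where n: "(LINT p|(lborel \<Otimes>\<^sub>M lborel). cmod (?h n p)) < \<delta> / sqrt 2"
    by (auto simp: eventually_sequentially)
  note hi = grid_error_tendsto(1)[OF F, of n]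
  \<comment> \<open>Integrating the kernel difference against the shifted Gaussians in
    \<open>y\<close> gives the difference of the atoms at \<open>z\<close> and at its grid point.
    Hence synthesizing this density reproduces the discretization error exactly.\<close>
  define F' where "F' y = sqrt 2 * (LINT z|lborel. ?h n (z, y))" for y
  have hs: "integrable (lborel \<Otimes>\<^sub>M lborel) (case_prod (\<lambda>z y. ?h n (z, y)))" using hi by (simp add: case_prod_beta')
  have F'i: "integrable lborel F'"
    unfolding F'_def using lborel_pair.integrable_snd[OF hs] by simp
  have hns: "integrable (lborel \<Otimes>\<^sub>M lborel) (case_prod (\<lambda>z y. cmod (?h n (z, y))))"
    using integrable_norm[OF hi] by (simp add: case_prod_beta')
  have "(LINT y|lborel. cmod (F' y)) \<le> (LINT y|lborel. sqrt 2 * (LINT z|lborel. cmod (?h n (z, y))))"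
  proof (rule integral_mono)
    show "integrable lborel (\<lambda>y. sqrt 2 * (LINT z|lborel. cmod (?h n (z, y))))"
      using lborel_pair.integrable_snd[OF hns] by simp
    show "cmod (F' y) \<le> sqrt 2 * (LINT z|lborel. cmod (?h n (z, y)))" for y
      unfolding F'_def norm_mult[of "of_real (sqrt 2)"] norm_of_real
      by (intro mult_mono order_trans[OF integral_norm_bound]) auto
  qed (rule integrable_norm[OF F'i])
  also have "\<dots> = sqrt 2 * (LINT p|(lborel \<Otimes>\<^sub>M lborel). cmod (?h n p))"
    using lborel_pair.integral_snd[OF hns] by (simp add: case_prod_beta')
  also have "\<dots> \<le> \<delta>" using n by (simp add: field_simps)
  finally have F'n: "(LINT y|lborel. cmod (F' y)) \<le> \<delta>" .
  obtain c \<zeta> where c: "summable (\<lambda>k. cmod (c k))" "(\<Sum>k. cmod (c k)) \<le> (LINT z|lborel. cmod (F z))"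
    "\<And>t. (LINT z|lborel. F z * tfshift (grid n z) gauss0 t) = (\<Sum>k. c k * tfshift (\<zeta> k) gauss0 t)"
    by (rule sum_over_cells[OF F, of n], rule that)
  have "synth F t = (\<Sum>k. c k * tfshift (\<zeta> k) gauss0 t) + synth F' t" for t
  proof -
    have [measurable]: "(\<lambda>z. tfshift (grid n z) gauss0 t) \<in> borel_measurable borel"
      by (rule measurable_compose[OF grid_measurable tfshift_gauss0_measurable])
    have i: "integrable lborel (\<lambda>z. F z * tfshift (grid n z) gauss0 t)"
      by (rule Bochner_Integration.integrable_bound[OF F]) (auto simp: norm_mult intro!: AE_I2 mult_left_le cmod_tfshift_gauss0_le)
    have hy: "integrable (lborel \<Otimes>\<^sub>M lborel) (\<lambda>p. ?h n (fst p, snd p) * tfshift (snd p) gauss0 t)"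
      by (rule Bochner_Integration.integrable_bound[OF hi])
        (use hi in \<open>auto simp: norm_mult intro!: AE_I2 mult_left_le cmod_tfshift_gauss0_le\<close>)
    have "synth F' t = (LINT y|lborel. sqrt 2 * (LINT z|lborel. ?h n (z, y) * tfshift y gauss0 t))"
    proof (unfold synth_def, intro Bochner_Integration.integral_cong refl)
      fix y
      show "F' y * tfshift y gauss0 t = sqrt 2 * (LINT z|lborel. ?h n (z, y) * tfshift y gauss0 t)"
        unfolding F'_def by (subst integral_mult_left_zero) (rule mult.assoc)
    qed
    also have "\<dots> = sqrt 2 * (LINT y|lborel. (LINT z|lborel. ?h n (z, y) * tfshift y gauss0 t))" by simp
    also have "(LINT y|lborel. (LINT z|lborel. ?h n (z, y) * tfshift y gauss0 t)) = (LINT z|lborel. (LINT y|lborel. ?h n (z, y) * tfshift y gauss0 t))"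
      by (rule integral_swap[OF hy])
    also have "\<dots> = (LINT z|lborel. F z * (tfshift z gauss0 t / sqrt 2 - tfshift (grid n z) gauss0 t / sqrt 2))"
    proof (intro Bochner_Integration.integral_cong refl)
      fix z
      have "(LINT y|lborel. ?h n (z, y) * tfshift y gauss0 t) = (LINT y|lborel. F z * (gauss_ker z y * tfshift y gauss0 t - gauss_ker (grid n z) y * tfshift y gauss0 t))"
        by (intro Bochner_Integration.integral_cong refl) (simp add: algebra_simps)
      also have "\<dots> = F z * (tfshift z gauss0 t / sqrt 2 - tfshift (grid n z) gauss0 t / sqrt 2)"
        using gauss_ker_tfshift_integrable by (simp add: gauss_self_inversion)
      finally show "(LINT y|lborel. ?h n (z, y) * tfshift y gauss0 t) = \<dots>" .
    qed
    also have "\<dots> = (LINT z|lborel. (F z * tfshift z gauss0 t - F z * tfshift (grid n z) gauss0 t) / sqrt 2)"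
      by (simp add: right_diff_distrib diff_divide_distrib)
    also have "\<dots> = (synth F t - (LINT z|lborel. F z * tfshift (grid n z) gauss0 t)) / sqrt 2"
      using i synth_integrable[OF F] by (simp add: synth_def)
    finally show ?thesis using c(3)[of t] by simp
  qed
  then show ?thesis using c F'i F'n by blast
qed

text \<open>Flattening along the pairing of the natural numbers. Only the coefficients
  \<open>b\<close> must be summable; the factors \<open>g\<close> are merely bounded by 1, so the
  same enumeration works for the atoms at every point \<open>t\<close>.\<close>

lemma abs_summable_double_series:
  fixes b :: "nat \<Rightarrow> nat \<Rightarrow> complex" and g :: "nat \<Rightarrow> nat \<Rightarrow> complex"
  assumes s: "\<And>k. summable (\<lambda>i. cmod (b k i))" and s2: "summable (\<lambda>k. \<Sum>i. cmod (b k i))"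
    and g: "\<And>k i. cmod (g k i) \<le> 1"
  defines "b' \<equiv> \<lambda>m. b (fst (prod_decode m)) (snd (prod_decode m))"
    and "g' \<equiv> \<lambda>m. g (fst (prod_decode m)) (snd (prod_decode m))"
  shows "summable (\<lambda>m. cmod (b' m))" and "(\<Sum>m. b' m * g' m) = (\<Sum>k. \<Sum>i. b k i * g k i)"
proof -
  let ?f = "\<lambda>p. b (fst p) (snd p)" and ?h = "\<lambda>p. b (fst p) (snd p) * g (fst p) (snd p)"
  have inner: "(\<lambda>i. cmod (b k i)) summable_on UNIV" for k
    using norm_summable_imp_summable_on[of "\<lambda>i. cmod (b k i)"] s[of k] by simp
  have inf_eq: "(\<Sum>\<^sub>\<infinity>i. cmod (b k i)) = (\<Sum>i. cmod (b k i))" for k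
    using norm_summable_imp_has_sum[of "\<lambda>i. cmod (b k i)"] s[of k] by (intro infsumI) auto
  have "(\<lambda>p. cmod (?f p)) summable_on (UNIV \<times> UNIV)"
    unfolding Infinite_Sum.abs_summable_on_Sigma_iff using inner inf_eq s2 norm_summable_imp_summable_on[of "\<lambda>k. \<Sum>i. cmod (b k i)"]
    by (simp add: suminf_nonneg s)
  then have f: "(\<lambda>p. cmod (?f p)) summable_on UNIV" by simp
  then have "(\<lambda>m. cmod (?f (prod_decode m))) summable_on UNIV"
    using summable_on_reindex_bij_betw[OF bij_prod_decode, of "\<lambda>p. cmod (?f p)"] by simp
  then show "summable (\<lambda>m. cmod (b' m))" unfolding b'_def by (rule summable_on_imp_summable)
  have habs: "(\<lambda>p. cmod (?h p)) summable_on UNIV"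
  proof (rule Infinite_Sum.abs_summable_on_comparison_test[OF f])
    show "norm (?h p) \<le> norm (?f p)" for p using g by (simp add: norm_mult mult_left_le)
  qed
  then have h: "?h summable_on (UNIV \<times> UNIV)" using Infinite_Sum.abs_summable_summable[OF habs] by simp
  have "(?h has_sum infsum ?h UNIV) UNIV" using h by simp
  then have "((\<lambda>m. ?h (prod_decode m)) has_sum infsum ?h UNIV) UNIV"
    using has_sum_reindex_bij_betw[OF bij_prod_decode, of ?h] by simp
  then have "(\<lambda>m. b' m * g' m) sums infsum ?h UNIV" unfolding b'_def g'_def by (rule has_sum_imp_sums)
  then have 1: "(\<Sum>m. b' m * g' m) = infsum ?h UNIV" by (rule sums_unique[symmetric])
  have hk: "summable (\<lambda>i. cmod (b k i * g k i))" for k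
    by (rule summable_comparison_test[OF _ s[of k]]) (use g in \<open>auto simp: norm_mult mult_left_le\<close>)
  have inner_h: "(\<Sum>\<^sub>\<infinity>i. b k i * g k i) = (\<Sum>i. b k i * g k i)" for k
    using norm_summable_imp_has_sum[OF hk] summable_norm_cancel[OF hk] by (intro infsumI) auto
  have hb: "summable (\<lambda>k. cmod (\<Sum>i. b k i * g k i))"
  proof (rule summable_comparison_test[OF _ s2], intro exI allI impI)
    fix k
    have "cmod (\<Sum>i. b k i * g k i) \<le> (\<Sum>i. cmod (b k i * g k i))" by (rule summable_norm[OF hk])
    also have "\<dots> \<le> (\<Sum>i. cmod (b k i))"
      by (rule suminf_le[OF _ hk s]) (use g in \<open>simp add: norm_mult mult_left_le\<close>)
    finally show "norm (cmod (\<Sum>i. b k i * g k i)) \<le> (\<Sum>i. cmod (b k i))" by simp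
  qed
  have "infsum ?h (UNIV \<times> UNIV) = (\<Sum>\<^sub>\<infinity>k. \<Sum>\<^sub>\<infinity>i. ?h (k, i))"
    using infsum_Sigma_banach[OF h] by simp
  also have "\<dots> = (\<Sum>k. \<Sum>i. b k i * g k i)"
    using norm_summable_imp_has_sum[OF hb] summable_norm_cancel[OF hb] by (intro infsumI) (simp_all add: inner_h summable_sums)
  finally show "(\<Sum>m. b' m * g' m) = (\<Sum>k. \<Sum>i. b k i * g k i)" using 1 by simp
qed

text \<open>The approximation step is repeated on its own remainder with tolerances
  \<open>(1/2)^k\<close>. The coefficient sums of the stages are then summable, and the remainders
  tend to 0 because a synthesized function is bounded by the L^1 norm of its density.\<close>

theorem synth_atomic:
  assumes F: "integrable lborel F"
  shows "\<exists>b zs. summable (\<lambda>n. cmod (b n)) \<and> (\<forall>t. synth F t = (\<Sum>n. b n * tfshift (zs n) gauss0 t))"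
proof -
  define P where "P F \<delta> r \<longleftrightarrow> (case r of (c, \<zeta>, F') \<Rightarrow> summable (\<lambda>k. cmod (c k)) \<and> (\<Sum>k. cmod (c k)) \<le> (LINT z|lborel. cmod (F z)) \<and>
    integrable lborel F' \<and> (LINT z|lborel. cmod (F' z)) \<le> \<delta> \<and>
    (\<forall>t. synth F t = (\<Sum>k. c k * tfshift (\<zeta> k) gauss0 t) + synth F' t))"
    for F :: "real \<times> real \<Rightarrow> complex" and \<delta> :: real and r :: "(nat \<Rightarrow> complex) \<times> (nat \<Rightarrow> real \<times> real) \<times> (real \<times> real \<Rightarrow> complex)"
  \<comment> \<open>Choosing a stage as a function of the remainder and of \<open>k\<close> makes
    the sequence of remainders definable by primitive recursion.\<close>
  define S where "S F k = (SOME r. P F ((1/2)^k) r)" for F and k :: nat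
  have S: "P F ((1/2)^k) (S F k)" if "integrable lborel F" for F k
  proof -
    have "\<exists>r. P F ((1/2)^k) r" using synth_atomic_step[OF that, of "(1/2)^k"] by (auto simp: P_def)
    then show ?thesis unfolding S_def by (rule someI_ex)
  qed
  define Fs where "Fs = rec_nat F (\<lambda>k G. snd (snd (S G k)))"
  have Fs0: "Fs 0 = F" and FsS: "Fs (Suc k) = snd (snd (S (Fs k) k))" for k by (simp_all add: Fs_def)
  have Fi: "integrable lborel (Fs k)" for k
  proof (induction k)
    case (Suc k) then show ?case using S[OF Suc, of k] by (auto simp: FsS P_def case_prod_beta)
  qed (simp add: Fs0 F)
  define b where "b k = fst (S (Fs k) k)" for k
  define \<zeta> where "\<zeta> k = fst (snd (S (Fs k) k))" for k
  have b1: "summable (\<lambda>i. cmod (b k i))" and b2: "(\<Sum>i. cmod (b k i)) \<le> (LINT z|lborel. cmod (Fs k z))"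
    and F2: "(LINT z|lborel. cmod (Fs (Suc k) z)) \<le> (1/2)^k"
    and dec: "synth (Fs k) t = (\<Sum>i. b k i * tfshift (\<zeta> k i) gauss0 t) + synth (Fs (Suc k)) t" for k t
    using S[OF Fi, of k k] by (auto simp: P_def case_prod_beta b_def \<zeta>_def FsS)
  have s2: "summable (\<lambda>k. \<Sum>i. cmod (b k i))"
  proof (subst summable_Suc_iff[symmetric], rule summable_comparison_test)
    show "summable (\<lambda>k. (1/2::real)^k)" by (rule summable_geometric) simp
    show "\<exists>N. \<forall>n\<ge>N. norm (\<Sum>i. cmod (b (Suc n) i)) \<le> (1/2)^n"
    proof (intro exI allI impI)
      fix n
      have "0 \<le> (\<Sum>i. cmod (b (Suc n) i))" by (rule suminf_nonneg[OF b1]) simp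
      then show "norm (\<Sum>i. cmod (b (Suc n) i)) \<le> (1/2)^n"
        using order_trans[OF b2[of "Suc n"] F2[of n]] unfolding real_norm_def by linarith
    qed
  qed
  have part: "synth F t = (\<Sum>k<n. \<Sum>i. b k i * tfshift (\<zeta> k i) gauss0 t) + synth (Fs n) t" for n t
  proof (induction n)
    case (Suc n)
    then show ?case using dec[of n t] by simp
  qed (simp add: Fs0)
  have "(\<lambda>k. \<Sum>i. b k i * tfshift (\<zeta> k i) gauss0 t) sums synth F t" for t
    unfolding sums_def
  proof (rule Lim_transform2[OF tendsto_const])
    show "(\<lambda>n. synth F t - (\<Sum>k<n. \<Sum>i. b k i * tfshift (\<zeta> k i) gauss0 t)) \<longlonglongrightarrow> 0"
    \<comment> \<open>The shift is needed because only the remainders \<open>Fs (Suc n)\<close> are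
      small; \<open>Fs 0\<close> is the given density.\<close>
    proof (rule LIMSEQ_imp_Suc, rule Lim_null_comparison)
      show "\<forall>\<^sub>F n in sequentially. cmod (synth F t - (\<Sum>k<Suc n. \<Sum>i. b k i * tfshift (\<zeta> k i) gauss0 t)) \<le> (1/2)^n"
      proof (rule always_eventually, rule allI)
        fix n
        have "cmod (synth (Fs (Suc n)) t) \<le> (1/2)^n" using order_trans[OF cmod_synth_le[OF Fi] F2] .
        then show "cmod (synth F t - (\<Sum>k<Suc n. \<Sum>i. b k i * tfshift (\<zeta> k i) gauss0 t)) \<le> (1/2)^n"
          using part[of t "Suc n"] by simp
      qed
      show "(\<lambda>n. (1/2::real)^n) \<longlonglongrightarrow> 0" by (rule LIMSEQ_realpow_zero) auto
    qed
  qed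
  then have "synth F t = (\<Sum>k. \<Sum>i. b k i * tfshift (\<zeta> k i) gauss0 t)" for t by (rule sums_unique)
  moreover have "(\<Sum>m. b (fst (prod_decode m)) (snd (prod_decode m)) * tfshift (\<zeta> (fst (prod_decode m)) (snd (prod_decode m))) gauss0 t)
      = (\<Sum>k. \<Sum>i. b k i * tfshift (\<zeta> k i) gauss0 t)" for t
    by (rule abs_summable_double_series(2)[OF b1 s2 cmod_tfshift_gauss0_le])
  moreover have "summable (\<lambda>m. cmod (b (fst (prod_decode m)) (snd (prod_decode m))))"
    by (rule abs_summable_double_series(1)[OF b1 s2, of "\<lambda>_ _. 0"]) simp
  ultimately show ?thesis
    by (intro exI[of _ "\<lambda>m. b (fst (prod_decode m)) (snd (prod_decode m))"] exI[of _ "\<lambda>m. \<zeta> (fst (prod_decode m)) (snd (prod_decode m))"]) auto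
qed

text \<open>Without such a representation, \<open>C_const \<phi>\<close> would be the junk value \<open>Inf {}\<close>.\<close>
theorem gauss_rep_exists:
  assumes S0: "in_S0 \<phi>"
  shows "\<exists>b zs. gauss_rep \<phi> b zs"
proof -
  have F: "integrable lborel (STFT gauss0 \<phi>)" by (rule in_S0_integrable[OF S0])
  obtain b zs where b: "summable (\<lambda>n. cmod (b n))" "\<And>t. synth (STFT gauss0 \<phi>) t = (\<Sum>n. b n * tfshift (zs n) gauss0 t)"
    using synth_atomic[OF F] by blast
  have "gauss_rep \<phi> (\<lambda>n. of_real (sqrt 2) * b n) zs"
    unfolding gauss_rep_def
  proof
    show "summable (\<lambda>n. cmod (of_real (sqrt 2) * b n))" using b(1) by (simp add: norm_mult summable_mult)
    have s: "summable (\<lambda>n. b n * tfshift (zs n) gauss0 t)" for t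
      by (rule summable_norm_cancel, rule summable_comparison_test[OF _ b(1)])
        (auto simp: norm_mult intro!: mult_left_le cmod_tfshift_gauss0_le)
    show "AE t in lborel. \<phi> t = (\<Sum>n. of_real (sqrt 2) * b n * tfshift (zs n) gauss0 t)"
      using gauss_inversion[OF S0]
      by eventually_elim (simp add: b(2) suminf_mult[OF s] mult.assoc)
  qed
  then show ?thesis by blast
qed

text \<open>If the Gaussian transform vanished almost everywhere, so would \<open>\<phi>\<close>, by
  the inversion formula. The positivity permits division by \<open>S0_norm \<phi>\<close> when the
  infimum \<open>C_const\<close> is handled.\<close>

lemma S0_norm_pos:
  assumes S0: "in_S0 \<phi>" and "L2_norm \<phi> \<noteq> 0"
  shows "S0_norm \<phi> > 0"
proof (rule ccontr)
  assume n: "\<not> ?thesis"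
  have i: "integrable lborel (\<lambda>z. cmod (STFT gauss0 \<phi> z))" using S0 by (auto simp: in_S0_def)
  have "S0_norm \<phi> = 0" using n by (simp add: S0_norm_def integral_nonneg order.antisym)
  then have z: "AE z in lborel. STFT gauss0 \<phi> z = 0"
    unfolding S0_norm_def using integral_nonneg_eq_0_iff_AE[OF i] by simp
  have "synth (STFT gauss0 \<phi>) t = 0" for t
    unfolding synth_def by (rule integral_eq_zero_AE) (use z in eventually_elim, simp)
  then have "AE t in lborel. \<phi> t = 0" using gauss_inversion[OF S0] by simp
  then have "AE t in lborel. (cmod (\<phi> t))^2 = 0" by eventually_elim simp
  then have "(LINT t|lborel. (cmod (\<phi> t))^2) = 0"
    by (rule integral_eq_zero_AE)
  then show False using assms(2) by (simp add: L2_norm_def)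
qed

section \<open>Sampling one point per unit square\<close>

text \<open>An upper bound for \<open>exp (- (pi / 2) x^2)\<close> on \<open>\<bar>x - k\<bar> \<le> 1\<close>; the sum over all \<open>k\<close> is \<open>11/3\<close>, whence the
  constant \<open>121/9 = (11/3)^2\<close> below.\<close>
definition cell_decay :: "int \<Rightarrow> real" where
  "cell_decay k = (if \<bar>k\<bar> \<le> 1 then 1 else (1/4)^nat (\<bar>k\<bar> - 1))"

lemma cell_decay_nonneg: "0 \<le> cell_decay k"
  by (simp add: cell_decay_def)

text \<open>Uses \<open>pi > 3\<close> and
  \<open>exp (3/2) \<ge> (1 + 3/20)^10 \<ge> 4\<close>.\<close>

lemma exp_neg_half_pi: "exp (- (pi / 2)) \<le> 1 / 4"
proof -
  have "(4::real) \<le> (1 + 3/20)^10" by (simp add: power_divide)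
  also have "\<dots> \<le> exp (3/20)^10" by (intro power_mono exp_ge_add_one_self) auto
  also have "\<dots> = exp (3/2 :: real)" by (simp flip: exp_of_nat_mult)
  also have "\<dots> \<le> exp (pi / 2)" using pi_gt3 by simp
  finally show ?thesis by (simp add: exp_minus field_simps)
qed

text \<open>With \<open>n = |k| - 1 \<ge> 1\<close> one has \<open>|x| \<ge> n\<close>, hence
  \<open>x^2 \<ge> n\<close>. Keeping only this linear exponent leaves a geometric series that sums
  in closed form.\<close>

lemma exp_le_cell_decay:
  assumes "\<bar>x - of_int k\<bar> \<le> 1"
  shows "exp (- (pi / 2 * x^2)) \<le> cell_decay k"
proof (cases "\<bar>k\<bar> \<le> 1")
  case True
  then show ?thesis by (simp add: cell_decay_def)
next
  case False
  define n where "n = nat (\<bar>k\<bar> - 1)"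
  have n: "real n = \<bar>real_of_int k\<bar> - 1" "1 \<le> real n" using False by (auto simp: n_def)
  have "real n \<le> \<bar>x\<bar>" using assms n by linarith
  then have "1 * real n \<le> \<bar>x\<bar> * \<bar>x\<bar>" using n by (intro mult_mono) auto
  then have "real n \<le> x^2" by (simp add: power2_eq_square)
  then have "exp (- (pi / 2 * x^2)) \<le> exp (real n * - (pi / 2))" by simp
  also have "\<dots> = exp (- (pi / 2))^n" by (rule exp_of_nat_mult)
  also have "\<dots> \<le> (1/4)^n" by (intro power_mono exp_neg_half_pi) auto
  finally show ?thesis using False by (simp add: cell_decay_def n_def)
qed

lemma sum_cell_decay_interval: "(\<Sum>k\<in>{- int (Suc n)..int (Suc n)}. cell_decay k) = 11/3 - 2/3 * (1/4)^n"
proof (induction n)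
  case 0
  have "{- int (Suc 0)..int (Suc 0)} = {-1, 0, 1}" by auto
  then show ?case by (simp add: cell_decay_def)
next
  case (Suc n)
  have e: "{- int (Suc (Suc n))..int (Suc (Suc n))} = insert (- int (Suc (Suc n))) (insert (int (Suc (Suc n))) {- int (Suc n)..int (Suc n)})"
    by auto
  have d: "cell_decay (int (Suc (Suc n))) = (1/4)^Suc n" "cell_decay (- int (Suc (Suc n))) = (1/4)^Suc n"
    by (auto simp: cell_decay_def nat_add_distrib)
  show ?case unfolding e by (subst sum.insert, simp, simp, subst sum.insert, simp, simp) (simp add: Suc d del: of_nat_Suc)
qed

lemma sum_cell_decay:
  assumes "finite J"
  shows "(\<Sum>k\<in>J. cell_decay k) \<le> 11/3"
proof -
  obtain n where n: "\<And>k. k \<in> J \<Longrightarrow> nat \<bar>k\<bar> \<le> n"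
    using finite_nat_set_iff_bounded_le[of "(\<lambda>k. nat \<bar>k\<bar>) ` J"] assms by auto
  have "J \<subseteq> {- int (Suc n)..int (Suc n)}" using n by fastforce
  then have "(\<Sum>k\<in>J. cell_decay k) \<le> (\<Sum>k\<in>{- int (Suc n)..int (Suc n)}. cell_decay k)"
    by (intro sum_mono2) (auto simp: cell_decay_nonneg)
  also have "\<dots> \<le> 11/3" unfolding sum_cell_decay_interval by simp
  finally show ?thesis .
qed

lemma sum_cell_decay2:
  assumes S: "finite (S :: (int \<times> int) set)"
  shows "(\<Sum>l\<in>S. cell_decay (fst l - a) * cell_decay (snd l - b)) \<le> 121/9"
proof -
  have sh: "(\<Sum>k\<in>J. cell_decay (k - a)) \<le> 11/3" if "finite J" for J a
  proof -
    have "(\<Sum>k\<in>J. cell_decay (k - a)) = (\<Sum>k\<in>(\<lambda>k. k - a) ` J. cell_decay k)"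
      by (subst sum.reindex) (auto simp: inj_on_def)
    then show ?thesis using sum_cell_decay[of "(\<lambda>k. k - a) ` J"] that by simp
  qed
  have "(\<Sum>l\<in>S. cell_decay (fst l - a) * cell_decay (snd l - b))
    \<le> (\<Sum>l\<in>fst ` S \<times> snd ` S. cell_decay (fst l - a) * cell_decay (snd l - b))"
    using S by (intro sum_mono2) (auto simp: cell_decay_nonneg intro: rev_image_eqI)
  also have "\<dots> = (\<Sum>k\<in>fst ` S. cell_decay (k - a)) * (\<Sum>k\<in>snd ` S. cell_decay (k - b))"
    by (simp add: sum_product sum.cartesian_product case_prod_beta)
  also have "\<dots> \<le> 11/3 * (11/3)"
    using S by (intro mult_mono sh sum_nonneg) (auto simp: cell_decay_nonneg)
  finally show ?thesis by simp
qed

lemma exp_le_cell_decay2: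
  assumes "\<bar>x - of_int k\<bar> \<le> 1" "\<bar>y - of_int l\<bar> \<le> 1"
  shows "exp (- (pi * (1/2) * (x^2 + y^2))) \<le> cell_decay k * cell_decay l"
proof -
  have "exp (- (pi * (1/2) * (x^2 + y^2))) = exp (- (pi / 2 * x^2)) * exp (- (pi / 2 * y^2))"
    by (simp add: algebra_simps flip: exp_add)
  then show ?thesis using exp_le_cell_decay[OF assms(1)] exp_le_cell_decay[OF assms(2)]
    by (simp add: mult_mono cell_decay_nonneg)
qed

section \<open>Gaussian transforms sampled once per square\<close>

abbreviation (input) lattice_pt :: "int \<times> int \<Rightarrow> real \<times> real" where
  "lattice_pt m \<equiv> (real_of_int (fst m), real_of_int (snd m))"

text \<open>Points chosen in the squares \<open>m\<close> and \<open>l\<close> differ by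
  \<open>l - m\<close> up to 1 in each coordinate, so the Gram matrix of the shifted Gaussians
  decays and its row sums are bounded. The common offset \<open>z0\<close> cancels in the
  differences; this uniformity carries the bound over to series of Gaussians.\<close>

lemma gauss_STFT_cell_bound:
  assumes S: "finite S" and w: "\<And>m. m \<in> S \<Longrightarrow> w m \<in> Q1 (lattice_pt m)" and f: "L2 f"
  shows "(\<Sum>m\<in>S. (cmod (STFT gauss0 f (w m + z0)))^2) \<le> 121/9 / sqrt 2 * (L2_norm f)^2"
  unfolding STFT_eq_inner
proof (rule L2_frame_bound[OF S L2_tfshift[OF L2_gauss0] f])
  fix m assume m: "m \<in> S"
  have "(\<Sum>l\<in>S. cmod (L2_inner (tfshift (w m + z0) gauss0) (tfshift (w l + z0) gauss0)))
    \<le> (\<Sum>l\<in>S. cell_decay (fst l - fst m) * cell_decay (snd l - snd m) / sqrt 2)"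
  proof (rule sum_mono)
    fix l assume l: "l \<in> S"
    have "\<bar>(fst (w l) - fst (w m)) - of_int (fst l - fst m)\<bar> \<le> 1" "\<bar>(snd (w l) - snd (w m)) - of_int (snd l - snd m)\<bar> \<le> 1"
      using w[OF l] w[OF m] unfolding Q1_def mem_Collect_eq fst_conv snd_conv of_int_diff by linarith+
    from exp_le_cell_decay2[OF this]
    show "cmod (L2_inner (tfshift (w m + z0) gauss0) (tfshift (w l + z0) gauss0)) \<le> cell_decay (fst l - fst m) * cell_decay (snd l - snd m) / sqrt 2"
      unfolding gauss_ker_def[symmetric] cmod_gauss_ker by (simp add: divide_right_mono)
  qed
  also have "\<dots> \<le> 121/9 / sqrt 2"
    unfolding sum_divide_distrib[symmetric] using sum_cell_decay2[OF S] by (intro divide_right_mono) auto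
  finally show "(\<Sum>l\<in>S. cmod (L2_inner (tfshift (w m + z0) gauss0) (tfshift (w l + z0) gauss0))) \<le> 121/9 / sqrt 2" .
qed simp

lemma cmod_STFT_gauss0: "cmod (STFT gauss0 gauss0 y) = exp (- (pi * (1/2) * ((fst y)^2 + (snd y)^2))) / sqrt 2"
  using cmod_gauss_ker[of "(0, 0)" y] by (simp add: gauss_ker_def STFT_eq_inner tfshift_0)

section \<open>A numerical lower bound for the amalgam norm of the Gaussian\<close>

abbreviation W_cell :: "int \<times> int \<Rightarrow> ereal" where
  "W_cell m \<equiv> esssup (restrict_space lborel (Q1 (0,0))) (\<lambda>v. ereal (cmod (STFT gauss0 gauss0 (v + lattice_pt m))))"

lemma Q1_sets: "Q1 v \<in> sets borel"
proof -
  have "closed (Q1 v)" unfolding Q1_def by (intro closed_Collect_conj closed_Collect_le continuous_intros)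
  then show ?thesis by simp
qed

lemma W_cell_measurable: "(\<lambda>v. ereal (cmod (STFT gauss0 gauss0 (v + lattice_pt m)))) \<in> borel_measurable (restrict_space lborel (Q1 (0,0)))"
proof -
  have "continuous_on UNIV (\<lambda>v. cmod (STFT gauss0 gauss0 (v + lattice_pt m)))"
    unfolding cmod_STFT_gauss0 by (intro continuous_intros) auto
  then have [measurable]: "(\<lambda>v. cmod (STFT gauss0 gauss0 (v + lattice_pt m))) \<in> borel_measurable borel"
    by (rule borel_measurable_continuous_onI)
  show ?thesis by (intro measurable_restrict_space1) measurable
qed

lemma W_cell_le: "W_cell m \<le> ereal (cell_decay (fst m) * cell_decay (snd m) / sqrt 2)"
proof (rule esssup_I[OF W_cell_measurable])
  have "cmod (STFT gauss0 gauss0 (v + lattice_pt m)) \<le> cell_decay (fst m) * cell_decay (snd m) / sqrt 2" if "v \<in> Q1 (0,0)" for v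
    unfolding cmod_STFT_gauss0 using that
    by (intro divide_right_mono exp_le_cell_decay2) (auto simp: Q1_def)
  then show "AE v in restrict_space lborel (Q1 (0,0)). ereal (cmod (STFT gauss0 gauss0 (v + lattice_pt m))) \<le> ereal (cell_decay (fst m) * cell_decay (snd m) / sqrt 2)"
    by (intro AE_I2) (simp add: space_restrict_space)
qed

text \<open>The function is continuous and \<open>p\<close> is an interior point of the square. So
  \<open>c\<close> is exceeded on a nonempty open subset of the square, which is not a null
  set.\<close>

lemma W_cell_ge:
  assumes p: "\<bar>fst p\<bar> < 1/2" "\<bar>snd p\<bar> < 1/2" and c: "c < cmod (STFT gauss0 gauss0 (p + lattice_pt m))"
  shows "ereal c \<le> W_cell m"
proof (rule ccontr)
  assume "\<not> ereal c \<le> W_cell m"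
  then have less: "W_cell m < ereal c" by simp
  let ?f = "\<lambda>v. cmod (STFT gauss0 gauss0 (v + lattice_pt m))"
  let ?B = "{v. \<bar>fst v\<bar> < 1/2 \<and> \<bar>snd v\<bar> < 1/2 \<and> c < ?f v}"
  have op: "open ?B" unfolding cmod_STFT_gauss0
    by (intro open_Collect_conj open_Collect_less continuous_intros) auto
  have "p \<in> ?B" using p c by simp
  with op have nn: "\<not> negligible ?B" by (intro open_not_negligible) blast+
  have "AE v in restrict_space lborel (Q1 (0,0)). ereal (?f v) \<le> W_cell m" by (rule esssup_AE)
  then have "AE v in lborel. v \<in> Q1 (0,0) \<longrightarrow> ereal (?f v) \<le> W_cell m"
    by (subst (asm) AE_restrict_space_iff) (auto simp: Q1_sets)
  then have "AE v in lborel. v \<notin> ?B"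
  proof eventually_elim
    case (elim v)
    show ?case
    proof
      assume v: "v \<in> ?B"
      then have "v \<in> Q1 (0,0)" by (auto simp: Q1_def)
      with elim less have "ereal (?f v) < ereal c" by (meson order_le_less_trans)
      with v show False by simp
    qed
  qed
  moreover have "?B \<in> sets borel" using op by simp
  ultimately have "?B \<in> null_sets lborel" by (subst AE_iff_null_sets) auto
  then have "negligible ?B" by (simp add: negligible_iff_null_sets null_sets_completionI)
  with nn show False ..
qed

text \<open>The squares \<open>(0, 0)\<close> and \<open>(\<plusminus>1, 0)\<close> contribute \<open>0.9\<close> and twice \<open>0.5\<close>. The upper bound
  \<open>up\<close> is needed as well, because \<open>real_of_ereal \<infinity> = 0\<close>.\<close>
lemma W_norm_gauss0_ge: "1.9 / sqrt 2 \<le> W_norm (STFT gauss0 gauss0)"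
proof -
  let ?X = "SUP I \<in> {I :: (int \<times> int) set. finite I}. \<Sum>m\<in>I. W_cell m"
  have up: "?X \<le> ereal (121/9 / sqrt 2)"
  proof (rule SUP_least)
    fix I :: "(int \<times> int) set" assume "I \<in> {I. finite I}"
    then have I: "finite I" by simp
    have "(\<Sum>m\<in>I. W_cell m) \<le> (\<Sum>m\<in>I. ereal (cell_decay (fst m) * cell_decay (snd m) / sqrt 2))"
      by (intro sum_mono W_cell_le)
    also have "\<dots> = ereal ((\<Sum>m\<in>I. cell_decay (fst m - 0) * cell_decay (snd m - 0)) / sqrt 2)"
      by (simp add: sum_divide_distrib)
    also have "\<dots> \<le> ereal (121/9 / sqrt 2)"
      using divide_right_mono[OF sum_cell_decay2[OF I, of 0 0], of "sqrt 2"] by simp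
    finally show "(\<Sum>m\<in>I. W_cell m) \<le> ereal (121/9 / sqrt 2)" .
  qed
  have pi: "pi < 3.2" using pi_approx by simp
  \<comment> \<open>The points \<open>(-0.45, 0)\<close> and \<open>(0.45, 0)\<close> lie just
    inside the square; shifted by 1 and by -1 they have distance 0.55 from the origin, where the
    exponent is still below 0.5.\<close>
  have e: "0.5 / sqrt 2 < exp (- (pi * (1/2) * (0.55^2 + 0^2))) / sqrt 2"
  proof (rule divide_strict_right_mono)
    have "pi * (1/2) * (0.55^2 + 0^2) < 0.5" using pi by (simp add: power2_eq_square)
    then have "0.5 < 1 + - (pi * (1/2) * (0.55^2 + 0^2))" by simp
    also have "\<dots> \<le> exp (- (pi * (1/2) * (0.55^2 + 0^2)))" by (rule exp_ge_add_one_self)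
    finally show "0.5 < exp (- (pi * (1/2) * (0.55^2 + 0^2)))" .
  qed simp
  have "ereal (0.9 / sqrt 2) \<le> W_cell (0, 0)"
    by (rule W_cell_ge[of "(0, 0)"]) (auto simp: cmod_STFT_gauss0 field_simps)
  moreover have "ereal (0.5 / sqrt 2) \<le> W_cell (1, 0)"
    by (rule W_cell_ge[of "(-0.45, 0)"]) (use e in \<open>auto simp: cmod_STFT_gauss0\<close>)
  moreover have "ereal (0.5 / sqrt 2) \<le> W_cell (-1, 0)"
    by (rule W_cell_ge[of "(0.45, 0)"]) (use e in \<open>auto simp: cmod_STFT_gauss0\<close>)
  ultimately have "ereal (0.9 / sqrt 2) + (ereal (0.5 / sqrt 2) + ereal (0.5 / sqrt 2)) \<le> W_cell (0, 0) + (W_cell (1, 0) + W_cell (-1, 0))"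
    by (intro add_mono)
  also have "\<dots> = (\<Sum>m\<in>{(0, 0), (1, 0), (-1, 0)}. W_cell m)" by simp
  also have "\<dots> \<le> ?X" by (rule SUP_upper) simp
  finally have lo: "ereal (1.9 / sqrt 2) \<le> ?X" by (simp add: add_divide_distrib[symmetric])
  have "real_of_ereal (ereal (1.9 / sqrt 2)) \<le> real_of_ereal ?X"
    using lo up by (intro real_of_ereal_positive_mono) auto
  then show ?thesis unfolding W_norm_def by simp
qed

section \<open>Windows that are series of shifted Gaussians\<close>

lemma tfshift_tfshift: "tfshift z (tfshift y \<phi>) t = cis (- 2 * pi * snd y * fst z) * tfshift (z + y) \<phi> t"
proof -
  have "cis (2 * pi * snd y * (t - fst z)) * cis (2 * pi * snd z * t) = cis (- 2 * pi * snd y * fst z) * cis (2 * pi * (snd z + snd y) * t)"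
    unfolding cis_mult by (intro arg_cong[of _ _ cis]) (simp add: algebra_simps)
  then show ?thesis by (simp add: tfshift_def algebra_simps diff_diff_eq)
qed

lemma cmod_L2_inner_tfshift2: "cmod (L2_inner f (tfshift z (tfshift y \<phi>))) = cmod (STFT \<phi> f (z + y))"
  unfolding tfshift_tfshift[abs_def] L2_inner_scale_right STFT_eq_inner by (simp add: norm_mult)

lemma STFT_cong_AE:
  assumes [measurable]: "\<phi> \<in> borel_measurable borel" "\<psi> \<in> borel_measurable borel" "f \<in> borel_measurable borel"
    and ae: "AE t in lborel. \<phi> t = \<psi> t"
  shows "STFT \<phi> f z = STFT \<psi> f z"
proof -
  have "AE t in lborel. \<phi> (- fst z + 1 * t) = \<psi> (- fst z + 1 * t)"
    by (rule AE_borel_affine[OF _ _ ae]) auto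
  then show ?thesis
    unfolding STFT_eq_inner L2_inner_def
    by (intro integral_cong_AE) (use tfshift_measurable[of \<phi>] tfshift_measurable[of \<psi>] in \<open>auto simp: tfshift_def elim!: eventually_mono\<close>)
qed

text \<open>The series converges absolutely and uniformly, so \<open>\<psi>\<close> below is defined
  at every point and is a continuous representative of any \<open>\<phi>\<close> with this
  representation. The coefficients stay arbitrary, because the bounds must hold for all
  representations before an infimum is taken.\<close>

locale gauss_series =
  fixes b :: "nat \<Rightarrow> complex" and zs :: "nat \<Rightarrow> real \<times> real"
  assumes summable_b: "summable (\<lambda>n. cmod (b n))"
begin

definition \<psi> :: "real \<Rightarrow> complex" where "\<psi> t = (\<Sum>n. b n * tfshift (zs n) gauss0 t)"

definition B :: real where "B = (\<Sum>n. cmod (b n))"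

lemma B_nonneg: "0 \<le> B"
  unfolding B_def by (rule suminf_nonneg[OF summable_b]) simp

lemma term_bound: "cmod (b n * tfshift (zs n) gauss0 t) \<le> cmod (b n)"
  by (auto simp: norm_mult intro!: mult_left_le cmod_tfshift_gauss0_le)

lemma summable_norm_terms: "summable (\<lambda>n. cmod (b n * tfshift (zs n) gauss0 t))"
  by (rule summable_comparison_test[OF _ summable_b]) (use term_bound in auto)

lemma continuous_\<psi>: "continuous_on UNIV \<psi>"
proof -
  have "uniform_limit UNIV (\<lambda>n t. \<Sum>i<n. b i * tfshift (zs i) gauss0 t) (\<lambda>t. \<Sum>i. b i * tfshift (zs i) gauss0 t) sequentially"
    by (rule Weierstrass_m_test[OF term_bound summable_b])
  moreover have "continuous_on UNIV (\<lambda>t. \<Sum>i<n. b i * tfshift (zs i) gauss0 t)" for n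
    unfolding tfshift_def gauss0_def cis_conv_exp by (intro continuous_intros)
  ultimately show ?thesis unfolding \<psi>_def[abs_def]
    by (intro uniform_limit_theorem) (auto intro!: always_eventually)
qed

lemma \<psi>_measurable [measurable]: "\<psi> \<in> borel_measurable borel"
  by (rule borel_measurable_continuous_onI[OF continuous_\<psi>])

lemma \<psi>_bound: "cmod (\<psi> t) \<le> B"
proof -
  have "cmod (\<psi> t) \<le> (\<Sum>n. cmod (b n * tfshift (zs n) gauss0 t))"
    unfolding \<psi>_def by (rule summable_norm[OF summable_norm_terms])
  also have "\<dots> \<le> B" unfolding B_def by (rule suminf_le[OF term_bound summable_norm_terms summable_b])
  finally show ?thesis .
qed

lemma tfshift_gauss0_L1:
  shows "integrable lborel (tfshift z gauss0)" and "(LINT t|lborel. cmod (tfshift z gauss0 t)) = 1"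
proof -
  have e: "cmod (tfshift z gauss0 t) = exp (- (pi * 1 * (t - fst z)^2))" for t
    by (simp add: cmod_tfshift cmod_gauss0)
  show "integrable lborel (tfshift z gauss0)"
    by (rule Bochner_Integration.integrable_bound[OF gaussian_integrable[of 1 "fst z"]])
      (use tfshift_measurable[OF gauss0_measurable] in \<open>auto simp: e\<close>)
  show "(LINT t|lborel. cmod (tfshift z gauss0 t)) = 1" unfolding e by (subst gaussian_integral) auto
qed

lemma \<psi>_integrable: "integrable lborel \<psi>"
  unfolding \<psi>_def[abs_def]
proof (rule integrable_suminf)
  show "integrable lborel (\<lambda>t. b n * tfshift (zs n) gauss0 t)" for n using tfshift_gauss0_L1(1) by simp
  show "AE t in lborel. summable (\<lambda>n. cmod (b n * tfshift (zs n) gauss0 t))" using summable_norm_terms by simp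
  show "summable (\<lambda>n. LINT t|lborel. cmod (b n * tfshift (zs n) gauss0 t))"
    using summable_b by (simp add: norm_mult tfshift_gauss0_L1(2))
qed

lemma L2_\<psi>: "L2 \<psi>"
proof -
  have "integrable lborel (\<lambda>t. (cmod (\<psi> t))^2)"
  proof (rule Bochner_Integration.integrable_bound)
    show "integrable lborel (\<lambda>t. B * cmod (\<psi> t))" using \<psi>_integrable by simp
    show "AE t in lborel. norm ((cmod (\<psi> t))^2) \<le> norm (B * cmod (\<psi> t))"
      using \<psi>_bound B_nonneg by (intro AE_I2) (simp add: power2_eq_square mult_right_mono abs_mult)
  qed simp
  then show ?thesis by (simp add: L2_def)
qed

text \<open>Sum and integral are interchanged, since the \<open>n\<close>-th term has integral at
  most \<open>|b n| \<parallel>f\<parallel> \<parallel>gauss0\<parallel>\<close>. Composing two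
  shifts costs only a phase, so in modulus the \<open>n\<close>-th term is a Gaussian transform at
  the translated point.\<close>

lemma STFT_\<psi>_series:
  assumes f: "L2 f"
  shows "summable (\<lambda>n. cmod (b n) * cmod (STFT gauss0 f (z + zs n)))"
    and "cmod (STFT \<psi> f z) \<le> (\<Sum>n. cmod (b n) * cmod (STFT gauss0 f (z + zs n)))"
proof -
  have [measurable]: "f \<in> borel_measurable borel" using f by auto
  let ?u = "\<lambda>n. tfshift z (tfshift (zs n) gauss0)"
  let ?g = "\<lambda>n t. f t * cnj (b n * ?u n t)"
  have u: "L2 (?u n)" and un: "L2_norm (?u n) = L2_norm gauss0" for n
    by (simp_all add: L2_tfshift L2_gauss0 L2_norm_tfshift)
  have cu: "cmod (?u n t) = cmod (tfshift (zs n) gauss0 (t - fst z))" for n t by (simp add: cmod_tfshift)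
  have gi: "integrable lborel (?g n)" for n
    by (rule L2_inner_integrable[OF f L2_scale[OF u]])
  have gn: "(LINT t|lborel. cmod (?g n t)) \<le> cmod (b n) * (L2_norm f * L2_norm gauss0)" for n
  proof -
    have "(LINT t|lborel. cmod (?g n t)) = cmod (b n) * (LINT t|lborel. cmod (f t) * cmod (?u n t))"
      by (simp add: norm_mult mult_ac flip: integral_mult_right_zero)
    also have "\<dots> \<le> cmod (b n) * (L2_norm f * L2_norm gauss0)"
      using L2_Cauchy_Schwarz_abs(1)[OF f u, of n] unfolding un by (intro mult_left_mono) auto
    finally show ?thesis .
  qed
  have s1: "summable (\<lambda>n. LINT t|lborel. cmod (?g n t))"
    by (rule summable_comparison_test[OF _ summable_mult2[OF summable_b, of "L2_norm f * L2_norm gauss0"]])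
      (use gn in \<open>auto simp: integral_nonneg\<close>)
  have sb: "summable (\<lambda>n. b n * ?u n t)" for t
    by (rule summable_norm_cancel, rule summable_comparison_test[OF _ summable_b])
      (auto simp: norm_mult cu intro!: mult_left_le cmod_tfshift_gauss0_le)
  have s2: "summable (\<lambda>n. cmod (?g n t))" for t
  proof (rule summable_comparison_test[OF _ summable_mult[OF summable_b, of "cmod (f t)"]], intro exI allI impI)
    fix n
    have "cmod (b n) * cmod (?u n t) \<le> cmod (b n)"
      unfolding cu by (intro mult_left_le cmod_tfshift_gauss0_le) auto
    then show "norm (cmod (?g n t)) \<le> cmod (f t) * cmod (b n)" by (simp add: norm_mult mult_left_mono)
  qed
  have ps: "tfshift z \<psi> t = (\<Sum>n. b n * ?u n t)" for t
  proof -
    have "tfshift z \<psi> t = (\<Sum>n. b n * tfshift (zs n) gauss0 (t - fst z)) * cis (2 * pi * snd z * t)"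
      by (simp add: tfshift_def[of z] \<psi>_def)
    also have "\<dots> = (\<Sum>n. b n * tfshift (zs n) gauss0 (t - fst z) * cis (2 * pi * snd z * t))"
      by (rule suminf_mult2[OF summable_norm_cancel[OF summable_norm_terms]])
    finally show ?thesis by (simp add: tfshift_def[of z] mult.assoc)
  qed
  have "STFT \<psi> f z = (LINT t|lborel. (\<Sum>n. ?g n t))"
    unfolding STFT_eq_inner L2_inner_def
  proof (intro Bochner_Integration.integral_cong refl)
    fix t
    have sc: "(\<lambda>n. cnj (b n * ?u n t)) sums cnj (tfshift z \<psi> t)"
      unfolding ps using summable_sums[OF sb] by (simp only: sums_cnj)
    from sums_mult[OF this, of "f t"] show "f t * cnj (tfshift z \<psi> t) = (\<Sum>n. ?g n t)"
      by (simp only: sums_iff)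
  qed
  also have "\<dots> = (\<Sum>n. (LINT t|lborel. ?g n t))"
    by (rule integral_suminf[OF gi AE_I2[OF s2] s1])
  also have "(\<lambda>n. (LINT t|lborel. ?g n t)) = (\<lambda>n. cnj (b n) * L2_inner f (?u n))"
    unfolding L2_inner_def[symmetric] L2_inner_scale_right ..
  finally have eq: "STFT \<psi> f z = (\<Sum>n. cnj (b n) * L2_inner f (?u n))" .
  have cm: "cmod (cnj (b n) * L2_inner f (?u n)) = cmod (b n) * cmod (STFT gauss0 f (z + zs n))" for n
    by (simp add: norm_mult cmod_L2_inner_tfshift2)
  have bd: "cmod (STFT gauss0 f y) \<le> L2_norm f * L2_norm gauss0" for y by (rule STFT_bound[OF L2_gauss0 f])
  show s: "summable (\<lambda>n. cmod (b n) * cmod (STFT gauss0 f (z + zs n)))"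
    by (rule summable_comparison_test[OF _ summable_mult2[OF summable_b, of "L2_norm f * L2_norm gauss0"]])
      (simp add: abs_mult mult_left_mono[OF bd])
  show "cmod (STFT \<psi> f z) \<le> (\<Sum>n. cmod (b n) * cmod (STFT gauss0 f (z + zs n)))"
    unfolding eq using summable_norm[of "\<lambda>n. cnj (b n) * L2_inner f (?u n)"] s unfolding cm by simp
qed

text \<open>The series bound is applied to \<open>f = \<psi>\<close> at the origin, where the
  transform is the squared norm, and one factor of the norm is cancelled.\<close>

lemma L2_norm_\<psi>_le: "L2_norm \<psi> \<le> B * L2_norm gauss0"
proof (cases "L2_norm \<psi> = 0")
  case False
  note s = STFT_\<psi>_series[OF L2_\<psi>, of "(0, 0)"]
  have "(L2_norm \<psi>)^2 = cmod (STFT \<psi> \<psi> (0, 0))"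
    by (simp add: STFT_eq_inner tfshift_0 L2_inner_self norm_power L2_norm_nonneg)
  also have "\<dots> \<le> (\<Sum>n. cmod (b n) * cmod (STFT gauss0 \<psi> ((0, 0) + zs n)))" by (rule s)
  also have "\<dots> \<le> (\<Sum>n. cmod (b n) * (L2_norm \<psi> * L2_norm gauss0))"
    by (intro suminf_le s summable_mult2[OF summable_b] mult_left_mono STFT_bound[OF L2_gauss0 L2_\<psi>]) auto
  also have "\<dots> = B * (L2_norm \<psi> * L2_norm gauss0)" unfolding B_def by (rule suminf_mult2[symmetric, OF summable_b])
  finally have "L2_norm \<psi> * L2_norm \<psi> \<le> L2_norm \<psi> * (B * L2_norm gauss0)" by (simp add: power2_eq_square mult_ac)
  then show ?thesis using False L2_norm_nonneg[of \<psi>] by simp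
qed (simp add: B_nonneg L2_norm_nonneg)

text \<open>Cauchy-Schwarz with the weights \<open>|b n|\<close> costs one factor \<open>B\<close>
  and leaves a weighted sum of Gaussian cell sums, each bounded independently of
  \<open>zs n\<close>; summing the weights costs another \<open>B\<close>. Partial sums are treated
  first, so that only finite sums are interchanged.\<close>

lemma STFT_\<psi>_cell_bound:
  assumes S: "finite S" and w: "\<And>m. m \<in> S \<Longrightarrow> w m \<in> Q1 (lattice_pt m)" and f: "L2 f"
  shows "(\<Sum>m\<in>S. (cmod (STFT \<psi> f (w m)))^2) \<le> B^2 * (121/9 / sqrt 2 * (L2_norm f)^2)"
proof -
  let ?K = "121/9 / sqrt 2 * (L2_norm f)^2"
  let ?x = "\<lambda>m n. cmod (STFT gauss0 f (w m + zs n))"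
  have part: "(\<Sum>m\<in>S. (\<Sum>n<k. cmod (b n) * ?x m n)^2) \<le> B^2 * ?K" for k
  proof -
    have Bk: "(\<Sum>n<k. cmod (b n)) \<le> B" unfolding B_def by (rule sum_le_suminf[OF summable_b]) auto
    have "(\<Sum>n<k. cmod (b n) * ?x m n)^2 \<le> B * (\<Sum>n<k. cmod (b n) * (?x m n)^2)" for m
    proof -
      have "(\<Sum>n<k. cmod (b n) * ?x m n)^2 = (\<Sum>n<k. sqrt (cmod (b n)) * (sqrt (cmod (b n)) * ?x m n))^2"
        by (simp flip: mult.assoc)
      also have "\<dots> \<le> (\<Sum>n<k. (sqrt (cmod (b n)))^2) * (\<Sum>n<k. (sqrt (cmod (b n)) * ?x m n)^2)"
        by (rule Cauchy_Schwarz_ineq_sum)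
      also have "\<dots> = (\<Sum>n<k. cmod (b n)) * (\<Sum>n<k. cmod (b n) * (?x m n)^2)" by (simp add: power_mult_distrib)
      also have "\<dots> \<le> B * (\<Sum>n<k. cmod (b n) * (?x m n)^2)" by (intro mult_right_mono Bk sum_nonneg) auto
      finally show ?thesis .
    qed
    then have "(\<Sum>m\<in>S. (\<Sum>n<k. cmod (b n) * ?x m n)^2) \<le> (\<Sum>m\<in>S. B * (\<Sum>n<k. cmod (b n) * (?x m n)^2))"
      by (rule sum_mono)
    also have "\<dots> = B * (\<Sum>n<k. cmod (b n) * (\<Sum>m\<in>S. (?x m n)^2))"
      unfolding sum_distrib_left by (subst sum.swap) simp
    also have "\<dots> \<le> B * (\<Sum>n<k. cmod (b n) * ?K)"
      by (intro mult_left_mono sum_mono gauss_STFT_cell_bound[OF S w f] B_nonneg) auto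
    also have "\<dots> = B * (\<Sum>n<k. cmod (b n)) * ?K" by (simp only: sum_distrib_right[symmetric] mult.assoc)
    also have "\<dots> \<le> B * B * ?K" by (intro mult_right_mono mult_left_mono Bk B_nonneg) auto
    finally show ?thesis by (simp add: power2_eq_square)
  qed
  have "(\<Sum>m\<in>S. (\<Sum>n. cmod (b n) * ?x m n)^2) \<le> B^2 * ?K"
  proof (rule LIMSEQ_le_const2)
    show "(\<lambda>k. \<Sum>m\<in>S. (\<Sum>n<k. cmod (b n) * ?x m n)^2) \<longlonglongrightarrow> (\<Sum>m\<in>S. (\<Sum>n. cmod (b n) * ?x m n)^2)"
      by (intro tendsto_intros summable_LIMSEQ STFT_\<psi>_series f)
    show "\<exists>N. \<forall>k\<ge>N. (\<Sum>m\<in>S. (\<Sum>n<k. cmod (b n) * ?x m n)^2) \<le> B^2 * ?K" using part by blast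
  qed
  moreover have "(\<Sum>m\<in>S. (cmod (STFT \<psi> f (w m)))^2) \<le> (\<Sum>m\<in>S. (\<Sum>n. cmod (b n) * ?x m n)^2)"
    by (intro sum_mono power_mono STFT_\<psi>_series f) auto
  ultimately show ?thesis by linarith
qed

end

lemma gauss_rep_series:
  assumes "gauss_rep \<phi> b zs"
  shows "gauss_series b" and "AE t in lborel. \<phi> t = gauss_series.\<psi> b zs t"
proof -
  show g: "gauss_series b" using assms by (simp add: gauss_rep_def gauss_series_def)
  show "AE t in lborel. \<phi> t = gauss_series.\<psi> b zs t"
    using assms by (simp add: gauss_rep_def gauss_series.\<psi>_def[OF g])
qed

lemma L2_norm_cong_AE:
  assumes "L2 f" "L2 g" "AE t in lborel. f t = g t"
  shows "L2_norm f = L2_norm g"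
proof -
  have [measurable]: "f \<in> borel_measurable borel" "g \<in> borel_measurable borel" using assms by auto
  show ?thesis unfolding L2_norm_def
    by (intro arg_cong[of _ _ sqrt] integral_cong_AE) (use assms(3) in auto)
qed

text \<open>The product \<open>\<beta>\<close> acts as the infimum of the coefficient sums over all
  representations: whatever bounds all these sums from below also bounds \<open>\<beta>\<close>. The
  estimate \<open>sqrt 2 \<le> \<beta>^2\<close> comes from \<open>1 = \<parallel>\<phi>\<parallel>
  \<le> B \<parallel>gauss0\<parallel>\<close> and
  \<open>\<parallel>gauss0\<parallel>^2 = 1 / sqrt 2\<close>.\<close>

lemma STFT_cell_bound:
  assumes S0: "in_S0 \<phi>" and norm: "L2_norm \<phi> = 1"
  defines "\<beta> \<equiv> C_const \<phi> * S0_norm \<phi>"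
  shows "sqrt 2 \<le> \<beta>^2" and "0 \<le> \<beta>"
    and "finite S \<Longrightarrow> (\<And>m. m \<in> S \<Longrightarrow> w m \<in> Q1 (lattice_pt m)) \<Longrightarrow> L2 f \<Longrightarrow>
      (\<Sum>m\<in>S. (cmod (STFT \<phi> f (w m)))^2) \<le> \<beta>^2 * (121/9 / sqrt 2 * (L2_norm f)^2)"
proof -
  let ?A = "{C. C > 0 \<and> (\<exists>b zs. gauss_rep \<phi> b zs \<and> (\<Sum>n. cmod (b n)) \<le> C * S0_norm \<phi>)}"
  have L2: "L2 \<phi>" using S0 by (simp add: in_S0_def)
  have [measurable]: "\<phi> \<in> borel_measurable borel" using L2 by auto
  have pos: "S0_norm \<phi> > 0" using S0_norm_pos[OF S0] norm by simp
  obtain b0 zs0 where rep0: "gauss_rep \<phi> b0 zs0" using gauss_rep_exists[OF S0] by blast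
  have s0: "0 \<le> (\<Sum>n. cmod (b0 n))" using rep0 by (intro suminf_nonneg) (auto simp: gauss_rep_def)
  have ne: "?A \<noteq> {}"
  proof -
    \<comment> \<open>Adding 1 makes the constant strictly positive, as membership requires.\<close>
    have "((\<Sum>n. cmod (b0 n)) + 1) / S0_norm \<phi> \<in> ?A"
      using rep0 pos s0 by (auto intro!: divide_pos_pos exI[of _ b0] exI[of _ zs0])
    then show ?thesis by blast
  qed
  have lb: "q / S0_norm \<phi> \<le> C_const \<phi>" if "\<And>b zs. gauss_rep \<phi> b zs \<Longrightarrow> q \<le> (\<Sum>n. cmod (b n))" for q
    unfolding C_const_def
  proof (rule cInf_greatest[OF ne])
    fix C assume "C \<in> ?A"
    then obtain b zs where "gauss_rep \<phi> b zs" "(\<Sum>n. cmod (b n)) \<le> C * S0_norm \<phi>" by blast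
    with that[of b zs] have "q \<le> C * S0_norm \<phi>" by linarith
    then show "q / S0_norm \<phi> \<le> C" using pos by (simp add: field_simps)
  qed
  have lb': "q \<le> \<beta>" if "\<And>b zs. gauss_rep \<phi> b zs \<Longrightarrow> q \<le> (\<Sum>n. cmod (b n))" for q
    using lb[OF that] pos unfolding \<beta>_def by (simp add: field_simps)
  have g0: "L2_norm gauss0 > 0"
    using L2_norm_gauss0 L2_norm_nonneg[of gauss0] by (cases "L2_norm gauss0 = 0") auto
  have "1 / L2_norm gauss0 \<le> \<beta>"
  proof (rule lb')
    fix b zs assume r: "gauss_rep \<phi> b zs"
    interpret gauss_series b zs by (rule gauss_rep_series(1)[OF r])
    have "L2_norm \<phi> = L2_norm \<psi>" by (rule L2_norm_cong_AE[OF L2 L2_\<psi> gauss_rep_series(2)[OF r]])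
    then have "1 \<le> B * L2_norm gauss0" using L2_norm_\<psi>_le norm by simp
    then show "1 / L2_norm gauss0 \<le> (\<Sum>n. cmod (b n))" using g0 by (simp add: B_def field_simps)
  qed
  moreover have "0 < 1 / L2_norm gauss0" using g0 by simp
  ultimately have "0 \<le> \<beta>" and "(1 / L2_norm gauss0)^2 \<le> \<beta>^2" by (linarith, intro power_mono) auto
  then show "sqrt 2 \<le> \<beta>^2" "0 \<le> \<beta>" by (simp_all add: power_divide L2_norm_gauss0)
  assume S: "finite S" and w: "\<And>m. m \<in> S \<Longrightarrow> w m \<in> Q1 (lattice_pt m)" and f: "L2 f"
  have [measurable]: "f \<in> borel_measurable borel" using f by auto
  let ?X = "\<Sum>m\<in>S. (cmod (STFT \<phi> f (w m)))^2" and ?K = "121/9 / sqrt 2 * (L2_norm f)^2"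
  have X: "?X \<le> (\<Sum>n. cmod (b n))^2 * ?K" and nb: "0 \<le> (\<Sum>n. cmod (b n))" if r: "gauss_rep \<phi> b zs" for b zs
  proof -
    interpret gauss_series b zs by (rule gauss_rep_series(1)[OF r])
    have "STFT \<phi> f z = STFT \<psi> f z" for z
      by (rule STFT_cong_AE[OF _ _ _ gauss_rep_series(2)[OF r]]) auto
    then show "?X \<le> (\<Sum>n. cmod (b n))^2 * ?K"
      using STFT_\<psi>_cell_bound[OF S w f] by (simp add: B_def)
    show "0 \<le> (\<Sum>n. cmod (b n))" using B_nonneg by (simp add: B_def)
  qed
  show "?X \<le> \<beta>^2 * ?K"
  proof (cases "?K = 0")
    case True
    then show ?thesis using X[OF rep0] by simp
  next
    case False
    then have K: "?K > 0" by (simp add: zero_less_mult_iff)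
    have X0: "0 \<le> ?X" by (simp add: sum_nonneg)
    \<comment> \<open>The cell bound is solved for the coefficient sum, because the infimum is
      accessible only through lower bounds valid for every representation.\<close>
    have "sqrt (?X / ?K) \<le> \<beta>"
    proof (rule lb')
      fix b zs assume r: "gauss_rep \<phi> b zs"
      have "?X / ?K \<le> (\<Sum>n. cmod (b n))^2" using X[OF r] K by (simp only: pos_divide_le_eq)
      then show "sqrt (?X / ?K) \<le> (\<Sum>n. cmod (b n))" using nb[OF r] by (rule real_le_lsqrt[rotated])
    qed
    then have "?X / ?K \<le> \<beta>^2" using \<open>0 \<le> \<beta>\<close> by (simp only: real_sqrt_le_iff sqrt_le_D)
    then show ?thesis using K by (simp only: pos_divide_le_eq)
  qed
qed

section \<open>Localization operators of continuous windows\<close>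

text \<open>The Plancherel inequality with a Gaussian regularization that makes Fubini applicable; the parameter
  \<open>\<sigma>\<close> later tends to \<open>0\<close>.\<close>
lemma gaussian_Plancherel_bound:
  fixes g :: "real \<Rightarrow> complex"
  assumes g1: "integrable lborel g" and g2: "integrable lborel (\<lambda>t. (cmod (g t))^2)" and \<sigma>: "\<sigma> > 0"
  defines "ft \<equiv> \<lambda>w. (LINT t|lborel. g t * cis (- 2 * pi * w * t))"
  shows "integrable lborel (\<lambda>w. (cmod (ft w))^2 * exp (- (pi * \<sigma> * w^2)))"
    and "(LINT w|lborel. (cmod (ft w))^2 * exp (- (pi * \<sigma> * w^2))) \<le> (LINT t|lborel. (cmod (g t))^2)"
proof -
  have [measurable]: "g \<in> borel_measurable borel" using g1 by auto
  have cg: "integrable lborel (\<lambda>s. cnj (g s))" using g1 by simp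
  let ?P = "\<lambda>p. g (fst p) * cnj (g (snd p))"
  have "integrable (lborel \<Otimes>\<^sub>M lborel) (\<lambda>p. g (fst p) * (\<lambda>q. cnj (g (snd q))) p)"
    by (rule pair_mult_integrable[OF g1, of _ "LINT s|lborel. cmod (g s)"]) (use cg in auto)
  then have P: "integrable lborel ?P" by (simp only: lborel_prod)
  \<comment> \<open>With the squared modulus written as a double integral over the pair
    \<open>p\<close>, this factor collects the phase and the regularization. Integrated over the
    frequency it becomes the Gaussian \<open>k\<close> in the difference of the two points.\<close>
  let ?h = "\<lambda>q::(real\<times>real)\<times>real. of_real (exp (- (pi * \<sigma> * (snd q)^2))) * cis (2 * pi * (snd (fst q) - fst (fst q)) * snd q)"
  have hc: "continuous_on UNIV ?h" unfolding cis_conv_exp by (intro continuous_intros)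
  have hi: "integrable lborel (\<lambda>w. ?h (p, w))" for p
    by (rule Bochner_Integration.integrable_bound[OF gaussian_Fourier_std(1)[OF \<sigma>]])
      (auto simp: norm_mult intro!: borel_measurable_times borel_measurable_continuous_onI continuous_intros simp: cis_conv_exp)
  have I3: "integrable (lborel \<Otimes>\<^sub>M lborel) (\<lambda>q. ?P (fst q) * ?h q)"
  proof (rule pair_mult_integrable[OF P _ hi])
    show "?h \<in> borel_measurable (borel \<Otimes>\<^sub>M borel)" using hc by (simp add: borel_prod borel_measurable_continuous_onI)
    show "(LINT w|lborel. cmod (?h (p, w))) \<le> 1 / sqrt \<sigma>" for p
      using gaussian_integral[OF \<sigma>, of 0] by (simp add: norm_mult)
  qed
  have ftm: "complex_of_real ((cmod (ft w))^2 * exp (- (pi * \<sigma> * w^2))) = (LINT p|lborel. ?P p * ?h (p, w))" for w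
  proof -
    have c: "integrable lborel (\<lambda>t. g t * cis (- 2 * pi * w * t))"
      by (rule Bochner_Integration.integrable_bound[OF g1]) (auto simp: norm_mult)
    have "complex_of_real ((cmod (ft w))^2) = ft w * cnj (ft w)" by (metis complex_norm_square of_real_power)
    also have "cnj (ft w) = (LINT s|lborel. cnj (g s * cis (- 2 * pi * w * s)))" unfolding ft_def by (rule Bochner_Integration.integral_cnj[symmetric])
    also have "ft w * (LINT s|lborel. cnj (g s * cis (- 2 * pi * w * s))) = (LINT t|lborel. (LINT s|lborel. g t * cis (- 2 * pi * w * t) * cnj (g s * cis (- 2 * pi * w * s))))"
      unfolding ft_def by (simp only: integral_mult_left_zero integral_mult_right_zero)
    also have "\<dots> = (LINT p|(lborel \<Otimes>\<^sub>M lborel). g (fst p) * cis (- 2 * pi * w * fst p) * cnj (g (snd p) * cis (- 2 * pi * w * snd p)))"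
    proof -
      have "integrable (lborel \<Otimes>\<^sub>M lborel) (\<lambda>p. (\<lambda>t. g t * cis (- 2 * pi * w * t)) (fst p) * (\<lambda>q. cnj (g (snd q) * cis (- 2 * pi * w * snd q))) p)"
      proof (rule pair_mult_integrable[OF c, of _ "LINT s|lborel. cmod (g s)"])
        show "integrable lborel (\<lambda>s. cnj (g (snd (t, s)) * cis (- 2 * pi * w * snd (t, s))))" for t using integrable_cnj[OF c] by simp
      qed (auto simp: norm_mult intro!: measurable_compose[OF _ measurable_cnj])
      from lborel_pair.integral_fst'[OF this] show ?thesis by simp
    qed
    finally have "complex_of_real ((cmod (ft w))^2 * exp (- (pi * \<sigma> * w^2)))
      = (LINT p|lborel. g (fst p) * cis (- 2 * pi * w * fst p) * cnj (g (snd p) * cis (- 2 * pi * w * snd p)) * of_real (exp (- (pi * \<sigma> * w^2))))"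
      unfolding lborel_prod by simp
    also have "\<dots> = (LINT p|lborel. ?P p * ?h (p, w))"
    proof (intro Bochner_Integration.integral_cong refl)
      fix p :: "real \<times> real"
      have "cis (- 2 * pi * w * fst p) * cnj (cis (- 2 * pi * w * snd p)) = cis (2 * pi * (snd p - fst p) * w)"
        unfolding cis_cnj cis_mult by (intro arg_cong[of _ _ cis]) (simp add: algebra_simps)
      then show "g (fst p) * cis (- 2 * pi * w * fst p) * cnj (g (snd p) * cis (- 2 * pi * w * snd p)) * of_real (exp (- (pi * \<sigma> * w^2))) = ?P p * ?h (p, w)"
        by (simp add: mult_ac)
    qed
    finally show ?thesis .
  qed
  have I3': "integrable (lborel \<Otimes>\<^sub>M lborel) (case_prod (\<lambda>p w. ?P p * ?h (p, w)))" using I3 by (simp add: case_prod_beta')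
  have "integrable lborel (\<lambda>w. complex_of_real ((cmod (ft w))^2 * exp (- (pi * \<sigma> * w^2))))"
    unfolding ftm by (rule lborel_pair.integrable_snd[OF I3'])
  then show "integrable lborel (\<lambda>w. (cmod (ft w))^2 * exp (- (pi * \<sigma> * w^2)))" by (simp only: complex_of_real_integrable_eq)
  \<comment> \<open>A symmetric kernel with total mass 1 in each variable. The arithmetic-geometric
    mean inequality therefore bounds its quadratic form at \<open>|g|\<close> by the squared L^2
    norm, with no limit in \<open>\<sigma>\<close>.\<close>
  define k :: "real \<times> real \<Rightarrow> real" where "k p = exp (- (pi * (fst p - snd p)^2 / \<sigma>)) / sqrt \<sigma>" for p
  have k0: "0 \<le> k p" and k_swap: "k (s, t) = k (t, s)" for p s t using \<sigma> by (simp_all add: k_def power2_commute)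
  have "complex_of_real (LINT w|lborel. (cmod (ft w))^2 * exp (- (pi * \<sigma> * w^2))) = (LINT w|lborel. (LINT p|lborel. ?P p * ?h (p, w)))"
    unfolding ftm[symmetric] by (rule integral_complex_of_real[symmetric])
  also have "\<dots> = (LINT p|lborel. (LINT w|lborel. ?P p * ?h (p, w)))"
    by (rule integral_swap) (use I3 in simp)
  also have "\<dots> = (LINT p|lborel. ?P p * of_real (k p))"
    using gaussian_Fourier_std(2)[OF \<sigma>] by (simp add: k_def power2_commute)
  finally have eq: "complex_of_real (LINT w|lborel. (cmod (ft w))^2 * exp (- (pi * \<sigma> * w^2))) = \<dots>" .
  have gk: "exp (- (pi * (t - s)^2 / \<sigma>)) = exp (- (pi * (1 / \<sigma>) * (t - s)^2))" for t s by simp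
  have sg: "0 < 1 / \<sigma>" using \<sigma> by simp
  have ik: "integrable lborel (\<lambda>s. k (t, s))" and kk: "(LINT s|lborel. k (t, s)) = 1" for t
    using gaussian_integrable[OF sg, of t] gaussian_integral[OF sg, of t] \<sigma> unfolding k_def fst_conv snd_conv gk power2_commute[of t]
    by (simp_all add: real_sqrt_divide)
  have kc: "continuous_on UNIV (\<lambda>p::real\<times>real. complex_of_real (k p))" unfolding k_def using \<sigma> by (intro continuous_intros) auto
  have g2c: "integrable lborel (\<lambda>t. complex_of_real ((cmod (g t))^2))" using g2 by (simp only: complex_of_real_integrable_eq)
  have K1: "integrable (lborel \<Otimes>\<^sub>M lborel) (\<lambda>p. complex_of_real ((cmod (g (fst p)))^2) * (\<lambda>p. complex_of_real (k p)) p)"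
  proof (rule pair_mult_integrable[OF g2c, of _ 1])
    show "(\<lambda>p. complex_of_real (k p)) \<in> borel_measurable (borel \<Otimes>\<^sub>M borel)" using kc by (simp add: borel_prod borel_measurable_continuous_onI)
    show "integrable lborel (\<lambda>s. complex_of_real (k (t, s)))" for t using ik[of t] by (simp only: complex_of_real_integrable_eq)
    show "(LINT s|lborel. cmod (complex_of_real (k (t, s)))) \<le> 1" for t using kk[of t] by (simp add: k0)
  qed
  then have "integrable (lborel \<Otimes>\<^sub>M lborel) (\<lambda>p. complex_of_real ((cmod (g (fst p)))^2 * k p))" by simp
  then have K1r: "integrable (lborel \<Otimes>\<^sub>M lborel) (\<lambda>p. (cmod (g (fst p)))^2 * k p)" by (simp only: complex_of_real_integrable_eq)
  have K2r: "integrable (lborel \<Otimes>\<^sub>M lborel) (\<lambda>p. (cmod (g (snd p)))^2 * k p)"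
    using lborel_pair.integrable_product_swap[OF K1r] by (simp add: case_prod_beta' k_swap[of "snd _" "fst _"])
  have v1: "(LINT p|(lborel \<Otimes>\<^sub>M lborel). (cmod (g (fst p)))^2 * k p) = (LINT t|lborel. (cmod (g t))^2)"
    using lborel_pair.integral_fst'[OF K1r] kk by simp
  have v2: "(LINT p|(lborel \<Otimes>\<^sub>M lborel). (cmod (g (snd p)))^2 * k p) = (LINT t|lborel. (cmod (g t))^2)"
  proof -
    have "(LINT p|(lborel \<Otimes>\<^sub>M lborel). (cmod (g (snd p)))^2 * k p) = (LINT p|(lborel \<Otimes>\<^sub>M lborel). (cmod (g (fst p)))^2 * k p)"
      using lborel_pair.integral_product_swap[of "\<lambda>p. (cmod (g (fst p)))^2 * k p"] K1r by (simp add: case_prod_beta' k_swap[of "snd _" "fst _"])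
    then show ?thesis using v1 by simp
  qed
  have bd: "cmod (?P p * of_real (k p)) \<le> (cmod (g (fst p)))^2 * k p / 2 + (cmod (g (snd p)))^2 * k p / 2" for p
  proof -
    have "cmod (g (fst p)) * cmod (g (snd p)) \<le> (cmod (g (fst p)))^2 / 2 + (cmod (g (snd p)))^2 / 2"
      using sum_squares_bound[of "cmod (g (fst p))" "cmod (g (snd p))"] by simp
    then have "cmod (g (fst p)) * cmod (g (snd p)) * k p \<le> ((cmod (g (fst p)))^2 / 2 + (cmod (g (snd p)))^2 / 2) * k p"
      using k0 by (intro mult_right_mono) auto
    moreover have "cmod (?P p * of_real (k p)) = cmod (g (fst p)) * cmod (g (snd p)) * k p" by (simp add: norm_mult k0)
    ultimately show ?thesis by (simp add: distrib_right)
  qed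
  have bi: "integrable lborel (\<lambda>p. (cmod (g (fst p)))^2 * k p / 2 + (cmod (g (snd p)))^2 * k p / 2)"
    using K1r K2r unfolding lborel_prod by (intro Bochner_Integration.integrable_add integrable_divide)
  have m: "(\<lambda>p. ?P p * of_real (k p)) \<in> borel_measurable lborel"
    using borel_measurable_times[OF borel_measurable_integrable[OF P], of "\<lambda>p. of_real (k p)"]
      borel_measurable_continuous_onI[OF kc] by simp
  have ni: "integrable lborel (\<lambda>p. ?P p * of_real (k p))"
    by (rule Bochner_Integration.integrable_bound[OF bi m]) (use bd in \<open>auto intro!: AE_I2 order_trans[OF _ abs_ge_self]\<close>)
  have "(LINT w|lborel. (cmod (ft w))^2 * exp (- (pi * \<sigma> * w^2))) \<le> cmod (complex_of_real (LINT w|lborel. (cmod (ft w))^2 * exp (- (pi * \<sigma> * w^2))))"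
    by simp
  also have "\<dots> \<le> (LINT p|lborel. cmod (?P p * of_real (k p)))" unfolding eq by (rule integral_norm_bound)
  also have "\<dots> \<le> (LINT p|lborel. (cmod (g (fst p)))^2 * k p / 2 + (cmod (g (snd p)))^2 * k p / 2)"
    by (intro integral_mono integrable_norm ni bi bd)
  also have "\<dots> = (LINT t|lborel. (cmod (g t))^2)"
    using K1r K2r v1 v2 unfolding lborel_prod by (subst Bochner_Integration.integral_add) auto
  finally show "(LINT w|lborel. (cmod (ft w))^2 * exp (- (pi * \<sigma> * w^2))) \<le> (LINT t|lborel. (cmod (g t))^2)" .
qed

text \<open>What the continuous representative of \<open>\<phi>\<close> provides: continuity serves
  the equicontinuity of the transforms, while boundedness and integrability serve Fubini and
  dominated convergence.\<close>

locale window =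
  fixes \<phi> :: "real \<Rightarrow> complex" and B :: real
  assumes cont: "continuous_on UNIV \<phi>" and bound: "\<And>t. cmod (\<phi> t) \<le> B"
    and int: "integrable lborel \<phi>" and L2_window: "L2 \<phi>" and norm_window: "L2_norm \<phi> = 1"
begin

abbreviation V :: "(real \<Rightarrow> complex) \<Rightarrow> real \<times> real \<Rightarrow> complex" where "V \<equiv> STFT \<phi>"

abbreviation shift :: "real \<times> real \<Rightarrow> real \<Rightarrow> complex" where "shift z \<equiv> tfshift z \<phi>"

lemma L2_shift: "L2 (shift z)" and norm_shift: "L2_norm (shift z) = 1"
  using L2_tfshift[OF L2_window] norm_window by (auto simp: L2_norm_tfshift)

lemma V_bound: "L2 f \<Longrightarrow> cmod (V f z) \<le> L2_norm f"
  using STFT_bound[OF L2_window] norm_window by simp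

lemma shift_joint_continuous: "continuous_on UNIV (\<lambda>p. shift (fst p) (snd p))"
  unfolding tfshift_def cis_conv_exp
  by (intro continuous_intros continuous_on_compose2[OF cont]) auto

lemma shift_joint_measurable [measurable]: "(\<lambda>p. shift (fst p) (snd p)) \<in> borel_measurable (borel \<Otimes>\<^sub>M borel)"
  using shift_joint_continuous by (simp add: borel_prod borel_measurable_continuous_onI)

lemma shift_bound: "cmod (shift z t) \<le> B"
  using bound by (simp add: cmod_tfshift)

lemma B_nonneg: "0 \<le> B"
  using order_trans[OF norm_ge_zero bound] .

lemma shift_L1: "integrable lborel (shift z)" "(LINT t|lborel. cmod (shift z t)) = (LINT t|lborel. cmod (\<phi> t))"
proof -
  have [measurable]: "\<phi> \<in> borel_measurable borel" by (rule borel_measurable_continuous_onI[OF cont])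
  have "integrable lborel (\<lambda>t. \<phi> (- fst z + 1 * t))" by (rule lborel_integrable_real_affine[OF int]) simp
  from integrable_norm[OF this] show "integrable lborel (shift z)"
    by (rule Bochner_Integration.integrable_bound) (use tfshift_measurable[of \<phi> z] in \<open>auto simp: cmod_tfshift\<close>)
  show "(LINT t|lborel. cmod (shift z t)) = (LINT t|lborel. cmod (\<phi> t))"
    using lborel_integral_real_affine[of 1 "\<lambda>t. cmod (\<phi> t)" "- fst z"] by (simp add: cmod_tfshift)
qed

definition osc :: "real \<times> real \<Rightarrow> real \<times> real \<Rightarrow> real" where
  "osc z z' = L2_norm (\<lambda>t. shift z t - shift z' t)"

text \<open>All shifts have norm 1, so the squared oscillation is
  \<open>2 - 2 Re \<langle>\<pi>(z) \<phi>, \<pi>(z') \<phi>\<rangle>\<close>. The inner product is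
  continuous in \<open>z'\<close> by dominated convergence.\<close>

lemma osc_continuous: "((\<lambda>z'. osc z z') \<longlongrightarrow> 0) (at z)"
proof -
  have "isCont (\<lambda>z'. L2_inner (shift z) (shift z')) z"
    unfolding continuous_at_sequentially
  proof (intro allI impI)
    fix x assume x: "x \<longlonglongrightarrow> z"
    have "(\<lambda>n. LINT t|lborel. shift z t * cnj (shift (x n) t)) \<longlonglongrightarrow> (LINT t|lborel. shift z t * cnj (shift z t))"
    proof (rule integral_dominated_convergence[where w = "\<lambda>t. B * cmod (shift z t)"])
      have m: "shift y \<in> borel_measurable borel" for y using L2_shift by auto
      show "(\<lambda>t. shift z t * cnj (shift z t)) \<in> borel_measurable lborel" "(\<lambda>t. shift z t * cnj (shift (x n) t)) \<in> borel_measurable lborel" for n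
        using m by auto
      show "integrable lborel (\<lambda>t. B * cmod (shift z t))" using shift_L1(1) by simp
      show "AE t in lborel. (\<lambda>n. shift z t * cnj (shift (x n) t)) \<longlonglongrightarrow> shift z t * cnj (shift z t)"
      proof (rule AE_I2)
        fix t
        have "continuous_on UNIV (\<lambda>y. shift y t)"
          using continuous_on_compose2[OF shift_joint_continuous, of UNIV "\<lambda>y. (y, t)"] by (simp add: continuous_on_Pair continuous_on_id)
        then have "(\<lambda>n. shift (x n) t) \<longlonglongrightarrow> shift z t" using x by (rule continuous_on_tendsto_compose) auto
        then show "(\<lambda>n. shift z t * cnj (shift (x n) t)) \<longlonglongrightarrow> shift z t * cnj (shift z t)" by (intro tendsto_intros)
      qed
      show "AE t in lborel. cmod (shift z t * cnj (shift (x n) t)) \<le> B * cmod (shift z t)" for n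
        using shift_bound by (intro AE_I2) (simp add: norm_mult mult.commute[of B] mult_left_mono)
    qed
    then show "((\<lambda>z'. L2_inner (shift z) (shift z')) \<circ> x) \<longlonglongrightarrow> L2_inner (shift z) (shift z)"
      by (simp add: L2_inner_def o_def)
  qed
  then have "((\<lambda>z'. sqrt (1 - 2 * Re (L2_inner (shift z) (shift z')) + 1)) \<longlongrightarrow> sqrt (1 - 2 * Re (L2_inner (shift z) (shift z)) + 1)) (at z)"
    unfolding isCont_def by (intro tendsto_intros)
  moreover have "osc z z' = sqrt (1 - 2 * Re (L2_inner (shift z) (shift z')) + 1)" for z'
  proof -
    have "(osc z z')^2 = 1 - 2 * Re (L2_inner (shift z) (shift z')) + 1"
      unfolding osc_def by (subst L2_norm_diff_sq[OF L2_shift L2_shift]) (simp add: norm_shift)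
    then show ?thesis by (metis osc_def L2_norm_nonneg real_sqrt_unique)
  qed
  ultimately show ?thesis by (simp add: L2_inner_self norm_shift)
qed

lemma V_diff:
  assumes "L2 f" shows "cmod (V f z - V f z') \<le> L2_norm f * osc z z'"
  unfolding STFT_eq_inner osc_def
  using L2_Cauchy_Schwarz[OF assms L2_diff[OF L2_shift L2_shift]]
  by (simp add: L2_inner_diff_right L2_shift assms)

text \<open>The oscillation of the shifts does not involve \<open>f\<close>, so one radius serves
  the whole ball of norm \<open>K\<close>: the hypothesis of Arzela-Ascoli. The denominator
  \<open>|K| + 1\<close> is positive for every \<open>K\<close>.\<close>

lemma V_equicontinuous:
  assumes "0 < e"
  obtains d where "0 < d" "\<And>f z'. L2 f \<Longrightarrow> L2_norm f \<le> K \<Longrightarrow> norm (z - z') < d \<Longrightarrow> cmod (V f z - V f z') < e"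
proof -
  have "0 < e / (\<bar>K\<bar> + 1)" using assms by simp
  with tendstoD[OF osc_continuous] have "\<forall>\<^sub>F z' in at z. dist (osc z z') 0 < e / (\<bar>K\<bar> + 1)" by blast
  then obtain d where d: "d > 0" "\<And>z'. z' \<noteq> z \<Longrightarrow> dist z' z < d \<Longrightarrow> osc z z' < e / (\<bar>K\<bar> + 1)"
    unfolding eventually_at by (auto simp: osc_def L2_norm_nonneg)
  have "cmod (V f z - V f z') < e" if "L2 f" "L2_norm f \<le> K" "norm (z - z') < d" for f z'
  proof (cases "z' = z")
    case False
    have o: "osc z z' < e / (\<bar>K\<bar> + 1)" using d(2)[OF False] that(3) by (simp add: dist_norm norm_minus_commute)
    have "cmod (V f z - V f z') \<le> L2_norm f * osc z z'" by (rule V_diff[OF that(1)])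
    also have "\<dots> \<le> (\<bar>K\<bar> + 1) * osc z z'"
      using that(2) by (intro mult_right_mono) (auto simp: osc_def L2_norm_nonneg)
    also have "\<dots> < e" using o by (simp add: field_simps)
    finally show ?thesis .
  qed (use assms in simp)
  with d(1) that show ?thesis by blast
qed

lemma V_continuous: assumes "L2 f" shows "continuous_on S (V f)"
  unfolding continuous_on_iff
proof (intro ballI allI impI)
  fix z and e :: real assume "z \<in> S" "0 < e"
  from V_equicontinuous[OF this(2), of "L2_norm f" z] obtain d where
    d: "0 < d" "\<And>z'. norm (z - z') < d \<Longrightarrow> cmod (V f z - V f z') < e" using assms by (metis order_refl)
  then show "\<exists>d>0. \<forall>z'\<in>S. dist z' z < d \<longrightarrow> dist (V f z') (V f z) < e"
    by (intro exI[of _ d]) (auto simp: dist_norm norm_minus_commute)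
qed

lemma V_measurable [measurable]: "L2 f \<Longrightarrow> V f \<in> borel_measurable borel"
  by (rule borel_measurable_continuous_onI[OF V_continuous])

definition syn :: "(real \<times> real \<Rightarrow> complex) \<Rightarrow> real \<Rightarrow> complex" where
  "syn F t = (LINT z|lborel. F z * shift z t)"

text \<open>The function is bounded by \<open>B\<close> times the L^1 norm of \<open>F\<close>, and
  it is integrable by Fubini; a bounded integrable function is square-integrable.\<close>

lemma syn_L2:
  assumes F: "integrable lborel F"
  shows "L2 (syn F)"
proof -
  have [measurable]: "F \<in> borel_measurable borel" using F by auto
  have Fi: "integrable lborel (\<lambda>z. F z * shift z t)" for t
  proof (rule Bochner_Integration.integrable_bound[of _ "\<lambda>z. B * cmod (F z)"])
    have "continuous_on UNIV (\<lambda>z. shift z t)"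
      using continuous_on_compose2[OF shift_joint_continuous, of UNIV "\<lambda>z. (z, t)"] by (simp add: continuous_on_Pair continuous_on_id)
    then show "(\<lambda>z. F z * shift z t) \<in> borel_measurable lborel"
      by (intro borel_measurable_times) (auto intro: borel_measurable_continuous_onI)
    show "AE z in lborel. cmod (F z * shift z t) \<le> norm (B * cmod (F z))"
      using shift_bound by (intro AE_I2) (simp add: norm_mult mult.commute[of B] mult_left_mono abs_mult B_nonneg)
  qed (use F in simp)
  have b: "cmod (syn F t) \<le> B * (LINT z|lborel. cmod (F z))" for t
  proof -
    have "cmod (syn F t) \<le> (LINT z|lborel. cmod (F z * shift z t))" unfolding syn_def by (rule integral_norm_bound)
    also have "\<dots> \<le> (LINT z|lborel. B * cmod (F z))"
      using shift_bound by (intro integral_mono integrable_norm Fi) (auto simp: F norm_mult mult.commute[of B] mult_left_mono)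
    finally show ?thesis by simp
  qed
  have "integrable (lborel \<Otimes>\<^sub>M lborel) (\<lambda>p. F (fst p) * (\<lambda>p. shift (fst p) (snd p)) p)"
    by (rule pair_mult_integrable[OF F, of _ "LINT t|lborel. cmod (\<phi> t)"]) (use shift_L1 in auto)
  then have "integrable (lborel \<Otimes>\<^sub>M lborel) (case_prod (\<lambda>z t. F z * shift z t))" by (simp add: case_prod_beta')
  from lborel_pair.integrable_snd[OF this] have i: "integrable lborel (syn F)" by (simp add: syn_def[abs_def])
  then have [measurable]: "syn F \<in> borel_measurable borel" by auto
  have "integrable lborel (\<lambda>t. (cmod (syn F t))^2)"
  proof (rule Bochner_Integration.integrable_bound)
    show "integrable lborel (\<lambda>t. B * (LINT z|lborel. cmod (F z)) * cmod (syn F t))" using i by simp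
    show "AE t in lborel. norm ((cmod (syn F t))^2) \<le> norm (B * (LINT z|lborel. cmod (F z)) * cmod (syn F t))"
    proof (rule AE_I2)
      fix t
      have "cmod (syn F t) * cmod (syn F t) \<le> B * (LINT z|lborel. cmod (F z)) * cmod (syn F t)"
        using b by (intro mult_right_mono) auto
      then show "norm ((cmod (syn F t))^2) \<le> norm (B * (LINT z|lborel. cmod (F z)) * cmod (syn F t))"
        by (simp add: power2_eq_square)
    qed
  qed simp
  then show ?thesis by (simp add: L2_def)
qed

lemma syn_adjoint:
  assumes F: "integrable lborel F" and f: "L2 f"
  shows "L2_inner (syn F) f = (LINT z|lborel. F z * cnj (V f z))"
proof -
  have [measurable]: "f \<in> borel_measurable borel" using f by auto
  have i: "integrable (lborel \<Otimes>\<^sub>M lborel) (\<lambda>p. F (fst p) * (shift (fst p) (snd p) * cnj (f (snd p))))"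
  proof (rule pair_mult_integrable[OF F])
    show "(\<lambda>p. shift (fst p) (snd p) * cnj (f (snd p))) \<in> borel_measurable (borel \<Otimes>\<^sub>M borel)" by measurable
    show "integrable lborel (\<lambda>t. shift (fst (z, t)) (snd (z, t)) * cnj (f (snd (z, t))))" for z
      using L2_inner_integrable[OF L2_shift f] by simp
    show "(LINT t|lborel. cmod (shift (fst (z, t)) (snd (z, t)) * cnj (f (snd (z, t))))) \<le> L2_norm f" for z
      using L2_Cauchy_Schwarz_abs(1)[OF L2_shift f, of z] by (simp add: norm_mult norm_shift)
  qed
  have "L2_inner (syn F) f = (LINT t|lborel. (LINT z|lborel. F z * (shift z t * cnj (f t))))"
    unfolding L2_inner_def syn_def by (simp flip: mult.assoc)
  also have "\<dots> = (LINT z|lborel. (LINT t|lborel. F z * (shift z t * cnj (f t))))"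
    by (rule integral_swap) (rule i)
  also have "\<dots> = (LINT z|lborel. F z * cnj (V f z))"
    by (simp add: STFT_eq_inner L2_inner_cnj) (simp add: L2_inner_def)
  finally show ?thesis .
qed

text \<open>For fixed \<open>x\<close> the transform is, in the frequency, the Fourier transform of
  \<open>f\<close> times a translated conjugate window; Plancherel and integration over
  \<open>x\<close> give \<open>\<parallel>f\<parallel>^2 \<parallel>\<phi>\<parallel>^2\<close>. On
  a bounded set with frequencies up to \<open>R\<close> the Gaussian regularization costs at most
  \<open>exp (pi \<sigma> R^2)\<close>, which tends to 1.\<close>

lemma V_energy_bound:
  assumes \<Omega>: "compact \<Omega>" and f: "L2 f"
  shows "(LINT z:\<Omega>|lborel. (cmod (V f z))^2) \<le> (L2_norm f)^2"
proof -
  have [measurable]: "f \<in> borel_measurable borel" "\<phi> \<in> borel_measurable borel" using f L2_window by auto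
  obtain R where R: "R > 0" "\<And>z. z \<in> \<Omega> \<Longrightarrow> norm z \<le> R"
    using compact_imp_bounded[OF \<Omega>] unfolding bounded_pos by auto
  have R': "\<bar>snd z\<bar> \<le> R" if "z \<in> \<Omega>" for z
    using R(2)[OF that] norm_snd_le[of "snd z" "fst z"] by simp
  have [measurable]: "\<Omega> \<in> sets borel" using \<Omega> by (simp add: compact_imp_closed)
  have si: "integrable lborel (\<lambda>z. indicator \<Omega> z *\<^sub>R (cmod (V f z))^2)"
    by (rule borel_integrable_compact[OF \<Omega>]) (intro continuous_intros V_continuous f)
  have g2: "integrable lborel (\<lambda>t. (cmod (f t * cnj (\<phi> (t - x))))^2)" for x
  proof (rule Bochner_Integration.integrable_bound)
    show "integrable lborel (\<lambda>t. B^2 * (cmod (f t))^2)" using L2_integrable[OF f] by simp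
    show "AE t in lborel. norm ((cmod (f t * cnj (\<phi> (t - x))))^2) \<le> norm (B^2 * (cmod (f t))^2)"
      using bound by (intro AE_I2) (simp add: norm_mult power_mult_distrib mult.commute[of "B^2"] mult_left_mono power_mono)
  qed simp
  have g1: "integrable lborel (\<lambda>t. f t * cnj (\<phi> (t - x)))" for x
    using L2_inner_integrable[OF f L2_shift[of "(x, 0)"]] by (simp add: tfshift_def)
  have Vft: "V f (x, w) = (LINT t|lborel. f t * cnj (\<phi> (t - x)) * cis (- 2 * pi * w * t))" for x w
    by (simp add: STFT_def)
  have double: "(\<integral>\<^sup>+x. ennreal (LINT t|lborel. (cmod (f t * cnj (\<phi> (t - x))))^2) \<partial>lborel) = ennreal ((L2_norm f)^2)"
  proof -
    have "(\<integral>\<^sup>+x. ennreal (LINT t|lborel. (cmod (f t * cnj (\<phi> (t - x))))^2) \<partial>lborel)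
      = (\<integral>\<^sup>+x. (\<integral>\<^sup>+t. ennreal ((cmod (f t * cnj (\<phi> (t - x))))^2) \<partial>lborel) \<partial>lborel)"
      by (intro nn_integral_cong nn_integral_eq_integral[symmetric] g2) auto
    also have "\<dots> = (\<integral>\<^sup>+t. (\<integral>\<^sup>+x. ennreal ((cmod (f t * cnj (\<phi> (t - x))))^2) \<partial>lborel) \<partial>lborel)"
      by (rule lborel_pair.Fubini') measurable
    also have "\<dots> = (\<integral>\<^sup>+t. ennreal ((cmod (f t))^2) \<partial>lborel)"
    proof (intro nn_integral_cong)
      fix t
      have "(\<integral>\<^sup>+x. ennreal ((cmod (\<phi> (t - x)))^2) \<partial>lborel) = (\<integral>\<^sup>+x. ennreal ((cmod (\<phi> x))^2) \<partial>lborel)"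
        using nn_integral_real_affine[of "\<lambda>x. ennreal ((cmod (\<phi> x))^2)" "-1" t] by simp
      also have "\<dots> = ennreal ((L2_norm \<phi>)^2)"
        unfolding L2_norm_sq using L2_integrable[OF L2_window] by (intro nn_integral_eq_integral) auto
      finally have 1: "(\<integral>\<^sup>+x. ennreal ((cmod (\<phi> (t - x)))^2) \<partial>lborel) = 1" using norm_window by simp
      have "(\<integral>\<^sup>+x. ennreal ((cmod (f t * cnj (\<phi> (t - x))))^2) \<partial>lborel) = (\<integral>\<^sup>+x. ennreal ((cmod (f t))^2) * ennreal ((cmod (\<phi> (t - x)))^2) \<partial>lborel)"
        by (simp add: norm_mult power_mult_distrib ennreal_mult')
      also have "\<dots> = ennreal ((cmod (f t))^2) * 1" unfolding 1[symmetric] by (rule nn_integral_cmult) measurable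
      finally show "(\<integral>\<^sup>+x. ennreal ((cmod (f t * cnj (\<phi> (t - x))))^2) \<partial>lborel) = ennreal ((cmod (f t))^2)" by simp
    qed
    also have "\<dots> = ennreal ((L2_norm f)^2)"
      unfolding L2_norm_sq using L2_integrable[OF f] by (intro nn_integral_eq_integral) auto
    finally show ?thesis .
  qed
  have main: "(LINT z:\<Omega>|lborel. (cmod (V f z))^2) \<le> exp (pi * \<sigma> * R^2) * (L2_norm f)^2" if \<sigma>: "\<sigma> > 0" for \<sigma>
  proof -
    let ?E = "exp (pi * \<sigma> * R^2)"
    have "ennreal (LINT z:\<Omega>|lborel. (cmod (V f z))^2) = (\<integral>\<^sup>+z. ennreal (indicator \<Omega> z *\<^sub>R (cmod (V f z))^2) \<partial>(lborel \<Otimes>\<^sub>M lborel))"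
      unfolding set_lebesgue_integral_def lborel_prod using si by (intro nn_integral_eq_integral[symmetric]) auto
    also have "\<dots> = (\<integral>\<^sup>+x. (\<integral>\<^sup>+w. ennreal (indicator \<Omega> (x, w) *\<^sub>R (cmod (V f (x, w)))^2) \<partial>lborel) \<partial>lborel)"
      using si by (intro lborel.nn_integral_fst[symmetric]) (simp add: lborel_prod)
    also have "\<dots> \<le> (\<integral>\<^sup>+x. ennreal (?E * (LINT t|lborel. (cmod (f t * cnj (\<phi> (t - x))))^2)) \<partial>lborel)"
    proof (rule nn_integral_mono)
      fix x
      note P = gaussian_Plancherel_bound[OF g1[of x] g2[of x] \<sigma>, folded Vft]
      have "(\<integral>\<^sup>+w. ennreal (indicator \<Omega> (x, w) *\<^sub>R (cmod (V f (x, w)))^2) \<partial>lborel)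
        \<le> (\<integral>\<^sup>+w. ennreal (?E * ((cmod (V f (x, w)))^2 * exp (- (pi * \<sigma> * w^2)))) \<partial>lborel)"
      proof (intro nn_integral_mono ennreal_leI)
        fix w
        show "indicator \<Omega> (x, w) *\<^sub>R (cmod (V f (x, w)))^2 \<le> ?E * ((cmod (V f (x, w)))^2 * exp (- (pi * \<sigma> * w^2)))"
        proof (cases "(x, w) \<in> \<Omega>")
          case True
          then have "\<bar>w\<bar> \<le> R" using R'[of "(x, w)"] by simp
          then have "w^2 \<le> R^2" using abs_le_square_iff[of w R] R(1) by simp
          then have "pi * \<sigma> * w^2 \<le> pi * \<sigma> * R^2" using \<sigma> by (intro mult_left_mono) auto
          then have "1 \<le> ?E * exp (- (pi * \<sigma> * w^2))" by (simp flip: exp_add)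
          from mult_left_mono[OF this, of "(cmod (V f (x, w)))^2"] True show ?thesis by (simp add: mult_ac)
        qed simp
      qed
      also have "\<dots> = ennreal (LINT w|lborel. ?E * ((cmod (V f (x, w)))^2 * exp (- (pi * \<sigma> * w^2))))"
        using P(1) by (intro nn_integral_eq_integral) auto
      also have "\<dots> \<le> ennreal (?E * (LINT t|lborel. (cmod (f t * cnj (\<phi> (t - x))))^2))"
        using P(2) by (intro ennreal_leI) (simp add: mult_left_mono)
      finally show "(\<integral>\<^sup>+w. ennreal (indicator \<Omega> (x, w) *\<^sub>R (cmod (V f (x, w)))^2) \<partial>lborel) \<le> \<dots>" .
    qed
    also have "\<dots> = (\<integral>\<^sup>+x. ennreal ?E * ennreal (LINT t|lborel. (cmod (f t * cnj (\<phi> (t - x))))^2) \<partial>lborel)"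
      by (simp add: ennreal_mult')
    also have "\<dots> = ennreal ?E * ennreal ((L2_norm f)^2)"
      unfolding double[symmetric] by (rule nn_integral_cmult) measurable
    also have "\<dots> = ennreal (?E * (L2_norm f)^2)" by (simp add: ennreal_mult')
    finally show ?thesis by (simp add: ennreal_le_iff)
  qed
  show ?thesis
  proof (rule LIMSEQ_le_const)
    have "(\<lambda>n. exp (pi * (1 / real (Suc n)) * R^2) * (L2_norm f)^2) \<longlonglongrightarrow> exp (pi * 0 * R^2) * (L2_norm f)^2"
      by (intro tendsto_intros LIMSEQ_Suc[OF lim_1_over_n])
    then show "(\<lambda>n. exp (pi * (1 / real (Suc n)) * R^2) * (L2_norm f)^2) \<longlonglongrightarrow> (L2_norm f)^2" by simp
    show "\<exists>N. \<forall>n\<ge>N. (LINT z:\<Omega>|lborel. (cmod (V f z))^2) \<le> exp (pi * (1 / real (Suc n)) * R^2) * (L2_norm f)^2"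
      by (intro exI allI impI main) simp
  qed
qed

end

lemma L2_inner_cong_AE:
  assumes "L2 f" "L2 f'" "L2 g" "AE t in lborel. f t = f' t"
  shows "L2_inner f g = L2_inner f' g"
proof -
  have [measurable]: "f \<in> borel_measurable borel" "f' \<in> borel_measurable borel" "g \<in> borel_measurable borel" using assms by auto
  show ?thesis unfolding L2_inner_def by (intro integral_cong_AE) (use assms(4) in auto)
qed

section \<open>The localization operator on a compact set and its eigenfunctions\<close>

locale window_domain = window +
  fixes \<Omega> :: "(real \<times> real) set"
  assumes compact_\<Omega>: "compact \<Omega>"
begin

definition res :: "(real \<Rightarrow> complex) \<Rightarrow> real \<times> real \<Rightarrow> complex" where
  "res f z = indicator \<Omega> z *\<^sub>R V f z"

definition H :: "(real \<Rightarrow> complex) \<Rightarrow> real \<Rightarrow> complex" where "H f = syn (res f)"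

definition q :: "(real \<Rightarrow> complex) \<Rightarrow> real" where "q f = (LINT z:\<Omega>|lborel. (cmod (V f z))^2)"

lemma \<Omega>_sets [measurable]: "\<Omega> \<in> sets borel"
  using compact_\<Omega> by (simp add: compact_imp_closed)

lemma loc_op_eq_H: "loc_op \<Omega> \<phi> f = H f"
  by (rule ext) (simp add: loc_op_def H_def syn_def res_def set_lebesgue_integral_def)

lemma integrable_on_\<Omega>:
  fixes F :: "real \<times> real \<Rightarrow> 'b :: {banach, second_countable_topology}"
  assumes "continuous_on \<Omega> F"
  shows "integrable lborel (\<lambda>z. indicator \<Omega> z *\<^sub>R F z)"
  by (rule borel_integrable_compact[OF compact_\<Omega> assms])

lemma res_integrable: "L2 f \<Longrightarrow> integrable lborel (res f)"
  unfolding res_def[abs_def] by (intro integrable_on_\<Omega> V_continuous)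

lemma L2_H: "L2 f \<Longrightarrow> L2 (H f)"
  unfolding H_def by (intro syn_L2 res_integrable)

lemma H_inner: "L2 f \<Longrightarrow> L2 g \<Longrightarrow> L2_inner (H f) g = (LINT z:\<Omega>|lborel. V f z * cnj (V g z))"
  unfolding H_def by (subst syn_adjoint) (simp_all add: res_integrable res_def set_lebesgue_integral_def)

lemma H_self: "L2 f \<Longrightarrow> L2_inner (H f) f = of_real (q f)"
proof -
  assume f: "L2 f"
  have "V f z * cnj (V f z) = complex_of_real ((cmod (V f z))^2)" for z
    by (metis complex_norm_square of_real_power)
  then show ?thesis unfolding H_inner[OF f f] q_def by (simp only: set_integral_complex_of_real)
qed

lemma H_sym: "L2 f \<Longrightarrow> L2 g \<Longrightarrow> L2_inner (H f) g = cnj (L2_inner (H g) f)"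
  unfolding H_inner set_lebesgue_integral_def
  by (subst Bochner_Integration.integral_cnj[symmetric]) (simp add: mult.commute)

lemma res_sq: "(cmod (res f z))^2 = indicator \<Omega> z *\<^sub>R (cmod (V f z))^2"
  by (simp add: res_def indicator_def)

lemma res_sq_integrable: "L2 f \<Longrightarrow> integrable lborel (\<lambda>z. (cmod (res f z))^2)"
  unfolding res_sq by (intro integrable_on_\<Omega> continuous_intros V_continuous)

lemma q_res: "q f = (LINT z|lborel. (cmod (res f z))^2)"
  unfolding res_sq q_def set_lebesgue_integral_def ..

lemma q_nonneg: "0 \<le> q f"
  unfolding q_res by (simp add: integral_nonneg)

lemma q_le: "L2 f \<Longrightarrow> q f \<le> (L2_norm f)^2"
  unfolding q_def by (rule V_energy_bound[OF compact_\<Omega>])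

lemma V_scale: "V (\<lambda>t. c * f t) z = c * V f z"
  by (simp add: STFT_eq_inner L2_inner_scale_left)

lemma V_add: "L2 f \<Longrightarrow> L2 g \<Longrightarrow> V (\<lambda>t. f t + g t) z = V f z + V g z"
  by (simp add: STFT_eq_inner L2_inner_add_left L2_shift)

lemma q_scale: "q (\<lambda>t. c * f t) = (cmod c)^2 * q f"
  unfolding q_def V_scale by (simp add: norm_mult power_mult_distrib)

lemma H_scale: "H (\<lambda>t. c * f t) t = c * H f t"
proof -
  have "H (\<lambda>t. c * f t) t = (LINT z|lborel. c * (res f z * shift z t))"
    unfolding H_def syn_def by (intro Bochner_Integration.integral_cong refl) (simp add: res_def V_scale)
  then show ?thesis by (simp add: H_def syn_def)
qed

text \<open>Cauchy-Schwarz for the positive form of \<open>H\<close>. Compared with the L^2 version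
  it keeps the energy \<open>q f\<close> in the bound, which is what makes a maximizing sequence
  asymptotically an eigenfunction.\<close>

lemma H_Cauchy_Schwarz:
  assumes f: "L2 f" and g: "L2 g"
  shows "(cmod (L2_inner (H f) g))^2 \<le> q f * q g"
proof -
  have m: "res f \<in> borel_measurable lborel" "res g \<in> borel_measurable lborel"
    using res_integrable[OF f] res_integrable[OF g] by auto
  have "V f z * cnj (V g z) * indicator \<Omega> z = res f z * cnj (res g z)" for z
    by (simp add: res_def indicator_def)
  then have "L2_inner (H f) g = (LINT z|lborel. res f z * cnj (res g z))"
    unfolding H_inner[OF f g] set_lebesgue_integral_def
    by (intro Bochner_Integration.integral_cong refl) (simp add: res_def indicator_def)
  then have "cmod (L2_inner (H f) g) \<le> (LINT z|lborel. cmod (res f z * cnj (res g z)))" by simp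
  then have "(cmod (L2_inner (H f) g))^2 \<le> (LINT z|lborel. cmod (res f z) * cmod (res g z))^2"
    by (intro power_mono) (auto simp: norm_mult)
  also have "\<dots> \<le> q f * q g"
    unfolding q_res by (rule square_integrable_mult(2)[OF m res_sq_integrable[OF f] res_sq_integrable[OF g]])
  finally show ?thesis .
qed

definition orth :: "(real \<Rightarrow> complex) set \<Rightarrow> (real \<Rightarrow> complex) set" where
  "orth E = {f. L2 f \<and> (\<forall>e\<in>E. L2_inner f e = 0)}"

definition eigfun :: "(real \<Rightarrow> complex) \<Rightarrow> bool" where
  "eigfun e \<longleftrightarrow> L2 e \<and> (\<exists>\<mu>::real. AE t in lborel. H e t = of_real \<mu> * e t)"

lemma H_orth:
  assumes E: "\<And>e. e \<in> E \<Longrightarrow> eigfun e" and f: "f \<in> orth E"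
  shows "H f \<in> orth E"
proof -
  have L: "L2 f" using f by (simp add: orth_def)
  have "L2_inner (H f) e = 0" if e: "e \<in> E" for e
  proof -
    from E[OF e] obtain \<mu> :: real where \<mu>: "L2 e" "AE t in lborel. H e t = of_real \<mu> * e t" by (auto simp: eigfun_def)
    have "L2_inner (H e) f = of_real \<mu> * L2_inner e f"
      using L2_inner_cong_AE[OF L2_H[OF \<mu>(1)] L2_scale[OF \<mu>(1)] L \<mu>(2)] by (simp add: L2_inner_scale_left)
    also have "L2_inner e f = cnj (L2_inner f e)" by (simp add: L2_inner_cnj)
    also have "L2_inner f e = 0" using f e by (simp add: orth_def)
    finally show ?thesis unfolding H_sym[OF L \<mu>(1)] by simp
  qed
  then show ?thesis using L2_H[OF L] by (simp add: orth_def)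
qed

text \<open>Compactness enters only through the Arzela--Ascoli theorem for the transforms \<open>V (f n)\<close>
  of a maximizing sequence: their uniform limit \<open>F\<close> on \<open>\<Omega>\<close> yields the maximizer \<open>syn F\<close>.\<close>
lemma eigfun_of_large_energy:
  assumes E: "\<And>e. e \<in> E \<Longrightarrow> eigfun e" and f0: "f0 \<in> orth E" and c: "0 \<le> c" "c * (L2_norm f0)^2 < q f0"
  obtains g M where "g \<in> orth E" "c < M" "L2_norm g = 1" "\<And>t. H g t = of_real M * g t"
proof -
  let ?X = "orth E"
  have XL: "L2 f" if "f \<in> ?X" for f using that by (simp add: orth_def)
  have Xs: "(\<lambda>t. c * f t) \<in> ?X" if "f \<in> ?X" for f and c :: complex
    using that by (simp add: orth_def L2_scale L2_inner_scale_left)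
  define A where "A = q ` {f \<in> ?X. L2_norm f = 1}"
  have unit: "(\<lambda>t. of_real (1 / L2_norm f) * f t) \<in> {f \<in> ?X. L2_norm f = 1}" if "f \<in> ?X" "L2_norm f \<noteq> 0" for f
  proof -
    have "L2_norm (\<lambda>t. of_real (1 / L2_norm f) * f t) = 1"
      unfolding L2_norm_scale norm_of_real using that L2_norm_nonneg[of f] by simp
    then show ?thesis using Xs[OF that(1)] by blast
  qed
  have qu: "q (\<lambda>t. of_real (1 / L2_norm f) * f t) = q f / (L2_norm f)^2" for f
    unfolding q_scale norm_of_real by (simp add: power_divide)
  have n0: "L2_norm f0 \<noteq> 0" using c q_le[OF XL[OF f0]] by auto
  have bdd: "bdd_above A" unfolding A_def by (rule bdd_aboveI2[of _ _ 1]) (use q_le XL in fastforce)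
  have q0: "q f0 / (L2_norm f0)^2 \<in> A" unfolding A_def using unit[OF f0 n0] qu[of f0] by (metis (no_types, lifting) imageI)
  define M where "M = Sup A"
  have "c < q f0 / (L2_norm f0)^2" using c n0 by (simp add: field_simps)
  also have "\<dots> \<le> M" unfolding M_def by (rule cSup_upper[OF q0 bdd])
  finally have cM: "c < M" .
  have M0: "0 < M" using c cM by simp
  have qM: "q f \<le> M * (L2_norm f)^2" if "f \<in> ?X" for f
  proof (cases "L2_norm f = 0")
    case True
    then show ?thesis using q_le[OF XL[OF that]] by simp
  next
    case False
    have "q f / (L2_norm f)^2 \<in> A" unfolding A_def using unit[OF that False] qu[of f] by (metis (no_types, lifting) imageI)
    then have "q f / (L2_norm f)^2 \<le> M" unfolding M_def by (rule cSup_upper[OF _ bdd])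
    then show ?thesis using False by (simp add: field_simps)
  qed
  have "\<exists>f. f \<in> ?X \<and> L2_norm f = 1 \<and> M - 1 / real (Suc n) < q f" for n
  proof -
    have "M - 1 / real (Suc n) < Sup A" unfolding M_def by simp
    then obtain a where "a \<in> A" "M - 1 / real (Suc n) < a" using q0 less_cSup_iff[OF _ bdd] by blast
    then show ?thesis unfolding A_def by blast
  qed
  then obtain f where f: "\<And>n. f n \<in> ?X" "\<And>n. L2_norm (f n) = 1" "\<And>n. M - 1 / real (Suc n) < q (f n)" by metis
  have fL: "L2 (f n)" for n by (rule XL[OF f(1)])
  have HfL: "L2 (H (f n))" for n by (rule L2_H[OF fL])
  \<comment> \<open>The form inequality with second argument \<open>H h\<close>, which stays in the
    complement, where \<open>q\<close> is at most \<open>M\<close> times the squared norm; one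
    factor is cancelled.\<close>
  have Hn: "(L2_norm (H h))^2 \<le> M * q h" if "h \<in> ?X" for h
  proof (cases "L2_norm (H h) = 0")
    case False
    have "((L2_norm (H h))^2)^2 = (cmod (L2_inner (H h) (H h)))^2" by (simp add: L2_inner_self norm_power)
    also have "\<dots> \<le> q h * q (H h)" by (rule H_Cauchy_Schwarz[OF XL[OF that] L2_H[OF XL[OF that]]])
    also have "\<dots> \<le> q h * (M * (L2_norm (H h))^2)" by (intro mult_left_mono qM H_orth[OF E that] q_nonneg)
    finally have "(L2_norm (H h))^2 * (L2_norm (H h))^2 \<le> (M * q h) * (L2_norm (H h))^2" by (simp add: power2_eq_square mult_ac)
    then show ?thesis by (rule mult_right_le_imp_le) (use False in simp)
  qed (use M0 q_nonneg in simp)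
  \<comment> \<open>Expanding the square gives at most \<open>M * (M - q (f n))\<close>: a nearly
    maximal energy makes \<open>f n\<close> nearly an eigenfunction for \<open>M\<close>.\<close>
  have dn: "(L2_norm (\<lambda>t. H (f n) t - of_real M * f n t))^2 \<le> M / real (Suc n)" for n
  proof -
    have "(L2_norm (\<lambda>t. H (f n) t - of_real M * f n t))^2 = (L2_norm (H (f n)))^2 - 2 * (M * q (f n)) + M^2"
      by (subst L2_norm_diff_sq[OF HfL L2_scale[OF fL]])
        (use M0 in \<open>simp add: L2_inner_scale_right H_self[OF fL] L2_norm_scale f(2)\<close>)
    also have "\<dots> \<le> M * q (f n) - 2 * (M * q (f n)) + M^2" using Hn[OF f(1)] by simp
    also have "\<dots> = M * (M - q (f n))" by (simp add: power2_eq_square algebra_simps)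
    also have "\<dots> \<le> M * (1 / real (Suc n))" using f(3)[of n] M0 by (intro mult_left_mono) linarith+
    finally show ?thesis by simp
  qed
  obtain F k where Fc: "continuous_on \<Omega> F" and k: "strict_mono (k :: nat \<Rightarrow> nat)"
    and Fu: "\<And>e. 0 < e \<Longrightarrow> \<exists>N. \<forall>n z. n \<ge> N \<and> z \<in> \<Omega> \<longrightarrow> norm (V (f (k n)) z - F z) < e"
  proof (rule Arzela_Ascoli[OF compact_\<Omega>, of "\<lambda>n. V (f n)" 1])
    show "norm (V (f n) z) \<le> 1" for n z using V_bound[OF fL, of n z] f(2) by simp
    fix z and e :: real assume "0 < e"
    from V_equicontinuous[OF this, of 1 z] obtain d where
      "0 < d" "\<And>f z'. L2 f \<Longrightarrow> L2_norm f \<le> 1 \<Longrightarrow> norm (z - z') < d \<Longrightarrow> cmod (V f z - V f z') < e" by blast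
    then show "\<exists>d>0. \<forall>n y. y \<in> \<Omega> \<and> norm (z - y) < d \<longrightarrow> norm (V (f n) z - V (f n) y) < e"
      using fL f(2) by (intro exI[of _ d]) simp
  qed blast
  define G where "G z = indicator \<Omega> z *\<^sub>R F z" for z
  have Gi: "integrable lborel G" unfolding G_def[abs_def] by (rule integrable_on_\<Omega>[OF Fc])
  \<comment> \<open>The weak limit of \<open>H (f (k n))\<close>. It is reached through the L^1
    convergence of the localized transforms.\<close>
  define g where "g = syn G"
  have gL: "L2 g" unfolding g_def by (rule syn_L2[OF Gi])
  have fin: "emeasure lborel \<Omega> < \<infinity>" using compact_\<Omega> by (rule emeasure_compact_finite)
  define m where "m = measure lborel \<Omega>"
  have m0: "0 \<le> m" by (simp add: m_def)
  have lim0: "(\<lambda>n. LINT z|lborel. cmod (res (f (k n)) z - G z)) \<longlonglongrightarrow> 0"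
  proof (rule LIMSEQ_I)
    fix r :: real assume r: "0 < r"
    have "0 < r / (m + 1)" using r m0 by (intro divide_pos_pos) linarith+
    from Fu[OF this] obtain N where N: "\<And>n z. n \<ge> N \<Longrightarrow> z \<in> \<Omega> \<Longrightarrow> norm (V (f (k n)) z - F z) < r / (m + 1)" by blast
    have "norm ((LINT z|lborel. cmod (res (f (k n)) z - G z)) - 0) < r" if "n \<ge> N" for n
    proof -
      have "(LINT z|lborel. cmod (res (f (k n)) z - G z)) \<le> (LINT z|lborel. indicator \<Omega> z * (r / (m + 1)))"
      proof (rule integral_mono)
        show "integrable lborel (\<lambda>z. cmod (res (f (k n)) z - G z))"
          by (intro integrable_norm Bochner_Integration.integrable_diff res_integrable fL Gi)
        show "integrable lborel (\<lambda>z. indicator \<Omega> z * (r / (m + 1)))" using fin by simp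
        show "cmod (res (f (k n)) z - G z) \<le> indicator \<Omega> z * (r / (m + 1))" for z
          using N[OF that, of z] by (cases "z \<in> \<Omega>") (auto simp: res_def G_def)
      qed
      also have "\<dots> = m * (r / (m + 1))" using fin by (simp add: m_def)
      also have "\<dots> < r" using r m0 by (simp add: field_simps)
      finally show ?thesis by (simp add: integral_nonneg)
    qed
    then show "\<exists>no. \<forall>n\<ge>no. norm ((LINT z|lborel. cmod (res (f (k n)) z - G z)) - 0) < r" by blast
  qed
  have weak: "(\<lambda>n. L2_inner (H (f (k n))) h) \<longlonglongrightarrow> L2_inner g h" if h: "L2 h" for h
  proof (rule LIM_zero_cancel, rule Lim_null_comparison)
    show "(\<lambda>n. L2_norm h * (LINT z|lborel. cmod (res (f (k n)) z - G z))) \<longlonglongrightarrow> 0"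
      using tendsto_mult_right_zero[OF lim0] .
    show "\<forall>\<^sub>F n in sequentially. norm (L2_inner (H (f (k n))) h - L2_inner g h) \<le> L2_norm h * (LINT z|lborel. cmod (res (f (k n)) z - G z))"
    proof (rule always_eventually, rule allI)
      fix n
      have bi: "integrable lborel (\<lambda>z. K z * cnj (V h z))" if K: "integrable lborel K" for K :: "real \<times> real \<Rightarrow> complex"
      proof (rule Bochner_Integration.integrable_bound[of _ "\<lambda>z. L2_norm h * cmod (K z)"])
        show "(\<lambda>z. K z * cnj (V h z)) \<in> borel_measurable lborel"
          using K measurable_compose[OF V_measurable[OF h] measurable_cnj] by (intro borel_measurable_times) auto
        show "AE z in lborel. cmod (K z * cnj (V h z)) \<le> norm (L2_norm h * cmod (K z))"
          using V_bound[OF h] by (intro AE_I2) (simp add: norm_mult abs_mult L2_norm_nonneg mult.commute[of "L2_norm h"] mult_left_mono)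
      qed (use K in simp)
      have D: "integrable lborel (\<lambda>z. res (f (k n)) z - G z)"
        by (intro Bochner_Integration.integrable_diff res_integrable fL Gi)
      have "L2_inner (H (f (k n))) h - L2_inner g h = (LINT z|lborel. (res (f (k n)) z - G z) * cnj (V h z))"
        unfolding H_def g_def syn_adjoint[OF res_integrable[OF fL] h] syn_adjoint[OF Gi h] left_diff_distrib
        by (rule Bochner_Integration.integral_diff[symmetric]) (intro bi res_integrable fL Gi)+
      then have "cmod (L2_inner (H (f (k n))) h - L2_inner g h) \<le> (LINT z|lborel. cmod ((res (f (k n)) z - G z) * cnj (V h z)))" by simp
      also have "\<dots> \<le> (LINT z|lborel. L2_norm h * cmod (res (f (k n)) z - G z))"
        using V_bound[OF h] D by (intro integral_mono integrable_norm bi)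
          (auto simp: norm_mult mult.commute[of "L2_norm h"] intro!: mult_left_mono)
      finally show "norm (L2_inner (H (f (k n))) h - L2_inner g h) \<le> L2_norm h * (LINT z|lborel. cmod (res (f (k n)) z - G z))" by simp
    qed
  qed
  have gX: "g \<in> ?X"
  proof -
    have "L2_inner g e = 0" if e: "e \<in> E" for e
    proof -
      have eL: "L2 e" using E[OF e] by (simp add: eigfun_def)
      have "L2_inner (H (f n)) e = 0" for n using H_orth[OF E f(1)] e by (simp add: orth_def)
      then show ?thesis using weak[OF eL] by (simp add: LIMSEQ_const_iff)
    qed
    then show ?thesis using gL by (simp add: orth_def)
  qed
  have inv0: "(\<lambda>n. 1 / real (Suc (k n))) \<longlonglongrightarrow> 0"
    using LIMSEQ_subseq_LIMSEQ[OF LIMSEQ_Suc[OF lim_1_over_n] k] by (simp add: o_def)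
  \<comment> \<open>Testing the weak convergence against the shifted window recovers the transform
    pointwise. By \<open>dn\<close> the limit is \<open>M\<close> times the limit of the transforms
    of \<open>f (k n)\<close>; substituting this into \<open>H g\<close> gives the eigenvalue
    equation.\<close>
  have Vg: "V g z = of_real M * F z" if z: "z \<in> \<Omega>" for z
  proof -
    have "(\<lambda>n. V (f (k n)) z) \<longlonglongrightarrow> F z"
    proof (rule LIMSEQ_I)
      fix e :: real assume "0 < e"
      from Fu[OF this] z show "\<exists>no. \<forall>n\<ge>no. norm (V (f (k n)) z - F z) < e" by blast
    qed
    then have 1: "(\<lambda>n. of_real M * V (f (k n)) z) \<longlonglongrightarrow> of_real M * F z" by (intro tendsto_intros)
    have "(\<lambda>n. L2_inner (H (f (k n))) (shift z) - of_real M * V (f (k n)) z) \<longlonglongrightarrow> 0"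
    proof (rule Lim_null_comparison)
      show "(\<lambda>n. sqrt (M * (1 / real (Suc (k n))))) \<longlonglongrightarrow> 0"
        using tendsto_real_sqrt[OF tendsto_mult_right_zero[OF inv0, of M]] by simp
      show "\<forall>\<^sub>F n in sequentially. norm (L2_inner (H (f (k n))) (shift z) - of_real M * V (f (k n)) z) \<le> sqrt (M * (1 / real (Suc (k n))))"
      proof (rule always_eventually, rule allI)
        fix n
        have "L2_inner (H (f (k n))) (shift z) - of_real M * V (f (k n)) z = L2_inner (\<lambda>t. H (f (k n)) t - of_real M * f (k n) t) (shift z)"
          unfolding STFT_eq_inner by (subst L2_inner_diff_left[OF HfL L2_scale[OF fL] L2_shift]) (simp add: L2_inner_scale_left)
        also have "cmod \<dots> \<le> L2_norm (\<lambda>t. H (f (k n)) t - of_real M * f (k n) t)"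
          using L2_Cauchy_Schwarz[OF L2_diff[OF HfL L2_scale[OF fL]] L2_shift] by (simp add: norm_shift)
        also have "\<dots> \<le> sqrt (M * (1 / real (Suc (k n))))" using dn[of "k n"] by (intro real_le_rsqrt) simp
        finally show "norm (L2_inner (H (f (k n))) (shift z) - of_real M * V (f (k n)) z) \<le> sqrt (M * (1 / real (Suc (k n))))" .
      qed
    qed
    from tendsto_add[OF this 1] have "(\<lambda>n. L2_inner (H (f (k n))) (shift z)) \<longlonglongrightarrow> of_real M * F z" by simp
    with weak[OF L2_shift] show ?thesis unfolding STFT_eq_inner by (rule LIMSEQ_unique)
  qed
  have Hg: "H g t = of_real M * g t" for t
  proof -
    have "res g z = of_real M * G z" for z by (cases "z \<in> \<Omega>") (auto simp: res_def G_def Vg)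
    then have "H g t = (LINT z|lborel. of_real M * (G z * shift z t))" unfolding H_def syn_def by (simp add: mult.assoc)
    then show ?thesis by (simp add: g_def syn_def)
  qed
  have gn: "L2_norm g \<noteq> 0"
  proof
    assume "L2_norm g = 0"
    then have "V g z = 0" for z using V_bound[OF gL, of z] by simp
    then have F0: "F z = 0" if "z \<in> \<Omega>" for z using Vg[OF that] M0 by simp
    \<comment> \<open>If \<open>g\<close> had norm 0, then \<open>F\<close> would vanish on
      \<open>\<Omega>\<close> and the energies would eventually be at most
      \<open>m * e^2 \<le> M / 2\<close>, while they exceed \<open>M - M / 2\<close> along the
      sequence. The summand 1 avoids division by a vanishing measure.\<close>
    define e where "e = sqrt (M / (2 * (m + 1)))"
    have e: "0 < e" "e^2 = M / (2 * (m + 1))" unfolding e_def using M0 m0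
      by (auto intro!: divide_pos_pos simp: divide_nonneg_nonneg)
    from Fu[OF e(1)] obtain N1 where N1: "\<And>n z. n \<ge> N1 \<Longrightarrow> z \<in> \<Omega> \<Longrightarrow> norm (V (f (k n)) z - F z) < e" by blast
    from LIMSEQ_D[OF inv0, of "M / 2"] M0 obtain N2 where N2: "\<And>n. n \<ge> N2 \<Longrightarrow> 1 / real (Suc (k n)) < M / 2" by auto
    define n where "n = max N1 N2"
    have "q (f (k n)) \<le> (LINT z|lborel. indicator \<Omega> z * e^2)"
      unfolding q_res
    proof (rule integral_mono[OF res_sq_integrable[OF fL]])
      show "integrable lborel (\<lambda>z. indicator \<Omega> z * e^2)" using fin by simp
      show "(cmod (res (f (k n)) z))^2 \<le> indicator \<Omega> z * e^2" for z
      proof (cases "z \<in> \<Omega>")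
        case True
        then have "cmod (V (f (k n)) z) \<le> e" using N1[of n z] F0 by (simp add: n_def)
        then show ?thesis using True by (simp add: res_def power_mono)
      qed (simp add: res_def)
    qed
    also have "\<dots> = m * (M / (2 * (m + 1)))" using fin by (simp add: e(2) m_def)
    also have "\<dots> \<le> M / 2" using M0 m0 by (simp add: field_simps)
    finally show False using f(3)[of "k n"] N2[of n] by (simp add: n_def)
  qed
  let ?g = "\<lambda>t. of_real (1 / L2_norm g) * g t"
  have "?g \<in> ?X" "L2_norm ?g = 1" using unit[OF gX gn] by auto
  moreover have "H ?g t = of_real M * ?g t" for t unfolding H_scale Hg by (simp only: mult_ac)
  ultimately show ?thesis using that cM by blast
qed

lemma eigfun_inner:
  fixes \<mu> :: real
  assumes e: "L2 e" "AE t in lborel. H e t = of_real \<mu> * e t" and g: "L2 g"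
  shows "L2_inner (H e) g = of_real \<mu> * L2_inner e g"
  using L2_inner_cong_AE[OF L2_H[OF e(1)] L2_scale[OF e(1)] g e(2)] by (simp add: L2_inner_scale_left)

lemma eigfun_orthogonal:
  fixes \<mu> \<nu> :: real
  assumes e: "L2 e" "AE t in lborel. H e t = of_real \<mu> * e t"
    and e': "L2 e'" "AE t in lborel. H e' t = of_real \<nu> * e' t" and "\<mu> \<noteq> \<nu>"
  shows "L2_inner e e' = 0"
proof -
  have "of_real \<mu> * L2_inner e e' = cnj (of_real \<nu> * L2_inner e' e)"
    unfolding eigfun_inner[OF e e'(1), symmetric] eigfun_inner[OF e' e(1), symmetric] by (rule H_sym[OF e(1) e'(1)])
  also have "\<dots> = of_real \<nu> * L2_inner e e'" by (simp add: L2_inner_cnj)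
  finally show ?thesis using \<open>\<mu> \<noteq> \<nu>\<close> by simp
qed

text \<open>An energy above \<open>1/2\<close> on the orthogonal complement would produce a further eigenfunction with
  eigenvalue \<open>M > 1/2\<close>, contradicting the multiplicity of \<open>M\<close> in \<open>\<alpha>\<close>.\<close>
theorem eigen_split:
  assumes eigs: "eigenvalue_seq \<Omega> \<phi> \<alpha>" and \<alpha>: "1/2 \<le> \<alpha> N" "\<alpha> (Suc N) \<le> 1/2"
  obtains e where "\<And>k. k \<in> {1..N} \<Longrightarrow> L2 (e k)"
    "\<And>k. k \<in> {1..N} \<Longrightarrow> AE t in lborel. H (e k) t = of_real (\<alpha> k) * e k t"
    "\<And>i j. i \<in> {1..N} \<Longrightarrow> j \<in> {1..N} \<Longrightarrow> L2_inner (e i) (e j) = (if i = j then 1 else 0)"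
    "\<And>k. k \<in> {1..N} \<Longrightarrow> 1/2 \<le> \<alpha> k"
    "\<And>f. f \<in> orth (e ` {1..N}) \<Longrightarrow> q f \<le> 1/2 * (L2_norm f)^2"
proof -
  define K where "K \<mu> = {k. k \<ge> 1 \<and> \<alpha> k = \<mu>}" for \<mu>
  have dec: "\<alpha> j \<le> \<alpha> i" if "1 \<le> i" "i \<le> j" for i j
    using that(2,1)
  proof (induction j rule: dec_induct)
    case (step j)
    then have "\<alpha> (Suc j) \<le> \<alpha> j" using eigs by (auto simp: eigenvalue_seq_def)
    then show ?case using step by simp
  qed simp
  have mult: "finite (K \<mu>)" "eig_mult \<Omega> \<phi> \<mu> (card (K \<mu>))" if "\<mu> > 0" for \<mu>
    using eigs that by (auto simp: eigenvalue_seq_def K_def)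
  \<comment> \<open>For one eigenvalue: an orthonormal family of full multiplicity, and a bijection
    from the indices carrying this eigenvalue to the members of the family. Families are chosen for
    all \<open>\<mu> > 0\<close> at once, so that \<open>e\<close> can look them up by
    \<open>\<alpha> k\<close>.\<close>
  define Q where "Q \<mu> d h \<longleftrightarrow> (\<forall>i<card (K \<mu>). L2 (d i) \<and> (AE t in lborel. H (d i) t = of_real \<mu> * d i t)) \<and>
      (\<forall>i<card (K \<mu>). \<forall>j<card (K \<mu>). L2_inner (d i) (d j) = (if i = j then 1 else 0)) \<and> bij_betw h (K \<mu>) {0..<card (K \<mu>)}"
    for \<mu> :: real and d :: "nat \<Rightarrow> real \<Rightarrow> complex" and h
  have "\<forall>\<mu>. \<exists>p. \<mu> > 0 \<longrightarrow> Q \<mu> (fst p) (snd p)"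
  proof (intro allI)
    fix \<mu> :: real
    have "\<exists>d h. Q \<mu> d h" if "\<mu> > 0"
      using mult(2)[OF that] ex_bij_betw_finite_nat[OF mult(1)[OF that]]
      unfolding eig_mult_def eig_family_def loc_op_eq_H Q_def by blast
    then show "\<exists>p. \<mu> > 0 \<longrightarrow> Q \<mu> (fst p) (snd p)" by auto
  qed
  then obtain p where p: "\<forall>\<mu>. \<mu> > 0 \<longrightarrow> Q \<mu> (fst (p \<mu>)) (snd (p \<mu>))" by (rule choice[THEN exE])
  define d where "d \<mu> = fst (p \<mu>)" for \<mu>
  define h where "h \<mu> = snd (p \<mu>)" for \<mu>
  have dh: "(\<forall>i<card (K \<mu>). L2 (d \<mu> i) \<and> (AE t in lborel. H (d \<mu> i) t = of_real \<mu> * d \<mu> i t)) \<and>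
      (\<forall>i<card (K \<mu>). \<forall>j<card (K \<mu>). L2_inner (d \<mu> i) (d \<mu> j) = (if i = j then 1 else 0)) \<and> bij_betw (h \<mu>) (K \<mu>) {0..<card (K \<mu>)}"
    if "\<mu> > 0" for \<mu>
    using p that unfolding Q_def d_def h_def by blast
  define e where "e k = d (\<alpha> k) (h (\<alpha> k) k)" for k :: nat
  have half: "1/2 \<le> \<alpha> k" if "k \<in> {1..N}" for k using dec[of k N] \<alpha>(1) that by simp
  have hk: "h (\<alpha> k) k < card (K (\<alpha> k))" if "k \<in> {1..N}" for k
  proof -
    have "\<alpha> k > 0" using half[OF that] by simp
    then have "h (\<alpha> k) k \<in> {0..<card (K (\<alpha> k))}"
      using dh that by (intro bij_betwE[THEN bspec, of "h (\<alpha> k)" "K (\<alpha> k)"]) (auto simp: K_def)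
    then show ?thesis by simp
  qed
  have e1: "L2 (e k)" and e2: "AE t in lborel. H (e k) t = of_real (\<alpha> k) * e k t" if k: "k \<in> {1..N}" for k
    using dh[of "\<alpha> k"] hk[OF k] half[OF k] by (auto simp: e_def)
  have e3: "L2_inner (e i) (e j) = (if i = j then 1 else 0)" if i: "i \<in> {1..N}" and j: "j \<in> {1..N}" for i j
  proof (cases "\<alpha> i = \<alpha> j")
    case True
    have pos: "\<alpha> j > 0" using half[OF j] by simp
    have "inj_on (h (\<alpha> j)) (K (\<alpha> j))" using dh[OF pos] by (auto simp: bij_betw_def)
    then have "h (\<alpha> j) i = h (\<alpha> j) j \<longleftrightarrow> i = j" using i j True by (auto simp: K_def inj_on_def)
    then show ?thesis using dh[OF pos] hk[OF i] hk[OF j] True by (simp add: e_def)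
  next
    case False
    then show ?thesis using eigfun_orthogonal[OF e1[OF i] e2[OF i] e1[OF j] e2[OF j]] by auto
  qed
  have e4: "q f \<le> 1/2 * (L2_norm f)^2" if f: "f \<in> orth (e ` {1..N})" for f
  proof (rule ccontr)
    assume "\<not> ?thesis"
    then have less: "1/2 * (L2_norm f)^2 < q f" by simp
    have E: "eigfun x" if "x \<in> e ` {1..N}" for x
    proof -
      from that obtain k where "k \<in> {1..N}" "x = e k" by blast
      then show ?thesis using e1 e2 unfolding eigfun_def by blast
    qed
    obtain g M where g: "g \<in> orth (e ` {1..N})" "1/2 < M" "L2_norm g = 1" "\<And>t. H g t = of_real M * g t"
      using eigfun_of_large_energy[OF E f _ less] by auto
    have gL: "L2 g" and go: "\<And>k. k \<in> {1..N} \<Longrightarrow> L2_inner g (e k) = 0" using g(1) by (auto simp: orth_def)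
    have M: "M > 0" using g(2) by simp
    let ?n = "card (K M)"
    \<comment> \<open>Since \<open>M > 1/2 \<ge> \<alpha> (Suc N)\<close>, all indices with
      eigenvalue \<open>M\<close> are at most \<open>N\<close>. So the family of \<open>M\<close> is
      among the \<open>e k\<close>, and \<open>g\<close> is orthogonal to all of it.\<close>
    have KN: "K M \<subseteq> {1..N}"
    proof
      fix k assume k: "k \<in> K M"
      have "\<not> Suc N \<le> k"
      proof
        assume "Suc N \<le> k"
        then have "\<alpha> k \<le> 1/2" using dec[of "Suc N" k] \<alpha>(2) by simp
        then show False using k g(2) by (simp add: K_def)
      qed
      then show "k \<in> {1..N}" using k by (simp add: K_def)
    qed
    have gd: "L2_inner g (d M i) = 0" if i: "i < ?n" for i
    proof -
      have "i \<in> h M ` K M" using dh[OF M] i by (simp add: bij_betw_def)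
      then obtain k where k: "k \<in> K M" "i = h M k" by blast
      then have "d M i = e k" by (simp add: e_def K_def)
      then show ?thesis using go KN k by auto
    qed
    have dg: "L2_inner (d M i) g = 0" if i: "i < ?n" for i
      using arg_cong[where f = cnj, OF gd[OF i]] by (simp add: L2_inner_cnj)
    define e' where "e' i = (if i < ?n then d M i else g)" for i
    have "eig_family \<Omega> \<phi> M (Suc ?n)"
      unfolding eig_family_def loc_op_eq_H
    proof (intro exI[of _ e'] conjI allI impI)
      fix i j assume i: "i < Suc ?n" and j: "j < Suc ?n"
      show "L2 (e' i)" using dh[OF M] gL by (auto simp: e'_def)
      show "AE t in lborel. H (e' i) t = of_real M * e' i t" using dh[OF M] g(4) by (auto simp: e'_def)
      have "L2_inner g g = 1" using g(3) by (simp add: L2_inner_self)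
      then show "L2_inner (e' i) (e' j) = (if i = j then 1 else 0)"
        using dh[OF M] gd dg i j by (auto simp: e'_def less_Suc_eq)
    qed
    then show False using mult(2)[OF M] by (simp add: eig_mult_def)
  qed
  show ?thesis by (rule that[OF e1 e2 e3 half e4])
qed

section \<open>Splitting a concentrated function\<close>

lemma V_sum: "(\<And>i. i \<in> I \<Longrightarrow> L2 (f i)) \<Longrightarrow> V (\<lambda>t. \<Sum>i\<in>I. c i * f i t) z = (\<Sum>i\<in>I. c i * V (f i) z)"
  by (simp add: STFT_eq_inner L2_inner_sum_left L2_shift L2_scale L2_inner_scale_left)

lemma q_add:
  assumes f: "L2 f" and g: "L2 g"
  shows "q (\<lambda>t. f t + g t) = q f + 2 * Re (L2_inner (H f) g) + q g"
proof -
  have "complex_of_real (q (\<lambda>t. f t + g t)) = (LINT z:\<Omega>|lborel. V f z * cnj (V f z) + V f z * cnj (V g z) + V g z * cnj (V f z) + V g z * cnj (V g z))"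
    unfolding H_self[OF L2_add[OF f g], symmetric] H_inner[OF L2_add[OF f g] L2_add[OF f g]]
    by (simp add: V_add f g algebra_simps)
  also have "\<dots> = (LINT z:\<Omega>|lborel. V f z * cnj (V f z)) + (LINT z:\<Omega>|lborel. V f z * cnj (V g z)) + (LINT z:\<Omega>|lborel. V g z * cnj (V f z)) + (LINT z:\<Omega>|lborel. V g z * cnj (V g z))"
  proof -
    have "set_integrable lborel \<Omega> (\<lambda>z. V a z * cnj (V b z))" if "L2 a" "L2 b" for a b
      unfolding set_integrable_def by (intro integrable_on_\<Omega> continuous_intros V_continuous that)
    then show ?thesis using f g by (simp add: set_integral_add)
  qed
  also have "\<dots> = of_real (q f) + (L2_inner (H f) g + cnj (L2_inner (H f) g)) + of_real (q g)"
    using H_sym[OF g f] H_self[OF f] H_self[OF g] unfolding H_inner[OF f f] H_inner[OF f g] H_inner[OF g f] H_inner[OF g g]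
    by simp
  also have "L2_inner (H f) g + cnj (L2_inner (H f) g) = of_real (2 * Re (L2_inner (H f) g))" by (simp add: complex_add_cnj)
  finally have "complex_of_real (q (\<lambda>t. f t + g t)) = of_real (q f + 2 * Re (L2_inner (H f) g) + q g)" by simp
  then show ?thesis by (simp only: of_real_eq_iff)
qed

text \<open>\<open>H\<close> maps the complement into itself, so the energy is additive over the two
  parts and at most \<open>\<parallel>f1\<parallel>^2 + \<parallel>f2\<parallel>^2 / 2 =
  \<parallel>f\<parallel>^2 - \<parallel>f2\<parallel>^2 / 2\<close>. Comparison with the
  concentration hypothesis gives the factor 2 in \<open>2 * \<epsilon>\<close>.\<close>

theorem concentrated_split:
  fixes e :: "'i \<Rightarrow> real \<Rightarrow> complex"
  assumes I: "finite I" and e: "\<And>k. k \<in> I \<Longrightarrow> L2 (e k)" "\<And>k. k \<in> I \<Longrightarrow> eigfun (e k)"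
    and on: "\<And>i j. i \<in> I \<Longrightarrow> j \<in> I \<Longrightarrow> L2_inner (e i) (e j) = (if i = j then 1 else 0)"
    and half: "\<And>f. f \<in> orth (e ` I) \<Longrightarrow> q f \<le> 1/2 * (L2_norm f)^2"
    and f: "L2 f" and conc: "(1 - \<epsilon>) * (L2_norm f)^2 \<le> q f"
  obtains x f2 where "L2 f2" "\<And>z. V f z = (\<Sum>k\<in>I. x k * V (e k) z) + V f2 z"
    "(L2_norm f2)^2 \<le> 2 * \<epsilon> * (L2_norm f)^2" "(1 - 2 * \<epsilon>) * (L2_norm f)^2 \<le> (\<Sum>k\<in>I. (cmod (x k))^2)"
proof -
  define x where "x k = L2_inner f (e k)" for k
  define f1 where "f1 t = (\<Sum>k\<in>I. x k * e k t)" for t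
  define f2 where "f2 t = f t - f1 t" for t
  have f1L: "L2 f1" unfolding f1_def[abs_def] by (intro L2_sum L2_scale e)
  have f2L: "L2 f2" unfolding f2_def[abs_def] by (intro L2_diff f f1L)
  have f1e: "L2_inner f1 (e l) = x l" if l: "l \<in> I" for l
  proof -
    have "L2_inner f1 (e l) = (\<Sum>k\<in>I. L2_inner (\<lambda>t. x k * e k t) (e l))"
      unfolding f1_def[abs_def] by (intro L2_inner_sum_left L2_scale e l)
    also have "\<dots> = (\<Sum>k\<in>I. if k = l then x k else 0)"
      unfolding L2_inner_scale_left using on l by (intro sum.cong) auto
    finally show ?thesis using I l by simp
  qed
  have f2X: "f2 \<in> orth (e ` I)"
    using f2L f1e e f f1L unfolding f2_def[abs_def] by (auto simp: orth_def L2_inner_diff_left x_def)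
  have orth1: "L2_inner g f1 = 0" if "g \<in> orth (e ` I)" for g
  proof -
    have "L2_inner g f1 = (\<Sum>k\<in>I. L2_inner g (\<lambda>t. x k * e k t))"
      unfolding f1_def[abs_def] by (intro L2_inner_sum_right L2_scale e) (use that in \<open>simp_all add: orth_def\<close>)
    then show ?thesis using that by (simp add: L2_inner_scale_right orth_def)
  qed
  have sq: "x k * cnj (x k) = of_real ((cmod (x k))^2)" for k by (metis complex_norm_square of_real_power)
  have "complex_of_real ((L2_norm f1)^2) = (\<Sum>k\<in>I. L2_inner f1 (\<lambda>t. x k * e k t))"
    unfolding L2_inner_self[symmetric] by (subst (2) f1_def[abs_def]) (intro L2_inner_sum_right L2_scale e f1L)
  also have "\<dots> = of_real (\<Sum>k\<in>I. (cmod (x k))^2)"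
    unfolding of_real_sum by (intro sum.cong refl) (simp only: L2_inner_scale_right f1e sq[symmetric] mult.commute)
  finally have n1: "(L2_norm f1)^2 = (\<Sum>k\<in>I. (cmod (x k))^2)" by (simp only: of_real_eq_iff)
  have feq: "f = (\<lambda>t. f2 t + f1 t)" by (simp add: f2_def)
  have nf: "(L2_norm f)^2 = (L2_norm f2)^2 + (L2_norm f1)^2"
    using L2_norm_add_sq[OF f2L f1L] orth1[OF f2X] unfolding feq[symmetric] by simp
  have "H f2 \<in> orth (e ` I)" by (rule H_orth[OF _ f2X]) (use e in auto)
  then have "q f = q f2 + q f1" using q_add[OF f2L f1L] orth1 unfolding feq[symmetric] by simp
  also have "\<dots> \<le> 1/2 * (L2_norm f2)^2 + (L2_norm f1)^2" by (intro add_mono half f2X q_le f1L)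
  finally have "(1 - \<epsilon>) * (L2_norm f)^2 \<le> (L2_norm f)^2 - 1/2 * (L2_norm f2)^2" using conc nf by linarith
  then have b2: "(L2_norm f2)^2 \<le> 2 * \<epsilon> * (L2_norm f)^2" by (simp add: algebra_simps)
  show ?thesis
  proof (rule that[OF f2L _ b2])
    show "V f z = (\<Sum>k\<in>I. x k * V (e k) z) + V f2 z" for z
    proof -
      have "V f z = V f2 z + V f1 z" by (subst feq) (rule V_add[OF f2L f1L])
      then show ?thesis unfolding f1_def[abs_def] using V_sum[of I e x z] e by simp
    qed
    show "(1 - 2 * \<epsilon>) * (L2_norm f)^2 \<le> (\<Sum>k\<in>I. (cmod (x k))^2)" using b2 nf n1 by (simp add: algebra_simps)
  qed
qed

end

section \<open>The sampling inequality\<close>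

text \<open>The difference of the two sides vanishes at 0 and has derivative
  \<open>- ln (1 - x) - x \<ge> 0\<close>. The right-hand side is the rate function of the lower
  Chernoff tail.\<close>

lemma entropy_lower:
  fixes y :: real
  assumes "0 \<le> y" "y < 1"
  shows "y^2 / 2 \<le> y + (1 - y) * ln (1 - y)"
proof -
  let ?h = "\<lambda>y. y + (1 - y) * ln (1 - y) - y^2 / 2"
  have "?h 0 \<le> ?h y"
  proof (rule DERIV_nonneg_imp_nondecreasing[OF assms(1)])
    fix x assume x: "0 \<le> x" "x \<le> y"
    then have x1: "x < 1" using assms by simp
    have "((\<lambda>y. ln (1 - y)) has_real_derivative (- 1 / (1 - x))) (at x)"
      using x1 by (auto intro!: derivative_eq_intros)
    from DERIV_mult[OF DERIV_diff[OF DERIV_const[of 1] DERIV_ident] this]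
    have "((\<lambda>y. (1 - y) * ln (1 - y)) has_real_derivative - ln (1 - x) - 1) (at x)"
      using x1 by simp
    from DERIV_diff[OF DERIV_add[OF DERIV_ident this] DERIV_cdivide[OF DERIV_pow[of 2]], of 2]
    have "(?h has_real_derivative (- ln (1 - x) - x)) (at x)" by simp
    moreover have "ln (1 - x) \<le> - x" using ln_le_minus_one[of "1 - x"] x1 by simp
    ultimately show "\<exists>d. (?h has_real_derivative d) (at x) \<and> 0 \<le> d" by force
  qed
  then show ?thesis by simp
qed

lemma Q1_measure: "emeasure lborel (Q1 v) = 1"
proof -
  have "Q1 v = {fst v - 1/2..fst v + 1/2} \<times> {snd v - 1/2..snd v + 1/2}"
    unfolding Q1_def abs_diff_le_iff by (simp only: set_eq_iff mem_Collect_eq mem_Times_iff atLeastAtMost_iff) simp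
  then have "emeasure lborel (Q1 v) = emeasure (lborel \<Otimes>\<^sub>M lborel) ({fst v - 1/2..fst v + 1/2} \<times> {snd v - 1/2..snd v + 1/2})"
    by (simp add: lborel_prod)
  also have "\<dots> = 1"
    by (subst lborel.emeasure_pair_measure_Times) simp_all
  finally show ?thesis .
qed

text \<open>Exponential Markov inequality with parameter \<open>ln 3\<close>: each hit weighs 3,
  that is, \<open>1 + 2 * indicator\<close>. The square has area 1, so the mean weight is at most
  \<open>1 + 2 / |\<Omega>| \<le> exp (2 / |\<Omega>|)\<close>; the threshold
  \<open>3 r / |\<Omega>|\<close> then leaves the exponent \<open>3 ln 3 - 2\<close>.\<close>

lemma (in prob_space) uniform_count_tail:
  fixes lam :: "nat \<Rightarrow> 'a \<Rightarrow> real \<times> real"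
  assumes rv: "\<And>j. random_variable borel (lam j)" and indep: "indep_vars (\<lambda>_. borel) lam UNIV"
    and unif: "\<And>j. distr M borel (lam j) = uniform_measure lborel \<Omega>"
    and \<Omega>: "\<Omega> \<in> sets borel" "emeasure lborel \<Omega> < \<infinity>" "measure lborel \<Omega> > 0" and I: "finite I"
  shows "prob {\<omega>\<in>space M. 3 * (real (card I) / measure lborel \<Omega>) < (\<Sum>j\<in>I. indicator (Q1 v) (lam j \<omega>))}
    \<le> exp (- (real (card I) / measure lborel \<Omega>) * (3 * ln 3 - 2))"
proof -
  define m where "m = measure lborel \<Omega>"
  have m: "0 < m" and em: "emeasure lborel \<Omega> = ennreal m"
    using \<Omega> by (simp_all add: m_def emeasure_eq_ennreal_measure less_top)
  let ?r = "real (card I) / m"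
  have [measurable]: "Q1 v \<in> sets borel" by (rule Q1_sets)
  have rv': "lam j \<in> measurable M borel" for j by (rule rv)
  define Y where "Y z = (ennreal (1 + 2 * indicator (Q1 v) z))" for z :: "real \<times> real"
  have [measurable]: "Y \<in> borel_measurable borel" unfolding Y_def by measurable
  have EY: "(\<integral>\<^sup>+\<omega>. Y (lam j \<omega>) \<partial>M) \<le> ennreal (exp (2 / m))" for j
  proof -
    have "(\<integral>\<^sup>+\<omega>. Y (lam j \<omega>) \<partial>M) = (\<integral>\<^sup>+z. Y z \<partial>uniform_measure lborel \<Omega>)"
      unfolding unif[of j, symmetric] using rv' by (subst nn_integral_distr) auto
    also have "\<dots> = (\<integral>\<^sup>+z. Y z * indicator \<Omega> z \<partial>lborel) / emeasure lborel \<Omega>"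
      using \<Omega> by (intro nn_integral_uniform_measure) auto
    also have "(\<integral>\<^sup>+z. Y z * indicator \<Omega> z \<partial>lborel) \<le> (\<integral>\<^sup>+z. indicator \<Omega> z + 2 * indicator (Q1 v) z \<partial>lborel)"
      by (intro nn_integral_mono) (auto simp: Y_def indicator_def)
    also have "\<dots> = emeasure lborel \<Omega> + 2 * emeasure lborel (Q1 v)"
      using \<Omega> by (subst nn_integral_add) (auto simp: nn_integral_cmult)
    also have "\<dots> = ennreal (m + 2)"
      using m unfolding em Q1_measure by (subst ennreal_plus) auto
    also have "ennreal (m + 2) / emeasure lborel \<Omega> = ennreal ((m + 2) / m)"
      unfolding em by (rule divide_ennreal) (use m in auto)
    also have "(m + 2) / m = 1 + 2 / m" using m by (simp add: field_simps)
    also have "ennreal (1 + 2 / m) \<le> ennreal (exp (2 / m))" by (intro ennreal_leI exp_ge_add_one_self)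
    finally show ?thesis by (simp add: divide_right_mono_ennreal)
  qed
  have ind: "indep_vars (\<lambda>_. borel) (\<lambda>j \<omega>. Y (lam j \<omega>)) I"
    by (rule indep_vars_compose2[OF indep_vars_subset[OF indep subset_UNIV]]) simp
  have "(\<integral>\<^sup>+\<omega>. (\<Prod>j\<in>I. Y (lam j \<omega>)) \<partial>M) = (\<Prod>j\<in>I. \<integral>\<^sup>+\<omega>. Y (lam j \<omega>) \<partial>M)"
    by (rule indep_vars_nn_integral[OF I ind]) simp
  also have "\<dots> \<le> (\<Prod>j\<in>I. ennreal (exp (2 / m)))" by (intro prod_mono_ennreal EY)
  also have "\<dots> = ennreal (exp (2 * ?r))"
    by (simp add: ennreal_power mult.commute flip: exp_of_nat_mult)
  finally have EP: "(\<integral>\<^sup>+\<omega>. (\<Prod>j\<in>I. Y (lam j \<omega>)) \<partial>M) \<le> ennreal (exp (2 * ?r))" .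
  have PY: "(\<Prod>j\<in>I. Y (lam j \<omega>)) = ennreal (exp (ln 3 * (\<Sum>j\<in>I. indicator (Q1 v) (lam j \<omega>))))" for \<omega>
  proof -
    have "(\<Prod>j\<in>I. Y (lam j \<omega>)) = ennreal (\<Prod>j\<in>I. 1 + 2 * indicat_real (Q1 v) (lam j \<omega>))"
      unfolding Y_def by (rule prod_ennreal) (simp add: indicator_def)
    also have "(\<Prod>j\<in>I. 1 + 2 * indicat_real (Q1 v) (lam j \<omega>)) = (\<Prod>j\<in>I. exp (ln 3 * indicator (Q1 v) (lam j \<omega>)))"
      by (intro prod.cong refl) (simp add: indicator_def)
    also have "\<dots> = exp (ln 3 * (\<Sum>j\<in>I. indicator (Q1 v) (lam j \<omega>)))" using exp_sum[OF I, symmetric] by (simp only: sum_distrib_left)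
    finally show ?thesis .
  qed
  let ?bad = "{\<omega>\<in>space M. 3 * ?r < (\<Sum>j\<in>I. indicator (Q1 v) (lam j \<omega>))}"
  have m1: "(\<lambda>\<omega>. \<Prod>j\<in>I. Y (lam j \<omega>)) \<in> borel_measurable M"
    by (intro borel_measurable_prod_ennreal measurable_compose[OF rv']) simp
  have "emeasure M ?bad \<le> emeasure M {\<omega>\<in>space M. 1 \<le> ennreal (exp (- (ln 3 * (3 * ?r)))) * (\<Prod>j\<in>I. Y (lam j \<omega>))}"
  proof (rule emeasure_mono)
    show "?bad \<subseteq> {\<omega>\<in>space M. 1 \<le> ennreal (exp (- (ln 3 * (3 * ?r)))) * (\<Prod>j\<in>I. Y (lam j \<omega>))}"
    proof safe
      fix \<omega> assume "3 * ?r < (\<Sum>j\<in>I. indicator (Q1 v) (lam j \<omega>))"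
      then have "ln 3 * (3 * ?r) \<le> ln 3 * (\<Sum>j\<in>I. indicator (Q1 v) (lam j \<omega>))" by (intro mult_left_mono) auto
      then have "1 \<le> exp (- (ln 3 * (3 * ?r))) * exp (ln 3 * (\<Sum>j\<in>I. indicator (Q1 v) (lam j \<omega>)))"
        unfolding exp_add[symmetric] by simp
      then show "1 \<le> ennreal (exp (- (ln 3 * (3 * ?r)))) * (\<Prod>j\<in>I. Y (lam j \<omega>))"
        unfolding PY by (simp only: ennreal_mult'[symmetric] exp_ge_zero ennreal_ge_1)
    qed
    show "{\<omega>\<in>space M. 1 \<le> ennreal (exp (- (ln 3 * (3 * ?r)))) * (\<Prod>j\<in>I. Y (lam j \<omega>))} \<in> sets M"
      using m1 by measurable
  qed
  also have "\<dots> \<le> ennreal (exp (- (ln 3 * (3 * ?r)))) * (\<integral>\<^sup>+\<omega>. (\<Prod>j\<in>I. Y (lam j \<omega>)) * indicator (space M) \<omega> \<partial>M)"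
    using m1 by (intro nn_integral_Markov_inequality) auto
  also have "(\<integral>\<^sup>+\<omega>. (\<Prod>j\<in>I. Y (lam j \<omega>)) * indicator (space M) \<omega> \<partial>M) = (\<integral>\<^sup>+\<omega>. (\<Prod>j\<in>I. Y (lam j \<omega>)) \<partial>M)"
    by (intro nn_integral_cong) simp
  also have "ennreal (exp (- (ln 3 * (3 * ?r)))) * \<dots> \<le> ennreal (exp (- (ln 3 * (3 * ?r)))) * ennreal (exp (2 * ?r))"
    by (intro mult_left_mono EP) simp
  also have "\<dots> = ennreal (exp (- ?r * (3 * ln 3 - 2)))"
  proof -
    have "- (ln 3 * (3 * ?r)) + 2 * ?r = - ?r * (3 * ln 3 - 2)" by (simp add: algebra_simps)
    then show ?thesis by (simp only: ennreal_mult'[symmetric] exp_ge_zero exp_add[symmetric])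
  qed
  finally show ?thesis unfolding m_def[symmetric] by (simp only: emeasure_eq_measure ennreal_le_iff exp_ge_zero)
qed

text \<open>In each square every sample is replaced by the one with the largest value of
  \<open>g\<close>; an unvisited square gets its centre, so that every square carries one point.
  Samples lying in several squares are only counted more often.\<close>

lemma sum_over_cover_le:
  fixes g :: "real \<times> real \<Rightarrow> real" and lam :: "'j \<Rightarrow> real \<times> real"
  assumes I: "finite I" and S: "finite S" and g: "\<And>z. 0 \<le> g z"
    and cover: "\<And>j. j \<in> I \<Longrightarrow> \<exists>m\<in>S. lam j \<in> Q1 (lattice_pt m)"
    and count: "\<And>m. m \<in> S \<Longrightarrow> (\<Sum>j\<in>I. indicator (Q1 (lattice_pt m)) (lam j)) \<le> c"
    and X: "\<And>w. (\<And>m. m \<in> S \<Longrightarrow> w m \<in> Q1 (lattice_pt m)) \<Longrightarrow> (\<Sum>m\<in>S. g (w m)) \<le> X" and "0 \<le> c"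
  shows "(\<Sum>j\<in>I. g (lam j)) \<le> c * X"
proof -
  have "\<exists>z. z \<in> Q1 (lattice_pt m) \<and> (\<forall>j\<in>I. lam j \<in> Q1 (lattice_pt m) \<longrightarrow> g (lam j) \<le> g z)" for m
  proof (cases "\<exists>j\<in>I. lam j \<in> Q1 (lattice_pt m)")
    case True
    let ?J = "{j \<in> I. lam j \<in> Q1 (lattice_pt m)}"
    have "finite ?J" "?J \<noteq> {}" using I True by auto
    then have "Max ((g \<circ> lam) ` ?J) \<in> (g \<circ> lam) ` ?J" by (intro Max_in) auto
    then obtain k where "k \<in> ?J" "Max ((g \<circ> lam) ` ?J) = g (lam k)" by auto
    moreover have "g (lam j) \<le> Max ((g \<circ> lam) ` ?J)" if "j \<in> ?J" for j
      using that \<open>finite ?J\<close> by (intro Max_ge) auto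
    ultimately have "k \<in> ?J" "\<And>j. j \<in> ?J \<Longrightarrow> g (lam j) \<le> g (lam k)" by auto
    then show ?thesis by (intro exI[of _ "lam k"]) auto
  next
    case False
    have "lattice_pt m \<in> Q1 (lattice_pt m)" by (simp add: Q1_def)
    then show ?thesis using False by blast
  qed
  then have "\<forall>m. \<exists>z. z \<in> Q1 (lattice_pt m) \<and> (\<forall>j\<in>I. lam j \<in> Q1 (lattice_pt m) \<longrightarrow> g (lam j) \<le> g z)" by blast
  then obtain w where "\<forall>m. w m \<in> Q1 (lattice_pt m) \<and> (\<forall>j\<in>I. lam j \<in> Q1 (lattice_pt m) \<longrightarrow> g (lam j) \<le> g (w m))"
    by (rule choice[THEN exE])
  then have w: "\<And>m. w m \<in> Q1 (lattice_pt m)" "\<And>m j. j \<in> I \<Longrightarrow> lam j \<in> Q1 (lattice_pt m) \<Longrightarrow> g (lam j) \<le> g (w m)"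
    by blast+
  have "(\<Sum>j\<in>I. g (lam j)) \<le> (\<Sum>j\<in>I. \<Sum>m\<in>S. indicator (Q1 (lattice_pt m)) (lam j) * g (w m))"
  proof (rule sum_mono)
    fix j assume j: "j \<in> I"
    then obtain m where m: "m \<in> S" "lam j \<in> Q1 (lattice_pt m)" using cover by blast
    have "g (lam j) \<le> indicator (Q1 (lattice_pt m)) (lam j) * g (w m)" using w(2)[OF j m(2)] m(2) by simp
    also have "\<dots> \<le> (\<Sum>m\<in>S. indicator (Q1 (lattice_pt m)) (lam j) * g (w m))"
      by (rule member_le_sum[OF m(1) _ S]) (simp add: g)
    finally show "g (lam j) \<le> (\<Sum>m\<in>S. indicator (Q1 (lattice_pt m)) (lam j) * g (w m))" .
  qed
  also have "\<dots> = (\<Sum>m\<in>S. (\<Sum>j\<in>I. indicator (Q1 (lattice_pt m)) (lam j)) * g (w m))"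
    unfolding sum_distrib_right by (rule sum.swap)
  also have "\<dots> \<le> (\<Sum>m\<in>S. c * g (w m))" by (intro sum_mono mult_right_mono count g)
  also have "\<dots> = c * (\<Sum>m\<in>S. g (w m))" by (simp add: sum_distrib_left)
  also have "\<dots> \<le> c * X" using w(1) \<open>0 \<le> c\<close> by (intro mult_left_mono X)
  finally show ?thesis .
qed

text \<open>If \<open>b0 \<le> a0\<close>, the reverse triangle inequality gives
  \<open>(a0 - b0)^2\<close>, from which \<open>b0^2\<close> is dropped. Otherwise the left-hand
  side is not positive.\<close>

lemma sum_norm_sq_add_ge:
  fixes P R :: "'j \<Rightarrow> complex"
  assumes "finite I" and a: "0 \<le> a0" "a0^2 \<le> (\<Sum>j\<in>I. (cmod (P j))^2)"
    and b: "0 \<le> b0" "(\<Sum>j\<in>I. (cmod (R j))^2) \<le> b0^2"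
  shows "a0^2 - 2 * a0 * b0 \<le> (\<Sum>j\<in>I. (cmod (P j + R j))^2)"
proof -
  define p where "p = sqrt (\<Sum>j\<in>I. (cmod (P j))^2)"
  define q where "q = sqrt (\<Sum>j\<in>I. (cmod (R j))^2)"
  have p2: "p^2 = (\<Sum>j\<in>I. (cmod (P j))^2)" and q2: "q^2 = (\<Sum>j\<in>I. (cmod (R j))^2)"
    by (simp_all add: p_def q_def sum_nonneg)
  have p0: "0 \<le> p" and q0: "0 \<le> q" by (simp_all add: p_def q_def sum_nonneg)
  have pa: "a0 \<le> p" using a(2)[folded p2] p0 by (rule power2_le_imp_le)
  have qb: "q \<le> b0" using b(2)[folded q2] b(1) by (rule power2_le_imp_le)
  have "(\<Sum>j\<in>I. cmod (P j) * cmod (R j))^2 \<le> (p * q)^2"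
    unfolding power_mult_distrib p2 q2 by (rule Cauchy_Schwarz_ineq_sum)
  then have cs: "(\<Sum>j\<in>I. cmod (P j) * cmod (R j)) \<le> p * q"
    by (rule power2_le_imp_le) (use p0 q0 in simp)
  have "(p - q)^2 = p^2 - 2 * (p * q) + q^2" by (simp add: power2_eq_square algebra_simps)
  also have "\<dots> \<le> (\<Sum>j\<in>I. (cmod (P j))^2) - 2 * (\<Sum>j\<in>I. cmod (P j) * cmod (R j)) + (\<Sum>j\<in>I. (cmod (R j))^2)"
    unfolding p2 q2 using cs by simp
  also have "\<dots> = (\<Sum>j\<in>I. (cmod (P j) - cmod (R j))^2)"
    by (simp add: power2_diff sum.distrib sum_subtractf sum_distrib_left mult.assoc)
  also have "\<dots> \<le> (\<Sum>j\<in>I. (cmod (P j + R j))^2)"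
  proof (rule sum_mono)
    fix j
    have "\<bar>cmod (P j) - cmod (R j)\<bar> \<le> \<bar>cmod (P j + R j)\<bar>" using norm_triangle_ineq3[of "P j" "- R j"] by simp
    then show "(cmod (P j) - cmod (R j))^2 \<le> (cmod (P j + R j))^2" by (simp only: abs_le_square_iff)
  qed
  finally have pq: "(p - q)^2 \<le> (\<Sum>j\<in>I. (cmod (P j + R j))^2)" .
  show ?thesis
  proof (cases "b0 \<le> a0")
    case True
    then have "(a0 - b0)^2 \<le> (p - q)^2" using pa qb by (intro power_mono) auto
    moreover have "a0^2 - 2 * a0 * b0 \<le> (a0 - b0)^2" by (simp add: power2_eq_square algebra_simps)
    ultimately show ?thesis using pq by linarith
  next
    case False
    have "a0 * a0 \<le> a0 * (2 * b0)" using False a b by (intro mult_left_mono) auto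
    then have "a0^2 - 2 * a0 * b0 \<le> 0" by (simp add: power2_eq_square)
    also have "0 \<le> (\<Sum>j\<in>I. (cmod (P j + R j))^2)" by (simp add: sum_nonneg)
    finally show ?thesis .
  qed
qed

text \<open>The transform does not see a null set, and for fixed \<open>t\<close> the exceptional
  points of \<open>x \<mapsto> \<phi> (t - x)\<close> span a null set of the plane. So the operators
  agree at every \<open>t\<close>, and the eigenvalue hypothesis passes to the continuous
  representative.\<close>

lemma loc_op_cong_AE:
  assumes [measurable]: "\<phi> \<in> borel_measurable borel" "\<psi> \<in> borel_measurable borel"
    and f: "L2 f" and ae: "AE t in lborel. \<phi> t = \<psi> t"
    and V: "STFT \<psi> f \<in> borel_measurable borel" and [measurable]: "\<Omega> \<in> sets borel"
  shows "loc_op \<Omega> \<phi> f = loc_op \<Omega> \<psi> f"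
proof (rule ext)
  fix t
  have [measurable]: "f \<in> borel_measurable borel" using f by auto
  note V[measurable]
  have Veq: "STFT \<phi> f = STFT \<psi> f" by (rule ext) (rule STFT_cong_AE[OF _ _ _ ae]; measurable)
  have m: "(\<lambda>z. tfshift z g t) \<in> borel_measurable borel" if [measurable]: "g \<in> borel_measurable borel" for g
  proof -
    have "(\<lambda>z. g (t - fst z) * cis (2 * pi * snd z * t)) \<in> borel_measurable (borel \<Otimes>\<^sub>M borel)" by measurable
    then show ?thesis by (simp add: tfshift_def borel_prod)
  qed
  have "AE x in lborel. \<phi> (t + (-1) * x) = \<psi> (t + (-1) * x)" by (rule AE_borel_affine[OF _ _ ae]) auto
  then have "AE z in lborel \<Otimes>\<^sub>M lborel. \<phi> (t - fst z) = \<psi> (t - fst z)"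
  proof (intro lborel_pair.AE_pair_measure)
    show "{z \<in> space (lborel \<Otimes>\<^sub>M lborel). \<phi> (t - fst z) = \<psi> (t - fst z)} \<in> sets (lborel \<Otimes>\<^sub>M lborel)"
      by measurable
  qed (auto elim!: eventually_mono)
  then have az: "AE z in lborel. \<phi> (t - fst z) = \<psi> (t - fst z)" by (simp only: lborel_prod)
  show "loc_op \<Omega> \<phi> f t = loc_op \<Omega> \<psi> f t"
    unfolding loc_op_def Veq
  proof (rule set_lebesgue_integral_cong_AE)
    show "(\<lambda>z. STFT \<psi> f z * tfshift z \<phi> t) \<in> borel_measurable lborel" "(\<lambda>z. STFT \<psi> f z * tfshift z \<psi> t) \<in> borel_measurable lborel"
      using m[of \<phi>] m[of \<psi>] by auto
    show "AE z\<in>\<Omega> in lborel. STFT \<psi> f z * tfshift z \<phi> t = STFT \<psi> f z * tfshift z \<psi> t"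
      using az by eventually_elim (simp add: tfshift_def)
  qed simp
qed

lemma eigenvalue_seq_cong:
  assumes "\<And>f. L2 f \<Longrightarrow> loc_op \<Omega> \<phi> f = loc_op \<Omega> \<psi> f"
  shows "eigenvalue_seq \<Omega> \<phi> \<alpha> = eigenvalue_seq \<Omega> \<psi> \<alpha>"
proof -
  have "eig_family \<Omega> \<phi> \<mu> m = eig_family \<Omega> \<psi> \<mu> m" for \<mu> m
    unfolding eig_family_def by (simp add: assms cong: conj_cong)
  then show ?thesis by (simp add: eigenvalue_seq_def eig_mult_def)
qed

section \<open>From eigenfunctions to samples\<close>

context window_domain
begin

text \<open>Bessel's inequality for a shifted window bounds the sample vector by 1. The second
  moments are the inner products of \<open>H (e k)\<close> with \<open>e l\<close>, divided by
  \<open>|\<Omega>|\<close>, hence diagonal. The case distinction on \<open>k < n\<close> is there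
  because the locale wants measurability for every index.\<close>

lemma random_frame_eigenfunctions:
  fixes e :: "nat \<Rightarrow> real \<Rightarrow> complex"
  assumes m: "measure lborel \<Omega> > 0"
    and e: "\<And>k. k < n \<Longrightarrow> L2 (e k)" "\<And>k. k < n \<Longrightarrow> AE t in lborel. H (e k) t = of_real (\<alpha> k) * e k t"
    and on: "\<And>i j. i < n \<Longrightarrow> j < n \<Longrightarrow> L2_inner (e i) (e j) = (if i = j then 1 else 0)"
    and p: "\<And>k. k < n \<Longrightarrow> p \<le> \<alpha> k / measure lborel \<Omega>"
  shows "random_frame (uniform_measure lborel \<Omega>) n (\<lambda>k z. if k < n then V (e k) z else 0) (\<lambda>k. \<alpha> k / measure lborel \<Omega>) p"
proof -
  have fin: "emeasure lborel \<Omega> < \<infinity>" using compact_\<Omega> by (rule emeasure_compact_finite)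
  have em: "emeasure lborel \<Omega> = ennreal (measure lborel \<Omega>)" using fin by (simp add: emeasure_eq_ennreal_measure less_top)
  interpret D: prob_space "uniform_measure lborel \<Omega>"
    using fin m by (intro prob_space_uniform_measure) (auto simp: em)
  show ?thesis
  proof
    show "(\<lambda>z. if k < n then V (e k) z else 0) \<in> borel_measurable (uniform_measure lborel \<Omega>)" for k
      using V_measurable[OF e(1), of k] by (cases "k < n") (auto cong: measurable_cong_sets)
    show "(\<Sum>k<n. (cmod (if k < n then V (e k) z else 0))^2) \<le> 1" for z
    proof -
      have "(\<Sum>k<n. (cmod (if k < n then V (e k) z else 0))^2) = (\<Sum>k<n. (cmod (L2_inner (shift z) (e k)))^2)"
        by (intro sum.cong refl) (simp add: STFT_eq_inner, metis L2_inner_cnj complex_mod_cnj)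
      also have "\<dots> \<le> (L2_norm (shift z))^2"
        by (rule L2_Bessel) (use e on L2_shift in auto)
      finally show ?thesis by (simp add: norm_shift)
    qed
    show "(LINT z|uniform_measure lborel \<Omega>. (if k < n then V (e k) z else 0) * cnj (if l < n then V (e l) z else 0))
      = (if k = l then of_real (\<alpha> k / measure lborel \<Omega>) else 0)" if k: "k < n" and l: "l < n" for k l
    proof -
      have [measurable]: "V (e k) \<in> borel_measurable borel" "V (e l) \<in> borel_measurable borel"
        using V_measurable[OF e(1)] k l by auto
      have "(LINT z|uniform_measure lborel \<Omega>. V (e k) z * cnj (V (e l) z)) = (LINT z:\<Omega>|lborel. V (e k) z * cnj (V (e l) z)) /\<^sub>R measure lborel \<Omega>"
      proof -
        have D: "uniform_measure lborel \<Omega> = density lborel (\<lambda>z. ennreal (indicator \<Omega> z / measure lborel \<Omega>))"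
          unfolding uniform_measure_def em using m
          by (intro density_cong) (auto simp: indicator_def divide_ennreal[symmetric] ennreal_1[symmetric] simp del: ennreal_1)
        have "(LINT z|uniform_measure lborel \<Omega>. V (e k) z * cnj (V (e l) z))
          = (LINT z|lborel. (indicator \<Omega> z / measure lborel \<Omega>) *\<^sub>R (V (e k) z * cnj (V (e l) z)))"
          unfolding D by (rule integral_density) auto
        also have "\<dots> = (LINT z|lborel. inverse (measure lborel \<Omega>) *\<^sub>R (indicator \<Omega> z *\<^sub>R (V (e k) z * cnj (V (e l) z))))"
          by (simp add: divide_inverse mult.commute)
        also have "\<dots> = (LINT z:\<Omega>|lborel. V (e k) z * cnj (V (e l) z)) /\<^sub>R measure lborel \<Omega>"
          unfolding set_lebesgue_integral_def by (rule integral_scaleR_right)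
        finally show ?thesis .
      qed
      also have "(LINT z:\<Omega>|lborel. V (e k) z * cnj (V (e l) z)) = of_real (\<alpha> k) * L2_inner (e k) (e l)"
        unfolding H_inner[OF e(1)[OF k] e(1)[OF l], symmetric] by (rule eigfun_inner[OF e(1)[OF k] e(2)[OF k] e(1)[OF l]])
      finally show ?thesis using on[OF k l] k l by (simp add: scaleR_conv_of_real divide_inverse mult.commute)
    qed
    show "p \<le> \<alpha> k / measure lborel \<Omega>" if "k < n" for k by (rule p[OF that])
  qed
qed

text \<open>The deterministic half: once the frame inequality and the counts hold for the given
  samples, every concentrated \<open>f\<close> is sampled well. The part in the span is bounded
  below through the frame, the rest is bounded above through the counts and the cell
  estimate.\<close>

lemma sampling_of_frame_and_counts:
  fixes e :: "nat \<Rightarrow> real \<Rightarrow> complex" and lam :: "'j \<Rightarrow> real \<times> real"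
  assumes e: "\<And>k. k < n \<Longrightarrow> L2 (e k)" "\<And>k. k < n \<Longrightarrow> eigfun (e k)"
    and on: "\<And>i j. i < n \<Longrightarrow> j < n \<Longrightarrow> L2_inner (e i) (e j) = (if i = j then 1 else 0)"
    and half: "\<And>f. f \<in> orth (e ` {..<n}) \<Longrightarrow> q f \<le> 1/2 * (L2_norm f)^2"
    and f: "L2 f" and conc: "(1 - \<epsilon>) * (L2_norm f)^2 \<le> q f"
    and J: "finite J" and S: "finite S"
    and cover: "\<And>j. j \<in> J \<Longrightarrow> \<exists>m\<in>S. lam j \<in> Q1 (lattice_pt m)"
    and count: "\<And>m. m \<in> S \<Longrightarrow> (\<Sum>j\<in>J. indicator (Q1 (lattice_pt m)) (lam j)) \<le> 3 * \<rho>"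
    and frame: "\<And>x. \<rho> * (1/2 - \<nu>) * (\<Sum>k<n. (cmod (x k))^2) \<le> (\<Sum>j\<in>J. (cmod (\<Sum>k<n. V (e k) (lam j) * x k))^2)"
    and cells: "\<And>g w. L2 g \<Longrightarrow> (\<And>m. m \<in> S \<Longrightarrow> w m \<in> Q1 (lattice_pt m)) \<Longrightarrow> (\<Sum>m\<in>S. (cmod (V g (w m)))^2) \<le> K * (L2_norm g)^2"
    and \<epsilon>: "0 \<le> \<epsilon>" "\<epsilon> \<le> 1/2" and \<nu>: "0 \<le> \<nu>" "\<nu> \<le> 1/2" and "0 \<le> \<rho>" "0 \<le> K" "0 \<le> C" and KC: "K \<le> 6 * C^2"
  shows "\<rho> * (1/2 - \<epsilon> - \<nu> - 6 * sqrt 2 * C * sqrt \<epsilon>) * (L2_norm f)^2 \<le> (\<Sum>j\<in>J. (cmod (V f (lam j)))^2)"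
proof -
  define F where "F = L2_norm f"
  have F0: "0 \<le> F" unfolding F_def by (rule L2_norm_nonneg)
  obtain x f2 where f2: "L2 f2" and Vf: "\<And>z. V f z = (\<Sum>k\<in>{..<n}. x k * V (e k) z) + V f2 z"
    and f2n: "(L2_norm f2)^2 \<le> 2 * \<epsilon> * F^2" and xn: "(1 - 2 * \<epsilon>) * F^2 \<le> (\<Sum>k\<in>{..<n}. (cmod (x k))^2)"
    unfolding F_def
    by (rule concentrated_split[of "{..<n}" e f \<epsilon>]) (use e on half f conc in auto)
  define a0 where "a0 = sqrt (\<rho> * (1/2 - \<nu>) * (1 - 2 * \<epsilon>)) * F"
  define b0 where "b0 = sqrt (6 * \<rho> * K * \<epsilon>) * F"
  have nn: "0 \<le> \<rho> * (1/2 - \<nu>) * (1 - 2 * \<epsilon>)" "0 \<le> 6 * \<rho> * K * \<epsilon>"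
    using assms(13-) by (auto intro!: mult_nonneg_nonneg)
  have a2: "a0^2 = \<rho> * (1/2 - \<nu>) * (1 - 2 * \<epsilon>) * F^2" unfolding a0_def power_mult_distrib using nn by simp
  have b2: "b0^2 = 6 * \<rho> * K * \<epsilon> * F^2" unfolding b0_def power_mult_distrib using nn by simp
  have ab: "0 \<le> a0" "0 \<le> b0" unfolding a0_def b0_def using nn F0 by auto
  have "a0^2 = \<rho> * (1/2 - \<nu>) * ((1 - 2 * \<epsilon>) * F^2)" unfolding a2 by simp
  also have "\<dots> \<le> \<rho> * (1/2 - \<nu>) * (\<Sum>k<n. (cmod (x k))^2)"
    using xn \<nu> \<open>0 \<le> \<rho>\<close> by (intro mult_left_mono) auto
  also have "\<dots> \<le> (\<Sum>j\<in>J. (cmod (\<Sum>k<n. V (e k) (lam j) * x k))^2)" by (rule frame)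
  finally have A: "a0^2 \<le> (\<Sum>j\<in>J. (cmod (\<Sum>k<n. x k * V (e k) (lam j)))^2)" by (simp only: mult.commute)
  have "(\<Sum>j\<in>J. (cmod (V f2 (lam j)))^2) \<le> 3 * \<rho> * (K * (L2_norm f2)^2)"
    by (rule sum_over_cover_le[OF J S _ cover count cells[OF f2]]) (use \<open>0 \<le> \<rho>\<close> in auto)
  also have "\<dots> \<le> 3 * \<rho> * (K * (2 * \<epsilon> * F^2))"
    using f2n \<open>0 \<le> \<rho>\<close> \<open>0 \<le> K\<close> by (intro mult_left_mono) auto
  also have "\<dots> = b0^2" unfolding b2 by simp
  finally have B: "(\<Sum>j\<in>J. (cmod (V f2 (lam j)))^2) \<le> b0^2" .
  have main: "a0^2 - 2 * a0 * b0 \<le> (\<Sum>j\<in>J. (cmod (V f (lam j)))^2)"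
    unfolding Vf by (rule sum_norm_sq_add_ge[OF J ab(1) A ab(2) B])
  \<comment> \<open>From \<open>a0^2 \<le> \<rho> / 2 * F^2\<close> and
    \<open>b0^2 \<le> 36 \<rho> C^2 \<epsilon> F^2\<close> the product is
    \<open>18 \<rho>^2 C^2 \<epsilon> F^4\<close>, and \<open>sqrt 18 = 3 * sqrt 2\<close>.\<close>
  have "(a0 * b0)^2 \<le> (3 * sqrt 2 * \<rho> * C * sqrt \<epsilon> * F^2)^2"
  proof -
    have "a0^2 \<le> \<rho> / 2 * F^2"
    proof -
      have "(1/2 - \<nu>) * (1 - 2 * \<epsilon>) \<le> 1/2 * 1" using \<epsilon> \<nu> by (intro mult_mono) auto
      then have "\<rho> * ((1/2 - \<nu>) * (1 - 2 * \<epsilon>)) \<le> \<rho> * (1/2)" using \<open>0 \<le> \<rho>\<close> by (intro mult_left_mono) auto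
      then show ?thesis unfolding a2 by (intro mult_right_mono) auto
    qed
    moreover have "b0^2 \<le> 36 * \<rho> * C^2 * \<epsilon> * F^2"
    proof -
      have "6 * \<rho> * \<epsilon> * F^2 * K \<le> 6 * \<rho> * \<epsilon> * F^2 * (6 * C^2)" using KC \<open>0 \<le> \<rho>\<close> \<epsilon> by (intro mult_left_mono) auto
      then show ?thesis unfolding b2 by (simp add: mult_ac)
    qed
    ultimately have "a0^2 * b0^2 \<le> (\<rho> / 2 * F^2) * (36 * \<rho> * C^2 * \<epsilon> * F^2)"
      using \<open>0 \<le> \<rho>\<close> by (intro mult_mono) auto
    also have "\<dots> = (3 * sqrt 2 * \<rho> * C * sqrt \<epsilon> * F^2)^2"
      using \<epsilon> by (simp add: power_mult_distrib power2_eq_square)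
    finally show ?thesis by (simp add: power_mult_distrib)
  qed
  then have ab_le: "a0 * b0 \<le> 3 * sqrt 2 * \<rho> * C * sqrt \<epsilon> * F^2"
    by (rule power2_le_imp_le) (use \<open>0 \<le> \<rho>\<close> \<open>0 \<le> C\<close> \<epsilon> in auto)
  have "\<rho> * (1/2 - \<epsilon> - \<nu>) * F^2 \<le> a0^2"
  proof -
    \<comment> \<open>The discarded term is \<open>2 * \<epsilon> * \<nu> \<ge> 0\<close>.\<close>
    have "1/2 - \<epsilon> - \<nu> \<le> (1/2 - \<nu>) * (1 - 2 * \<epsilon>)" using mult_nonneg_nonneg[OF \<epsilon>(1) \<nu>(1)] by (simp add: algebra_simps)
    then have "\<rho> * (1/2 - \<epsilon> - \<nu>) \<le> \<rho> * ((1/2 - \<nu>) * (1 - 2 * \<epsilon>))" using \<open>0 \<le> \<rho>\<close> by (rule mult_left_mono)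
    then show ?thesis unfolding a2 by (intro mult_right_mono) auto
  qed
  then have "\<rho> * (1/2 - \<epsilon> - \<nu>) * F^2 - 2 * (3 * sqrt 2 * \<rho> * C * sqrt \<epsilon> * F^2) \<le> a0^2 - 2 * a0 * b0"
    using ab_le by simp
  moreover have "\<rho> * (1/2 - \<epsilon> - \<nu> - 6 * sqrt 2 * C * sqrt \<epsilon>) * F^2 = \<rho> * (1/2 - \<epsilon> - \<nu>) * F^2 - 2 * (3 * sqrt 2 * \<rho> * C * sqrt \<epsilon> * F^2)"
    by (simp add: algebra_simps)
  ultimately show ?thesis using main unfolding F_def[symmetric] by linarith
qed

end

text \<open>The cell constant is quadratic in \<open>\<beta>\<close>, while
  \<open>C_phi^2 = \<beta>^4 W^2\<close>. The surplus \<open>\<beta>^2 W^2\<close> is at least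
  \<open>sqrt 2 * 1.805\<close>, with \<open>1.805 = 1.9^2 / 2\<close>, and this absorbs the
  constant because \<open>121/18 \<le> 6 * 1.805\<close>.\<close>

lemma cell_constant_le:
  assumes S0: "in_S0 \<phi>" and norm: "L2_norm \<phi> = 1"
  shows "(C_const \<phi> * S0_norm \<phi>)^2 * (121/9 / sqrt 2) \<le> 6 * (C_phi \<phi>)^2" and "0 \<le> C_phi \<phi>"
proof -
  define \<beta> where "\<beta> = C_const \<phi> * S0_norm \<phi>"
  define W where "W = W_norm (STFT gauss0 gauss0)"
  have b: "sqrt 2 \<le> \<beta>^2" unfolding \<beta>_def by (rule STFT_cell_bound(1)[OF S0 norm])
  have W: "1.9 / sqrt 2 \<le> W" unfolding W_def by (rule W_norm_gauss0_ge)
  have C: "C_phi \<phi> = \<beta>^2 * W" by (simp add: C_phi_def \<beta>_def W_def power_mult_distrib mult_ac)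
  have W0: "0 \<le> W" using W by (rule order_trans[rotated]) simp
  then show "0 \<le> C_phi \<phi>" unfolding C by simp
  have "(1.9 / sqrt 2)^2 \<le> W^2" using W by (intro power_mono) auto
  then have W2: "1.805 \<le> W^2" by (simp add: power_divide power2_eq_square)
  have "121/9 / sqrt 2 = 121/18 * sqrt 2" by (simp add: field_simps)
  also have "\<dots> \<le> 6 * (sqrt 2 * 1.805)" by simp
  also have "\<dots> \<le> 6 * (\<beta>^2 * W^2)" using b W2 by (intro mult_left_mono mult_mono) auto
  finally have "\<beta>^2 * (121/9 / sqrt 2) \<le> \<beta>^2 * (6 * (\<beta>^2 * W^2))" by (intro mult_left_mono) auto
  then show "(C_const \<phi> * S0_norm \<phi>)^2 * (121/9 / sqrt 2) \<le> 6 * (C_phi \<phi>)^2"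
    unfolding C \<beta>_def[symmetric] by (simp add: power_mult_distrib power2_eq_square mult_ac)
qed

text \<open>\<open>\<theta> = - ln (1 - 2 \<nu>)\<close> minimizes the exponent of the frame tail at
  the level \<open>1/2 - \<nu>\<close>. The minimum is the rate function at
  \<open>2 * \<nu>\<close>, so \<open>entropy_lower\<close> gives \<open>\<nu>^2\<close>, which is
  then weakened to \<open>\<nu>^2 / (1 + \<nu> / 3)\<close>.\<close>

lemma chernoff_exponent:
  fixes \<nu> c r :: real
  assumes \<nu>: "0 \<le> \<nu>" "\<nu> < 1/2" and c: "0 < c" and r: "0 \<le> r"
  shows "- ((1 - exp (- (- ln (1 - 2 * \<nu>)))) * (1 / (2 * c)) * r) + (- ln (1 - 2 * \<nu>)) * (r / c * (1/2 - \<nu>))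
    \<le> - (\<nu>^2 * r) / (c * (1 + \<nu> / 3))"
proof -
  have pos: "0 < 1 - 2 * \<nu>" using \<nu> by simp
  have "\<nu>^2 \<le> \<nu> + (1/2 - \<nu>) * ln (1 - 2 * \<nu>)"
    using entropy_lower[of "2 * \<nu>"] \<nu> by (simp add: power_mult_distrib algebra_simps)
  moreover have "\<nu>^2 / (1 + \<nu> / 3) \<le> \<nu>^2 / 1" using \<nu> by (intro divide_left_mono) auto
  ultimately have "r / c * (\<nu>^2 / (1 + \<nu> / 3)) \<le> r / c * (\<nu> + (1/2 - \<nu>) * ln (1 - 2 * \<nu>))"
    using c r by (intro mult_left_mono) auto
  moreover have h: "- ((1 - exp (- (- ln (1 - 2 * \<nu>)))) * (1 / (2 * c)) * r) + (- ln (1 - 2 * \<nu>)) * (r / c * (1/2 - \<nu>))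
    = - (r / c * (\<nu> + (1/2 - \<nu>) * ln (1 - 2 * \<nu>)))"
    using pos c by (simp add: field_simps)
  moreover have h': "- (\<nu>^2 * r) / (c * (1 + \<nu> / 3)) = - (r / c * (\<nu>^2 / (1 + \<nu> / 3)))" by simp
  ultimately show ?thesis unfolding h h' by simp
qed

section \<open>Combining the random events\<close>

theorem theorem4p7:
  fixes \<Omega> :: "(real \<times> real) set"
    and \<phi> :: "real \<Rightarrow> complex"
    and \<alpha> :: "nat \<Rightarrow> real"
    and N r :: nat
    and \<epsilon>\<^sub>1 \<epsilon>\<^sub>2 \<epsilon> \<nu> :: real
    and M :: "'a measure"
    and lam :: "nat \<Rightarrow> 'a \<Rightarrow> real \<times> real"
  assumes compact: "compact \<Omega>"
    and pos_meas: "measure lborel \<Omega> > 0"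
    and eps1: "\<epsilon>\<^sub>1 \<ge> 0"
    and cover: "\<exists>S :: (int \<times> int) set. finite S \<and> real (card S) \<le> measure lborel \<Omega> + \<epsilon>\<^sub>1 \<and>
                  \<Omega> \<subseteq> (\<Union>m\<in>S. Q1 (real_of_int (fst m), real_of_int (snd m)))"
    and S0: "in_S0 \<phi>" and normalized: "L2_norm \<phi> = 1"
    and eigs: "eigenvalue_seq \<Omega> \<phi> \<alpha>"
    and N: "N \<ge> 1" "\<alpha> N \<ge> 1/2" "1/2 \<ge> \<alpha> (Suc N)"
    and eps2: "real N = measure lborel \<Omega> + \<epsilon>\<^sub>2"
    and M: "prob_space M"
    and rv: "\<And>j. lam j \<in> measurable M borel"
    and indep: "prob_space.indep_vars M (\<lambda>_. borel) lam UNIV"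
    and unif: "\<And>j. distr M borel (lam j) = uniform_measure lborel \<Omega>"
    and eps_nonneg: "0 \<le> \<epsilon>"
    and eps_small: "\<epsilon> < 1 / (4 * (1 + 6 * sqrt 2 * C_phi \<phi>)^2)"
    and nu: "0 \<le> \<nu>" "\<nu> < 1/2 - (1 + 6 * sqrt 2 * C_phi \<phi>) * sqrt \<epsilon>"
  shows "\<exists>E\<in>sets M.
      measure M E \<ge> 1 - (measure lborel \<Omega> + \<epsilon>\<^sub>2) * exp (- (\<nu>^2 * real r) / (measure lborel \<Omega> * (1 + \<nu>/3)))
                       - (measure lborel \<Omega> + \<epsilon>\<^sub>1) * exp (- (real r / measure lborel \<Omega>) * (3 * ln 3 - 2)) \<and>
      (\<forall>\<omega>\<in>E. \<forall>f. concentrated \<epsilon> \<phi> \<Omega> f \<longrightarrow>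
          (real r / measure lborel \<Omega>) * (1/2 - \<epsilon> - \<nu> - 6 * sqrt 2 * C_phi \<phi> * sqrt \<epsilon>) * (L2_norm f)^2
            \<le> (\<Sum>j=1..r. (cmod (STFT \<phi> f (lam j \<omega>)))^2) \<and>
          (\<Sum>j=1..r. (cmod (STFT \<phi> f (lam j \<omega>)))^2) \<le> real r * (L2_norm f)^2)"
proof -
  interpret M: prob_space M by (rule M)
  define c where "c = measure lborel \<Omega>"
  have c: "0 < c" using pos_meas by (simp add: c_def)
  obtain S :: "(int \<times> int) set" where S: "finite S" "real (card S) \<le> c + \<epsilon>\<^sub>1" "\<Omega> \<subseteq> (\<Union>m\<in>S. Q1 (lattice_pt m))"
    using cover unfolding c_def by blast
  have C0: "0 \<le> C_phi \<phi>" by (rule cell_constant_le(2)[OF S0 normalized])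
  have C1: "1 \<le> 1 + 6 * sqrt 2 * C_phi \<phi>" using C0 by simp
  have \<nu>: "\<nu> < 1/2"
  proof -
    have "0 \<le> (1 + 6 * sqrt 2 * C_phi \<phi>) * sqrt \<epsilon>" using C0 eps_nonneg by (intro mult_nonneg_nonneg) auto
    then show ?thesis using nu(2) by linarith
  qed
  have \<epsilon>: "\<epsilon> \<le> 1/2"
  proof -
    have "1 \<le> (1 + 6 * sqrt 2 * C_phi \<phi>)^2" by (rule one_le_power[OF C1])
    then have "1 / (4 * (1 + 6 * sqrt 2 * C_phi \<phi>)^2) \<le> 1 / (4 * 1)"
      by (intro frac_le mult_left_mono) auto
    then show ?thesis using eps_small by simp
  qed
  have e2: "0 \<le> (c + \<epsilon>\<^sub>1) * exp (- (real r / c) * (3 * ln 3 - 2))" using c eps1 by simp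
  show ?thesis
  proof (cases "\<nu> = 0 \<or> r = 0")
    \<comment> \<open>Then the first exponential equals 1 and \<open>N \<ge> 1\<close>, so the
      asserted probability is not positive and the empty event suffices. The other case provides
      \<open>\<theta> > 0\<close> and a nonempty index set.\<close>
    case True
    then have "- (\<nu>^2 * real r) / (c * (1 + \<nu>/3)) = 0" by auto
    moreover have "1 \<le> c + \<epsilon>\<^sub>2" using N(1) eps2 unfolding c_def[symmetric] by linarith
    ultimately have "1 - (c + \<epsilon>\<^sub>2) * exp (- (\<nu>^2 * real r) / (c * (1 + \<nu>/3))) \<le> 0" by (simp only:) simp
    then have "1 - (c + \<epsilon>\<^sub>2) * exp (- (\<nu>^2 * real r) / (c * (1 + \<nu>/3))) - (c + \<epsilon>\<^sub>1) * exp (- (real r / c) * (3 * ln 3 - 2)) \<le> 0"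
      using e2 by linarith
    then show ?thesis unfolding c_def by (intro bexI[of _ "{}"]) auto
  next
    case False
    then have \<nu>0: "0 < \<nu>" and r0: "0 < r" using nu(1) by auto
    obtain b zs where rep: "gauss_rep \<phi> b zs" using gauss_rep_exists[OF S0] by blast
    interpret G: gauss_series b zs by (rule gauss_rep_series(1)[OF rep])
    note ae = gauss_rep_series(2)[OF rep]
    have L2\<phi>: "L2 \<phi>" using S0 by (simp add: in_S0_def)
    have m\<phi>: "\<phi> \<in> borel_measurable borel" using L2\<phi> by auto
    have n\<psi>: "L2_norm G.\<psi> = 1" using L2_norm_cong_AE[OF L2\<phi> G.L2_\<psi> ae] normalized by simp
    \<comment> \<open>From here on \<open>\<phi>\<close> is replaced by its continuous
      representative. Transforms of L^2 functions and the localization operator are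
      unchanged.\<close>
    interpret W: window_domain G.\<psi> G.B \<Omega>
      by unfold_locales (use G.continuous_\<psi> G.\<psi>_bound G.\<psi>_integrable G.L2_\<psi> n\<psi> compact in auto)
    have V: "STFT \<phi> f z = STFT G.\<psi> f z" if "L2 f" for f z
      by (rule STFT_cong_AE[OF m\<phi> G.\<psi>_measurable _ ae]) (use that in auto)
    have "eigenvalue_seq \<Omega> G.\<psi> \<alpha>"
      using eigs eigenvalue_seq_cong[OF loc_op_cong_AE[OF m\<phi> G.\<psi>_measurable _ ae W.V_measurable W.\<Omega>_sets]] by blast
    from W.eigen_split[OF this N(2,3)] obtain e where
      e1: "\<And>k. k \<in> {1..N} \<Longrightarrow> L2 (e k)" and
      e2: "\<And>k. k \<in> {1..N} \<Longrightarrow> AE t in lborel. W.H (e k) t = of_real (\<alpha> k) * e k t" and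
      e3: "\<And>i j. i \<in> {1..N} \<Longrightarrow> j \<in> {1..N} \<Longrightarrow> L2_inner (e i) (e j) = (if i = j then 1 else 0)" and
      e4: "\<And>k. k \<in> {1..N} \<Longrightarrow> 1/2 \<le> \<alpha> k" and
      e5: "\<And>f. f \<in> W.orth (e ` {1..N}) \<Longrightarrow> W.q f \<le> 1/2 * (L2_norm f)^2" by blast
    define d where "d k = e (Suc k)" for k
    have img: "d ` {..<N} = e ` {1..N}"
      unfolding d_def image_Suc_lessThan[symmetric] image_image ..
    have d1: "L2 (d k)" if "k < N" for k using e1 that by (simp add: d_def)
    have d2: "AE t in lborel. W.H (d k) t = of_real (\<alpha> (Suc k)) * d k t" if "k < N" for k using e2 that by (simp add: d_def)
    have d2': "W.eigfun (d k)" if "k < N" for k using d1[OF that] d2[OF that] unfolding W.eigfun_def by blast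
    have d3: "L2_inner (d i) (d j) = (if i = j then 1 else 0)" if "i < N" "j < N" for i j using e3 that by (simp add: d_def)
    interpret R: random_frame "uniform_measure lborel \<Omega>" N "\<lambda>k z. if k < N then STFT G.\<psi> (d k) z else 0" "\<lambda>k. \<alpha> (Suc k) / c" "1 / (2 * c)"
      unfolding c_def
    proof (rule W.random_frame_eigenfunctions[OF pos_meas d1 d2 d3])
      show "1 / (2 * measure lborel \<Omega>) \<le> \<alpha> (Suc k) / measure lborel \<Omega>" if "k < N" for k
        using e4[of "Suc k"] that pos_meas by (simp add: field_simps)
    qed
    let ?I = "{1..r}" and ?D = "uniform_measure lborel \<Omega>"
    define \<theta> where "\<theta> = - ln (1 - 2 * \<nu>)"
    have \<theta>: "0 < \<theta>" unfolding \<theta>_def using \<nu>0 \<nu> by simp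
    have "finite ?I" "0 \<le> 1 / (2 * c)" "0 \<le> real r / c * (1/2 - \<nu>)" using c \<nu> by auto
    from R.frame_lower_tail[OF this(1) \<theta> this(2,3)] obtain G where G: "G \<in> sets (Pi\<^sub>M ?I (\<lambda>_. ?D))"
      and Gp: "1 - real N * exp (- ((1 - exp (- \<theta>)) * (1 / (2 * c)) * real (card ?I)) + \<theta> * (real r / c * (1/2 - \<nu>))) \<le> measure (Pi\<^sub>M ?I (\<lambda>_. ?D)) G"
      and Gf: "\<And>\<omega> x. \<omega> \<in> G \<Longrightarrow> real r / c * (1/2 - \<nu>) * (\<Sum>k<N. (cmod (x k))^2)
        \<le> (\<Sum>j\<in>?I. (cmod (\<Sum>k<N. (if k < N then STFT G.\<psi> (d k) (\<omega> j) else 0) * x k))^2)" by blast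
    \<comment> \<open>By independence the restricted sample vector has the product law, so the event
      found in the product space can be pulled back to \<open>M\<close> with the same
      probability.\<close>
    define X where "X \<omega> = (\<lambda>j\<in>?I. lam j \<omega>)" for \<omega>
    have Xm: "X \<in> measurable M (Pi\<^sub>M ?I (\<lambda>_. borel))" unfolding X_def by (intro measurable_restrict rv)
    have "M.indep_vars (\<lambda>_. borel) lam ?I" by (rule M.indep_vars_subset[OF indep]) simp
    then have dX: "distr M (Pi\<^sub>M ?I (\<lambda>_. borel)) X = Pi\<^sub>M ?I (\<lambda>_. ?D)"
      using M.indep_vars_iff_distr_eq_PiM'[of ?I lam "\<lambda>_. borel"] r0 rv unfolding X_def unif by auto
    have G': "G \<in> sets (Pi\<^sub>M ?I (\<lambda>_. borel))" using G unfolding dX[symmetric] by simp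
    define E1 where "E1 = X -` G \<inter> space M"
    have E1: "E1 \<in> sets M" unfolding E1_def by (rule measurable_sets[OF Xm G'])
    have E1p: "1 - real N * exp (- (\<nu>^2 * real r) / (c * (1 + \<nu>/3))) \<le> M.prob E1"
    proof -
      have "M.prob E1 = measure (Pi\<^sub>M ?I (\<lambda>_. ?D)) G"
        unfolding dX[symmetric] E1_def by (rule measure_distr[symmetric, OF Xm G'])
      moreover have "exp (- ((1 - exp (- \<theta>)) * (1 / (2 * c)) * real (card ?I)) + \<theta> * (real r / c * (1/2 - \<nu>)))
          \<le> exp (- (\<nu>^2 * real r) / (c * (1 + \<nu>/3)))"
        unfolding \<theta>_def exp_le_cancel_iff using chernoff_exponent[OF nu(1) \<nu> c, of "real r"] by simp
      from mult_left_mono[OF this, of "real N"] have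
        "real N * exp (- ((1 - exp (- \<theta>)) * (1 / (2 * c)) * real (card ?I)) + \<theta> * (real r / c * (1/2 - \<nu>)))
          \<le> real N * exp (- (\<nu>^2 * real r) / (c * (1 + \<nu>/3)))" by simp
      ultimately show ?thesis using Gp by linarith
    qed
    have fin: "emeasure lborel \<Omega> < \<infinity>" using compact by (rule emeasure_compact_finite)
    \<comment> \<open>The samples lie in \<open>\<Omega>\<close> only almost surely. This event, of
      probability 1, is needed for them to be covered by the squares.\<close>
    define E2 where "E2 = {\<omega>\<in>space M. \<forall>j\<in>?I. lam j \<omega> \<in> \<Omega>}"
    have E2: "E2 \<in> sets M"
    proof -
      have "{\<omega>\<in>space M. lam j \<omega> \<in> \<Omega>} \<in> sets M" for j using measurable_sets[OF rv[of j] W.\<Omega>_sets] by (simp add: vimage_def Int_def conj_commute)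
      then show ?thesis unfolding E2_def by (intro sets.sets_Collect_finite_All) auto
    qed
    have E2p: "M.prob (space M - E2) = 0"
    proof -
      have "AE \<omega> in M. lam j \<omega> \<in> \<Omega>" for j
      proof -
        have "AE z in ?D. z \<in> \<Omega>" using fin by (intro AE_uniform_measureI) auto
        then have "AE z in distr M borel (lam j). z \<in> \<Omega>" unfolding unif .
        then show ?thesis by (subst (asm) AE_distr_iff) (use rv in auto)
      qed
      then have "AE \<omega> in M. \<forall>j\<in>?I. lam j \<omega> \<in> \<Omega>" by (intro AE_finite_allI) auto
      then have "AE \<omega> in M. \<omega> \<in> E2" using AE_space by eventually_elim (simp add: E2_def)
      then have "M.prob E2 = 1" using E2 by (simp add: M.prob_eq_1)
      then show ?thesis using M.prob_compl[OF E2] by simp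
    qed
    define bad where "bad m = {\<omega>\<in>space M. 3 * (real r / c) < (\<Sum>j\<in>?I. indicator (Q1 (lattice_pt m)) (lam j \<omega>))}" for m
    have bad: "bad m \<in> sets M" for m
    proof -
      have [measurable]: "lam j \<in> measurable M borel" for j by (rule rv)
      have [measurable]: "Q1 (lattice_pt m) \<in> sets borel" by (rule Q1_sets)
      show ?thesis unfolding bad_def by measurable
    qed
    have badp: "M.prob (bad m) \<le> exp (- (real r / c) * (3 * ln 3 - 2))" for m
      using M.uniform_count_tail[OF rv indep unif W.\<Omega>_sets fin pos_meas, of ?I "lattice_pt m"] unfolding bad_def c_def by simp
    \<comment> \<open>The union bound uses one frame event, one null event and at most
      \<open>|\<Omega>| + \<epsilon>\<^sub>1\<close> counting events. The event does not depend on
      \<open>f\<close>, so the inequality holds for all concentrated functions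
      simultaneously.\<close>
    define E where "E = space M - ((space M - E1) \<union> (space M - E2) \<union> (\<Union>m\<in>S. bad m))"
    have U: "(space M - E1) \<union> (space M - E2) \<union> (\<Union>m\<in>S. bad m) \<in> sets M" using E1 E2 bad S(1) by auto
    have E: "E \<in> sets M" unfolding E_def using U by auto
    have "M.prob ((space M - E1) \<union> (space M - E2) \<union> (\<Union>m\<in>S. bad m))
        \<le> M.prob (space M - E1) + M.prob (space M - E2) + M.prob (\<Union>m\<in>S. bad m)"
      using E1 E2 bad S(1) by (intro order_trans[OF measure_Un_le] add_right_mono measure_Un_le) auto
    also have "M.prob (\<Union>m\<in>S. bad m) \<le> (\<Sum>m\<in>S. M.prob (bad m))"
      using bad S(1) by (intro M.finite_measure_subadditive_finite) auto
    also have "\<dots> \<le> (\<Sum>m\<in>S. exp (- (real r / c) * (3 * ln 3 - 2)))" by (intro sum_mono badp)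
    also have "\<dots> \<le> (c + \<epsilon>\<^sub>1) * exp (- (real r / c) * (3 * ln 3 - 2))" using S(2) by (simp add: mult_right_mono)
    finally have "M.prob ((space M - E1) \<union> (space M - E2) \<union> (\<Union>m\<in>S. bad m))
        \<le> real N * exp (- (\<nu>^2 * real r) / (c * (1 + \<nu>/3))) + (c + \<epsilon>\<^sub>1) * exp (- (real r / c) * (3 * ln 3 - 2))"
      using E1p M.prob_compl[OF E1] E2p by linarith
    then have Ep: "1 - real N * exp (- (\<nu>^2 * real r) / (c * (1 + \<nu>/3))) - (c + \<epsilon>\<^sub>1) * exp (- (real r / c) * (3 * ln 3 - 2)) \<le> M.prob E"
      unfolding E_def using M.prob_compl[OF U] by linarith
    have good: "(real r / c) * (1/2 - \<epsilon> - \<nu> - 6 * sqrt 2 * C_phi \<phi> * sqrt \<epsilon>) * (L2_norm f)^2 \<le> (\<Sum>j=1..r. (cmod (STFT \<phi> f (lam j \<omega>)))^2)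
        \<and> (\<Sum>j=1..r. (cmod (STFT \<phi> f (lam j \<omega>)))^2) \<le> real r * (L2_norm f)^2"
      if \<omega>: "\<omega> \<in> E" and conc: "concentrated \<epsilon> \<phi> \<Omega> f" for \<omega> f
    proof
      have f: "L2 f" and fq: "(1 - \<epsilon>) * (L2_norm f)^2 \<le> W.q f"
        using conc unfolding concentrated_def W.q_def by (auto simp: V)
      have w: "\<omega> \<in> space M" "\<omega> \<in> E1" "\<omega> \<in> E2" "\<And>m. m \<in> S \<Longrightarrow> \<omega> \<notin> bad m" using \<omega> by (auto simp: E_def)
      show "(real r / c) * (1/2 - \<epsilon> - \<nu> - 6 * sqrt 2 * C_phi \<phi> * sqrt \<epsilon>) * (L2_norm f)^2 \<le> (\<Sum>j=1..r. (cmod (STFT \<phi> f (lam j \<omega>)))^2)"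
        unfolding V[OF f]
      proof (rule W.sampling_of_frame_and_counts[OF d1 d2' d3 _ f fq _ S(1), of N,
            where K = "(C_const \<phi> * S0_norm \<phi>)^2 * (121/9 / sqrt 2)"])
        show "W.q g \<le> 1/2 * (L2_norm g)^2" if "g \<in> W.orth (d ` {..<N})" for g using e5 that unfolding img by blast
        show "\<exists>m\<in>S. lam j \<omega> \<in> Q1 (lattice_pt m)" if "j \<in> ?I" for j
        proof -
          have "lam j \<omega> \<in> \<Omega>" using w(3) that by (simp add: E2_def)
          then show ?thesis using S(3) by blast
        qed
        show "(\<Sum>j\<in>?I. indicator (Q1 (lattice_pt m)) (lam j \<omega>)) \<le> 3 * (real r / c)" if "m \<in> S" for m
          using w(4)[OF that] w(1) by (auto simp: bad_def)
        show "real r / c * (1/2 - \<nu>) * (\<Sum>k<N. (cmod (x k))^2) \<le> (\<Sum>j\<in>?I. (cmod (\<Sum>k<N. STFT G.\<psi> (d k) (lam j \<omega>) * x k))^2)" for x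
          using Gf[of "X \<omega>" x] w(2) by (simp add: E1_def X_def)
        show "(\<Sum>m\<in>S. (cmod (STFT G.\<psi> g (w m)))^2) \<le> (C_const \<phi> * S0_norm \<phi>)^2 * (121/9 / sqrt 2) * (L2_norm g)^2"
          if "L2 g" "\<And>m. m \<in> S \<Longrightarrow> w m \<in> Q1 (lattice_pt m)" for g w
          using STFT_cell_bound(3)[OF S0 normalized S(1) that(2,1)] by (simp add: V[OF that(1)] mult.assoc)
        show "(C_const \<phi> * S0_norm \<phi>)^2 * (121/9 / sqrt 2) \<le> 6 * (C_phi \<phi>)^2" by (rule cell_constant_le(1)[OF S0 normalized])
      qed (use eps_nonneg \<epsilon> nu(1) \<nu> c C0 in auto)
      have "(\<Sum>j=1..r. (cmod (STFT G.\<psi> f (lam j \<omega>)))^2) \<le> (\<Sum>j=1..r. (L2_norm f)^2)"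
        by (intro sum_mono power_mono W.V_bound f) auto
      then show "(\<Sum>j=1..r. (cmod (STFT \<phi> f (lam j \<omega>)))^2) \<le> real r * (L2_norm f)^2" unfolding V[OF f] by simp
    qed
    show ?thesis
      using E Ep good eps2 unfolding c_def by (intro bexI[of _ E]) auto
  qed
qed

end
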